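(* Let $\mathcal I=[a,b]$ be compact, let $p,q,\Delta$ be real-valued functions on $\mathcal I$ with $\frac1p,q,\Delta$ integrable on $\mathcal I$, $\Delta(t)\ge0$ for $t\in\mathcal I$, and let the Borel (Lebesgue) measure of $\{t\in\mathcal I:\Delta(t)>0\}$ be nonzero. For $\alpha,\beta\in\mathbb R$ consider the eigenvalue problem $$l[y]=-(py')'+qy=\lambda\Delta(t)y,\qquad\cos\alpha\cdot y(a)+\sin\alpha\cdot(py')(a)=0,\quad\cos\beta\cdot y(b)+\sin\beta\cdot(py')(b)=0,$$ and let $EV$ be the set of its eigenvalues and $L_\lambda$ the set of its solutions for given $\lambda$. Then: (i) $EV$ is an infinite countable subset of $\mathbb R$ without finite limit points, and $\dim L_\lambda=1$ for $\lambda\in EV$. (ii) If in addition $p(t)\ge0$, $t\in\mathcal I$, then $EV$ has the properties from (i) and, moreover, is bounded from below (i.e. there exists $\lambda_0\in EV$ such that $\lambda_0\le\lambda$ for all $\lambda\in EV$). (iii) Let $\{\lambda_k\}_1^\infty$ be a sequence of all eigenvalues $\lambda_k\in EV$ and let $v_k\in L_{\lambda_k}$ be an eigenfunction with $\|v_k\|_{\mathcal L^2_\Delta(\mathcal I;\mathbb C)}=1$, $k\in\mathbb N$. Denote by $\mathcal F'$ the set of all $y\in\operatorname{dom}l$ such that $l[y]=\Delta f_y$ a.e. on $\mathcal I$ with some $f_y\in\mathcal L^2_\Delta(\mathcal I;\mathbb C)$ and the two boundary conditions above are satisfied. Then each $y\in\mathcal F'$ admits the eigenfunction expansion $$y(t)=\sum_{k=1}^\infty(y,v_k)_\Delta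 v_k(t),\quad t\in\mathcal I,$$ which converges absolutely and uniformly on $\mathcal I$.
   Context: $\operatorname{dom}l$ is the set of $y\in AC(\mathcal I)$ (complex-valued, absolutely continuous on $\mathcal I$) with $py'\in AC(\mathcal I)$, and $l[y]=-(py')'+qy$ for $y\in\operatorname{dom}l$. $\mathcal L^2_\Delta(\mathcal I;\mathbb C)$ is the space of Borel measurable $f:\mathcal I\to\mathbb C$ with $\int_{\mathcal I}\Delta|f|^2dt<\infty$, with semi-inner product $(f,g)_\Delta=\int_{\mathcal I}\Delta f\overline g\,dt$ and the corresponding seminorm. For $\lambda\in\mathbb C$, $L_\lambda$ is the linear space of all $y\in\operatorname{dom}l$ with $l[y]=\lambda\Delta(t)y$ a.e. on $\mathcal I$ satisfying both boundary conditions; $EV=\{\lambda\in\mathbb C:L_\lambda\ne\{0\}\}$; elements of $L_\lambda$, $\lambda\in EV$, are called eigenfunctions. The eigenvalues in the sequence $\{\lambda_k\}$ are listed without repetition. *)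

theory Defs
  imports "HOL-Analysis.Analysis" "HOL-Library.Function_Algebras"
begin

text \<open>
  Elements of \<open>dom l\<close> (and hence solutions) are functions on \<open>[a, b]\<close> extended by zero to the real
  line, so that the solution space \<open>L\<^sub>\<lambda>\<close> has the right dimension as a space of total functions.
\<close>

text \<open>
  Absolute continuity on \<open>[a, b]\<close> in the \<open>\<epsilon>\<close>-\<open>\<delta>\<close> sense: a division is a finite family of
  non-overlapping compact intervals \<open>K = [Inf K, Sup K]\<close>, here with union contained in \<open>[a, b]\<close>.
\<close>
definition abs_continuous_on :: "real \<Rightarrow> real \<Rightarrow> (real \<Rightarrow> complex) \<Rightarrow> bool" where
  "abs_continuous_on a b f \<longleftrightarrow>
     (\<forall>\<epsilon>>0. \<exists>\<delta>>0. \<forall>D T. D division_of T \<and> T \<subseteq> {a..b} \<and> (\<Sum>K\<in>D. Sup K - Inf K) < \<delta>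
        \<longrightarrow> (\<Sum>K\<in>D. cmod (f (Sup K) - f (Inf K))) < \<epsilon>)"

text \<open>
  \<open>py' = u \<in> AC[a, b]\<close>.  The product \<open>py'\<close> is only defined almost everywhere and is identified
  with its absolutely continuous representative \<open>u\<close>, which is unique on \<open>[a, b]\<close> by continuity
  and normalised to vanish outside.
  Absolutely continuous functions are differentiable almost everywhere, so the differentiability
  clause is no restriction; it makes explicit that \<open>vector_derivative\<close> is a derivative.
\<close>
definition is_quasi_deriv ::
  "real \<Rightarrow> real \<Rightarrow> (real \<Rightarrow> real) \<Rightarrow> (real \<Rightarrow> complex) \<Rightarrow> (real \<Rightarrow> complex) \<Rightarrow> bool" where
  "is_quasi_deriv a b p y u \<longleftrightarrow>
     abs_continuous_on a b u \<and> (\<forall>t. t \<notin> {a..b} \<longrightarrow> u t = 0) \<and>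
     (AE t in lebesgue_on {a..b}. y differentiable (at t within {a..b}) \<and>
        u t = of_real (p t) * vector_derivative y (at t within {a..b}))"

definition quasi_deriv ::
  "real \<Rightarrow> real \<Rightarrow> (real \<Rightarrow> real) \<Rightarrow> (real \<Rightarrow> complex) \<Rightarrow> (real \<Rightarrow> complex)" where
  "quasi_deriv a b p y = (THE u. is_quasi_deriv a b p y u)"

definition sl_dom :: "real \<Rightarrow> real \<Rightarrow> (real \<Rightarrow> real) \<Rightarrow> (real \<Rightarrow> complex) set" where
  "sl_dom a b p =
     {y. abs_continuous_on a b y \<and> (\<forall>t. t \<notin> {a..b} \<longrightarrow> y t = 0) \<and> (\<exists>u. is_quasi_deriv a b p y u)}"

definition sl_expr ::
  "real \<Rightarrow> real \<Rightarrow> (real \<Rightarrow> real) \<Rightarrow> (real \<Rightarrow> real) \<Rightarrow> (real \<Rightarrow> complex) \<Rightarrow> real \<Rightarrow> complex" where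
  "sl_expr a b p q y t =
     - vector_derivative (quasi_deriv a b p y) (at t within {a..b}) + of_real (q t) * y t"

text \<open>
  \<open>l[y] = g\<close> almost everywhere on \<open>[a, b]\<close>.  The differentiability clause holds automatically
  for \<open>y \<in> dom l\<close>, as in \<open>is_quasi_deriv\<close>.
\<close>
definition sl_eq ::
  "real \<Rightarrow> real \<Rightarrow> (real \<Rightarrow> real) \<Rightarrow> (real \<Rightarrow> real) \<Rightarrow> (real \<Rightarrow> complex) \<Rightarrow> (real \<Rightarrow> complex) \<Rightarrow> bool" where
  "sl_eq a b p q y g \<longleftrightarrow>
     (AE t in lebesgue_on {a..b}.
        quasi_deriv a b p y differentiable (at t within {a..b}) \<and> sl_expr a b p q y t = g t)"

definition sl_bc ::
  "real \<Rightarrow> real \<Rightarrow> (real \<Rightarrow> real) \<Rightarrow> real \<Rightarrow> real \<Rightarrow> (real \<Rightarrow> complex) \<Rightarrow> bool" where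
  "sl_bc a b p \<alpha> \<beta> y \<longleftrightarrow>
     of_real (cos \<alpha>) * y a + of_real (sin \<alpha>) * quasi_deriv a b p y a = 0 \<and>
     of_real (cos \<beta>) * y b + of_real (sin \<beta>) * quasi_deriv a b p y b = 0"

definition sl_sols ::
  "real \<Rightarrow> real \<Rightarrow> (real \<Rightarrow> real) \<Rightarrow> (real \<Rightarrow> real) \<Rightarrow> (real \<Rightarrow> real) \<Rightarrow> real \<Rightarrow> real \<Rightarrow>
   complex \<Rightarrow> (real \<Rightarrow> complex) set" where
  "sl_sols a b p q \<Delta> \<alpha> \<beta> \<mu> =
     {y \<in> sl_dom a b p. sl_eq a b p q y (\<lambda>t. \<mu> * of_real (\<Delta> t) * y t) \<and> sl_bc a b p \<alpha> \<beta> y}"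

definition sl_EV ::
  "real \<Rightarrow> real \<Rightarrow> (real \<Rightarrow> real) \<Rightarrow> (real \<Rightarrow> real) \<Rightarrow> (real \<Rightarrow> real) \<Rightarrow> real \<Rightarrow> real \<Rightarrow> complex set" where
  "sl_EV a b p q \<Delta> \<alpha> \<beta> = {\<mu>. sl_sols a b p q \<Delta> \<alpha> \<beta> \<mu> \<noteq> {\<lambda>t. 0}}"

definition wL2 :: "real \<Rightarrow> real \<Rightarrow> (real \<Rightarrow> real) \<Rightarrow> (real \<Rightarrow> complex) set" where
  "wL2 a b \<Delta> =
     {f. f \<in> borel_measurable (restrict_space borel {a..b}) \<and>
         integrable (lebesgue_on {a..b}) (\<lambda>t. \<Delta> t * (cmod (f t))\<^sup>2)}"

definition wip ::
  "real \<Rightarrow> real \<Rightarrow> (real \<Rightarrow> real) \<Rightarrow> (real \<Rightarrow> complex) \<Rightarrow> (real \<Rightarrow> complex) \<Rightarrow> complex" where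
  "wip a b \<Delta> f g = (LINT t|lebesgue_on {a..b}. of_real (\<Delta> t) * f t * cnj (g t))"

definition wnorm :: "real \<Rightarrow> real \<Rightarrow> (real \<Rightarrow> real) \<Rightarrow> (real \<Rightarrow> complex) \<Rightarrow> real" where
  "wnorm a b \<Delta> f = sqrt (Re (wip a b \<Delta> f f))"

definition sl_F ::
  "real \<Rightarrow> real \<Rightarrow> (real \<Rightarrow> real) \<Rightarrow> (real \<Rightarrow> real) \<Rightarrow> (real \<Rightarrow> real) \<Rightarrow> real \<Rightarrow> real \<Rightarrow>
   (real \<Rightarrow> complex) set" where
  "sl_F a b p q \<Delta> \<alpha> \<beta> =
     {y \<in> sl_dom a b p.
        (\<exists>f \<in> wL2 a b \<Delta>. sl_eq a b p q y (\<lambda>t. of_real (\<Delta> t) * f t)) \<and> sl_bc a b p \<alpha> \<beta> y}"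

definition cfun_scale :: "complex \<Rightarrow> (real \<Rightarrow> complex) \<Rightarrow> (real \<Rightarrow> complex)" where
  "cfun_scale c f = (\<lambda>t. c * f t)"

lemma vector_space_cfun_scale: "vector_space cfun_scale"
  by unfold_locales (auto simp: cfun_scale_def fun_eq_iff algebra_simps)

abbreviation cfun_dim :: "(real \<Rightarrow> complex) set \<Rightarrow> nat" where
  "cfun_dim \<equiv> vector_space.dim cfun_scale"

end

theory Submission
  imports Defs "HOL-Complex_Analysis.Great_Picard"
begin

text \<open>
  Write \<open>u\<close> for the quasi-derivative \<open>p y'\<close>.  In integral form the equation \<open>l[y] = g\<close> is the first order
  system \<open>y' = u / p\<close>, \<open>u' = q y - g\<close> with integrable coefficients (\<open>bvp_iff\<close>).  The passage between this
  form and the one with derivatives almost everywhere rests on two facts about the line: an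
  indefinite integral is differentiable almost everywhere with the expected derivative
  (\<open>lebesgue_differentiation\<close>), and an absolutely continuous function is the integral of its derivative
  (\<open>abs_continuous_has_integral\<close>).

  Lagrange's identity makes the problem symmetric.  The weight \<open>\<Delta>\<close> may vanish on a large set, so one
  has to know that an eigenfunction \<open>y\<close> has positive weighted norm.  If \<open>y = 0\<close> almost everywhere on
  \<open>{\<Delta> > 0}\<close>, then \<open>y' = 0\<close> and hence \<open>u = 0\<close> almost everywhere on that set, because a function has
  derivative zero at the accumulation points of its zero set; so \<open>y\<close> and \<open>u\<close> have a common zero and
  vanish identically (\<open>eigen_definite\<close>).  Therefore eigenvalues are real, and since the boundary
  condition at \<open>a\<close> fixes a solution up to a factor, eigenspaces are one-dimensional.

  If \<open>\<mu>\<close> is not an eigenvalue, variation of constants gives the resolvent \<open>R\<close> at \<open>\<mu>\<close> with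
  \<open>|R f (t)| \<le> C \<parallel>f\<parallel>\<close> for all \<open>t\<close>.  Applied to \<open>f = \<Sum> cnj (v\<^sub>k(t) / (\<lambda>\<^sub>k - \<mu>)) v\<^sub>k\<close> with orthonormal eigenfunctions \<open>v\<^sub>k\<close> this
  bound yields \<open>\<Sum> |v\<^sub>k(t) / (\<lambda>\<^sub>k - \<mu>)|\<^sup>2 \<le> C\<^sup>2\<close> (\<open>eigenfunction_kernel_bound\<close>).  For \<open>\<mu> = \<i>\<close>, integration against \<open>\<Delta>\<close>
  shows that every disc contains only finitely many eigenvalues (\<open>finite_EV_ball\<close>).  This gives
  countability, the absence of limit points, and a real \<open>\<mu>\<close> that is not an eigenvalue.

  For such a real \<open>\<mu>\<close> the resolvent is symmetric, compact by the Arzela-Ascoli theorem, and annihilates only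
  functions of norm zero.  A compact symmetric operator that does not vanish on the orthogonal complement of
  some of its eigenvectors has a further eigenvector there (\<open>eigenvector_in_orthocomplement\<close>).
  Hence a function orthogonal to all eigenfunctions has norm zero; as the weighted space has
  infinite dimension, there are infinitely many eigenvalues.  If \<open>y = R g\<close>, the completeness of the weighted space
  turns this into \<open>g = \<Sum> (g, v\<^sub>k) v\<^sub>k\<close> in norm; the resolvent maps norm convergence to
  uniform convergence, which is the expansion of \<open>y\<close>.  Its absolute convergence is the kernel bound together with
  Bessel's inequality.

  Finally let \<open>p \<ge> 0\<close>.  The span of eigenfunctions with negative eigenvalues is a space on which the
  form \<open>\<integral> p |w'|\<^sup>2 + q |w|\<^sup>2\<close> plus boundary terms is negative.  If its dimension exceeds the number of
  points of a grid, it contains some \<open>w \<noteq> 0\<close> vanishing on the grid; for a grid that is fine with respect to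
  \<open>\<integral> 1/p\<close> the first term dominates the others, a contradiction (\<open>finite_negative_EV\<close>).
  So only finitely many eigenvalues are negative, and by discreteness there is a smallest one.
\<close>

section \<open>Differentiation of indefinite integrals\<close>

text \<open>
  At a point of this set some arbitrarily short intervals have mean values of \<open>f\<close> that differ from \<open>f x\<close> by
  at least \<open>k\<close>.  These intervals form a Vitali cover of the set; the deviations over a disjoint finite
  family add up to less than \<open>e * k\<close> by Henstock's lemma, so the total length of the family is less than \<open>e\<close>.
\<close>
lemma lebesgue_differentiation_aux:
  fixes f :: "real \<Rightarrow> 'b::euclidean_space"
  assumes f: "f integrable_on {a..b}" and k: "k > 0"
  shows "negligible {x\<in>{a..b}. \<forall>d>0. \<exists>u v. a \<le> u \<and> u \<le> x \<and> x \<le> v \<and> v \<le> b \<and> u < v \<and> v - u < d \<and>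
           k * (v - u) \<le> norm ((v - u) *\<^sub>R f x - integral {u..v} f)}"
    (is "negligible ?B")
proof (subst negligible_outer_le, intro allI impI)
  fix e :: real assume e: "e > 0"
  have f': "f integrable_on cbox a b" using f by simp
  obtain \<gamma> where \<gamma>: "gauge \<gamma>"
    and hen: "\<And>D. \<lbrakk>D tagged_partial_division_of cbox a b; \<gamma> fine D\<rbrakk> \<Longrightarrow>
             (\<Sum>(x,K)\<in>D. norm (measure lborel K *\<^sub>R f x - integral K f)) < e * k"
    using Henstock_lemma[OF f', of "e * k"] e k by auto
  define K where "K = {(x,u,v). x \<in> ?B \<and> a \<le> u \<and> u \<le> x \<and> x \<le> v \<and> v \<le> b \<and> u < v \<and> {u..v} \<subseteq> \<gamma> x \<and>
           k * (v - u) \<le> norm ((v - u) *\<^sub>R f x - integral {u..v} f)}"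
  define c where "c = (\<lambda>(x::real,u::real,v::real). (u+v)/2)"
  define r where "r = (\<lambda>(x::real,u::real,v::real). (v-u)/2)"
  define J where "J = (\<lambda>(x::real,u::real,v::real). {u..v})"
  have cb: "cball (c i) (r i) = J i" for i
    by (cases i) (auto simp: c_def r_def J_def cball_eq_atLeastAtMost field_simps)
  have Kr: "0 < r i" if "i \<in> K" for i
    using that by (auto simp: K_def r_def)
  have vit: "\<exists>i. i \<in> K \<and> x \<in> cball (c i) (r i) \<and> r i < d" if x: "x \<in> ?B" and d: "0 < d" for x d
  proof -
    have "open (\<gamma> x)" "x \<in> \<gamma> x" using \<gamma> by (auto simp: gauge_def)
    then obtain s where s: "s > 0" "ball x s \<subseteq> \<gamma> x" by (meson openE)
    have "min s d > 0" using s d by simp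
    with x obtain u v where uv: "a \<le> u" "u \<le> x" "x \<le> v" "v \<le> b" "u < v" "v - u < min s d"
       "k * (v - u) \<le> norm ((v - u) *\<^sub>R f x - integral {u..v} f)" by blast
    have "{u..v} \<subseteq> ball x s" using uv by (auto simp: dist_real_def)
    then have "(x,u,v) \<in> K" using uv x s unfolding K_def by blast
    moreover have "x \<in> cball (c (x,u,v)) (r (x,u,v))" unfolding cb J_def using uv by simp
    moreover have "r (x,u,v) < d" using uv by (simp add: r_def)
    ultimately show ?thesis by blast
  qed
  obtain C where C: "countable C" "C \<subseteq> K"
     "pairwise (\<lambda>i j. disjnt (cball (c i) (r i)) (cball (c j) (r j))) C"
     "negligible (?B - (\<Union>i\<in>C. cball (c i) (r i)))"
    by (rule Vitali_covering_theorem_cballs[of K r ?B c, OF Kr vit])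
  have fin: "(\<Sum>i\<in>P. measure lebesgue (J i)) \<le> e" if P: "P \<subseteq> C" "finite P" for P
  proof -
    define D where "D = (\<lambda>i. (fst i, J i)) ` P"
    have PK: "P \<subseteq> K" using P C by auto
    have disj: "disjnt (J i) (J j)" if "i \<in> P" "j \<in> P" "i \<noteq> j" for i j
      using C(3) P that unfolding pairwise_def cb by blast
    have inj: "inj_on (\<lambda>i. (fst i, J i)) P"
    proof (rule inj_onI)
      fix i j assume ij: "i \<in> P" "j \<in> P" "(fst i, J i) = (fst j, J j)"
      have "J i \<noteq> {}" using ij PK by (auto simp: J_def K_def)
      then show "i = j" using disj[OF ij(1,2)] ij(3) by (auto simp: disjnt_def)
    qed
    have tag: "D tagged_partial_division_of cbox a b"
      unfolding tagged_partial_division_of_def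
    proof (intro conjI allI impI)
      show "finite D" using P by (simp add: D_def)
    next
      fix x L assume "(x,L) \<in> D"
      then obtain u v where *: "(x,u,v) \<in> P" "L = {u..v}" by (auto simp: D_def J_def)
      then have "a \<le> u" "u \<le> x" "x \<le> v" "v \<le> b" using PK by (auto simp: K_def)
      then show "x \<in> L" "L \<subseteq> cbox a b" "\<exists>a b. L = cbox a b"
        unfolding *(2) by (auto intro: box_real(2)[symmetric])
    next
      fix x1 K1 x2 K2 assume *: "(x1,K1) \<in> D \<and> (x2,K2) \<in> D \<and> (x1, K1) \<noteq> (x2, K2)"
      obtain i where i: "i \<in> P" "x1 = fst i" "K1 = J i" using * by (auto simp: D_def)
      obtain j where j: "j \<in> P" "x2 = fst j" "K2 = J j" using * by (auto simp: D_def)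
      have "i \<noteq> j" using * i j by auto
      then have "disjnt K1 K2" using disj i j by auto
      then show "interior K1 \<inter> interior K2 = {}"
        using interior_subset by (fastforce simp: disjnt_def)
    qed
    have "J i \<subseteq> \<gamma> (fst i)" if "i \<in> K" for i using that by (cases i) (simp add: K_def J_def)
    then have fine: "\<gamma> fine D" using PK unfolding fine_def D_def by blast
    have "(\<Sum>i\<in>P. k * measure lebesgue (J i)) \<le> (\<Sum>i\<in>P. norm (measure lborel (J i) *\<^sub>R f (fst i) - integral (J i) f))"
    proof (rule sum_mono)
      fix i assume "i \<in> P"
      then have "i \<in> K" using PK by auto
      then show "k * measure lebesgue (J i) \<le> norm (measure lborel (J i) *\<^sub>R f (fst i) - integral (J i) f)"
        by (auto simp: K_def J_def)
    qed
    also have "\<dots> = (\<Sum>(x,K)\<in>D. norm (measure lborel K *\<^sub>R f x - integral K f))"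
      unfolding D_def by (subst sum.reindex[OF inj]) auto
    also have "\<dots> < e * k" by (rule hen[OF tag fine])
    finally have "k * (\<Sum>i\<in>P. measure lebesgue (J i)) < e * k" by (simp add: sum_distrib_left)
    then show ?thesis using k by (simp add: mult.commute)
  qed
  have Jm: "J i \<in> lmeasurable" for i by (cases i) (auto simp: J_def)
  have U: "(\<Union>i\<in>C. J i) \<in> lmeasurable \<and> measure lebesgue (\<Union>i\<in>C. J i) \<le> e"
  proof -
    have "measure lebesgue (\<Union> D') \<le> e" if D': "D' \<subseteq> J ` C" "finite D'" for D'
    proof -
      obtain P where P: "P \<subseteq> C" "finite P" "D' = J ` P" using D' by (meson finite_subset_image)
      have "measure lebesgue (\<Union> D') \<le> (\<Sum>i\<in>P. measure lebesgue (J i))"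
        unfolding P(3) using P Jm by (intro measure_UNION_le) auto
      then show ?thesis using fin[OF P(1,2)] by simp
    qed
    then show ?thesis
      using C(1) Jm by (intro conjI fmeasurable_Union_bound[of "J ` C" lebesgue e] measure_Union_bound[of "J ` C" lebesgue e]) auto
  qed
  obtain Z where Z: "negligible Z" "Z = ?B - (\<Union>i\<in>C. J i)" using C(4) cb by auto
  show "\<exists>T. ?B \<subseteq> T \<and> T \<in> lmeasurable \<and> measure lebesgue T \<le> e"
  proof (intro exI[of _ "Z \<union> (\<Union>i\<in>C. J i)"] conjI)
    show "?B \<subseteq> Z \<union> (\<Union>i\<in>C. J i)" using Z by auto
    show "Z \<union> (\<Union>i\<in>C. J i) \<in> lmeasurable"
      using Z(1) U negligible_imp_measurable by (blast intro: fmeasurable.Un)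
    have "measure lebesgue (Z \<union> (\<Union>i\<in>C. J i)) \<le> measure lebesgue Z + measure lebesgue (\<Union>i\<in>C. J i)"
      using Z(1) U negligible_imp_measurable by (intro measure_Un_le) (auto simp: fmeasurableD)
    then show "measure lebesgue (Z \<union> (\<Union>i\<in>C. J i)) \<le> e"
      using U negligible_imp_measure0[OF Z(1)] by simp
  qed
qed

lemma lebesgue_differentiation:
  fixes f :: "real \<Rightarrow> 'b::euclidean_space"
  assumes f: "f integrable_on {a..b}"
  obtains N where "negligible N"
    "\<And>x. x \<in> {a..b} - N \<Longrightarrow> ((\<lambda>t. integral {a..t} f) has_vector_derivative f x) (at x within {a..b})"
proof -
  define B where "B = (\<lambda>k::real. {x\<in>{a..b}. \<forall>d>0. \<exists>u v. a \<le> u \<and> u \<le> x \<and> x \<le> v \<and> v \<le> b \<and> u < v \<and> v - u < d \<and>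
           k * (v - u) \<le> norm ((v - u) *\<^sub>R f x - integral {u..v} f)})"
  define N where "N = (\<Union>n. B (1 / real (Suc n)))"
  have "negligible N" unfolding N_def
  proof (rule negligible_Union_nat)
    show "negligible (B (1 / real (Suc n)))" for n
      unfolding B_def by (rule lebesgue_differentiation_aux[OF f]) simp
  qed
  moreover have "((\<lambda>t. integral {a..t} f) has_vector_derivative f x) (at x within {a..b})"
    if x: "x \<in> {a..b} - N" for x
    unfolding has_vector_derivative_def has_derivative_within_alt
  proof (intro conjI allI impI bounded_linear_scaleR_left)
    fix e :: real assume e: "e > 0"
    then obtain n where n: "1 / real (Suc n) < e" using nat_approx_posE by blast
    have "x \<notin> B (1 / real (Suc n))" using x by (auto simp: N_def)
    then obtain d where d: "d > 0" and small: "\<And>u v. a \<le> u \<Longrightarrow> u \<le> x \<Longrightarrow> x \<le> v \<Longrightarrow> v \<le> b \<Longrightarrow> u < v \<Longrightarrow> v - u < d \<Longrightarrow>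
           norm ((v - u) *\<^sub>R f x - integral {u..v} f) < 1 / real (Suc n) * (v - u)"
      using x unfolding B_def mem_Collect_eq by (metis DiffD1 not_le)
    have fi: "f integrable_on {u..v}" if "a \<le> u" "v \<le> b" for u v
      using f by (rule integrable_on_subinterval) (use that in auto)
    show "\<exists>d>0. \<forall>y\<in>{a..b}. norm (y - x) < d \<longrightarrow>
            norm (integral {a..y} f - integral {a..x} f - (y - x) *\<^sub>R f x) \<le> e * norm (y - x)"
    proof (intro exI[of _ d] conjI d ballI impI)
      fix y assume y: "y \<in> {a..b}" and yd: "norm (y - x) < d"
      consider "y = x" | "x < y" | "y < x" by linarith
      then show "norm (integral {a..y} f - integral {a..x} f - (y - x) *\<^sub>R f x) \<le> e * norm (y - x)"
      proof cases
        case 2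
        have "integral {a..x} f + integral {x..y} f = integral {a..y} f"
          using x y 2 fi by (intro Henstock_Kurzweil_Integration.integral_combine) auto
        then have "norm (integral {a..y} f - integral {a..x} f - (y - x) *\<^sub>R f x)
            = norm ((y - x) *\<^sub>R f x - integral {x..y} f)"
          by (metis add_diff_cancel_left' norm_minus_commute)
        also have "\<dots> \<le> 1 / real (Suc n) * (y - x)"
          using small[of x y] x y 2 yd by simp
        also have "\<dots> \<le> e * (y - x)" using n 2 by (intro mult_right_mono) auto
        finally show ?thesis using 2 by simp
      next
        case 3
        have "integral {a..y} f + integral {y..x} f = integral {a..x} f"
          using x y 3 fi by (intro Henstock_Kurzweil_Integration.integral_combine) auto
        then have "integral {a..y} f - integral {a..x} f - (y - x) *\<^sub>R f x = (x - y) *\<^sub>R f x - integral {y..x} f"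
          by (simp add: algebra_simps)
        then have "norm (integral {a..y} f - integral {a..x} f - (y - x) *\<^sub>R f x)
            = norm ((x - y) *\<^sub>R f x - integral {y..x} f)" by simp
        also have "\<dots> \<le> 1 / real (Suc n) * (x - y)"
          using small[of y x] x y 3 yd by simp
        also have "\<dots> \<le> e * (x - y)" using n 3 by (intro mult_right_mono) auto
        finally show ?thesis using 3 by simp
      qed auto
    qed
  qed
  ultimately show thesis using that by blast
qed

lemma AE_lebesgue_on_negligible:
  "(AE t in lebesgue_on {a..b::real}. P t) \<longleftrightarrow> negligible {t\<in>{a..b}. \<not> P t}"
proof -
  have "{x. \<not> (x \<in> {a..b} \<longrightarrow> P x)} = {t\<in>{a..b}. \<not> P t}" by auto
  then have "(AE t in lebesgue. t \<in> {a..b} \<longrightarrow> P t) \<longleftrightarrow> (\<exists>N. negligible N \<and> {t\<in>{a..b}. \<not> P t} \<subseteq> N)"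
    by (auto simp: eventually_ae_filter negligible_iff_null_sets)
  also have "\<dots> \<longleftrightarrow> negligible {t\<in>{a..b}. \<not> P t}" using negligible_subset by blast
  finally show ?thesis by (simp add: AE_restrict_space_iff)
qed

section \<open>Absolutely continuous functions as indefinite integrals\<close>

text \<open>
  Apart from an integrable part \<open>max 0 (|f| - n)\<close> of small integral, \<open>|f|\<close> is at most \<open>n\<close>.
\<close>
lemma abs_continuous_indefinite_integral:
  fixes f F :: "real \<Rightarrow> complex"
  assumes f: "integrable (lebesgue_on {a..b}) f"
    and F: "\<And>t. t \<in> {a..b} \<Longrightarrow> F t = F a + integral {a..t} f"
  shows "abs_continuous_on a b F"
  unfolding abs_continuous_on_def
proof (intro allI impI)
  fix e :: real assume e: "e > 0"
  have nf: "integrable (lebesgue_on {a..b}) (\<lambda>t. norm (f t))" using f by simp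
  define g where "g = (\<lambda>(n::nat) t. max 0 (norm (f t) - n))"
  have fm: "f \<in> borel_measurable (lebesgue_on {a..b})" using f by auto
  have "(\<lambda>n. integral\<^sup>L (lebesgue_on {a..b}) (g n)) \<longlonglongrightarrow> integral\<^sup>L (lebesgue_on {a..b}) (\<lambda>t. 0)"
  proof (rule integral_dominated_convergence[where w = "\<lambda>t. norm (f t)"])
    show "AE x in lebesgue_on {a..b}. (\<lambda>i. g i x) \<longlonglongrightarrow> 0"
    proof (rule AE_I2, rule tendsto_eventually)
      fix x
      obtain m :: nat where "norm (f x) \<le> m" using real_arch_simple by blast
      then show "\<forall>\<^sub>F i in sequentially. g i x = 0"
        by (intro eventually_sequentiallyI[of m]) (auto simp: g_def)
    qed
  qed (use nf fm in \<open>auto simp: g_def\<close>)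
  then have "\<forall>\<^sub>F n in sequentially. integral\<^sup>L (lebesgue_on {a..b}) (g n) < e / 2"
    using e by (intro order_tendstoD(2)) auto
  then obtain n where n: "integral\<^sup>L (lebesgue_on {a..b}) (g n) < e / 2"
    by (auto simp: eventually_sequentially)
  have gi: "integrable (lebesgue_on {a..b}) (g n)"
    by (rule Bochner_Integration.integrable_bound[OF nf]) (use fm in \<open>auto simp: g_def\<close>)
  have g_on: "g n integrable_on {a..b}" using gi by (rule integrable_on_lebesgue_on) auto
  have gint: "integral {a..b} (g n) < e / 2" using n lebesgue_integral_eq_integral[OF gi] by simp
  have f_on: "f integrable_on {a..b}" using f by (rule integrable_on_lebesgue_on) auto
  have nf_on: "(\<lambda>t. norm (f t)) integrable_on {a..b}" using nf by (rule integrable_on_lebesgue_on) auto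
  define d where "d = e / (2 * (real n + 1))"
  have d: "d > 0" using e by (simp add: d_def)
  show "\<exists>\<delta>>0. \<forall>D T. D division_of T \<and> T \<subseteq> {a..b} \<and> (\<Sum>K\<in>D. Sup K - Inf K) < \<delta> \<longrightarrow>
           (\<Sum>K\<in>D. cmod (F (Sup K) - F (Inf K))) < e"
  proof (intro exI[of _ d] conjI d allI impI, elim conjE)
    fix D T assume D: "D division_of T" and T: "T \<subseteq> {a..b}" and len: "(\<Sum>K\<in>D. Sup K - Inf K) < d"
    have each: "cmod (F (Sup K) - F (Inf K)) \<le> integral K (g n) + real n * (Sup K - Inf K) \<and> g n integrable_on K"
      if K: "K \<in> D" for K
    proof -
      obtain u v where uv: "K = {u..v}" "u \<le> v"
        using division_ofD(3,4)[OF D K] by (metis atLeastatMost_empty_iff2 box_real(2))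
      have sub: "{u..v} \<subseteq> {a..b}" using division_ofD(2)[OF D K] T uv(1) by blast
      then have ab: "a \<le> u" "v \<le> b" using uv(2) by (auto simp: subset_iff)
      have "integral {a..u} f + integral {u..v} f = integral {a..v} f"
        using ab uv f_on by (intro Henstock_Kurzweil_Integration.integral_combine) (auto intro: integrable_on_subinterval)
      then have "F v - F u = integral {u..v} f"
        using F[of u] F[of v] ab uv by (simp add: algebra_simps)
      moreover have "norm (integral {u..v} f) \<le> integral {u..v} (\<lambda>t. g n t + real n)"
      proof (rule integral_norm_bound_integral)
        show "f integrable_on {u..v}" using f_on sub by (rule integrable_on_subinterval)
        show "(\<lambda>t. g n t + real n) integrable_on {u..v}"
          using integrable_on_subinterval[OF g_on sub] by (intro integrable_add) auto
      qed (auto simp: g_def)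
      moreover have "integral {u..v} (\<lambda>t. g n t + real n) = integral {u..v} (g n) + real n * (v - u)"
        using integrable_on_subinterval[OF g_on sub] uv by (subst Henstock_Kurzweil_Integration.integral_add) auto
      ultimately show ?thesis using uv integrable_on_subinterval[OF g_on sub] by simp
    qed
    have gT: "g n integrable_on T"
      using D each by (auto intro: integrable_combine_division)
    have "(\<Sum>K\<in>D. cmod (F (Sup K) - F (Inf K))) \<le> (\<Sum>K\<in>D. integral K (g n) + real n * (Sup K - Inf K))"
      using each by (intro sum_mono) auto
    also have "\<dots> = integral T (g n) + real n * (\<Sum>K\<in>D. Sup K - Inf K)"
      by (simp add: sum.distrib sum_distrib_left integral_combine_division_topdown[OF gT D])
    also have "integral T (g n) \<le> integral {a..b} (g n)"
      by (rule integral_subset_le[OF T gT g_on]) (auto simp: g_def)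
    also have "real n * (\<Sum>K\<in>D. Sup K - Inf K) \<le> real n * d"
      using len by (intro mult_left_mono) auto
    also have "real n * d \<le> e / 2" using e unfolding d_def by (simp add: field_simps)
    finally show "(\<Sum>K\<in>D. cmod (F (Sup K) - F (Inf K))) < e" using gint by simp
  qed
qed


text \<open>
  The Riemann sums of a gauge converge to the increment of \<open>F\<close>.  On the null set where the derivative fails
  the gauge is an open set of measure so small that absolute continuity controls \<open>F\<close> over it.
\<close>
lemma abs_continuous_has_integral:
  fixes F f :: "real \<Rightarrow> complex"
  assumes ab: "a \<le> b" and AC: "abs_continuous_on a b F"
    and der: "AE t in lebesgue_on {a..b}. (F has_vector_derivative f t) (at t within {a..b})"
  shows "(f has_integral (F b - F a)) {a..b}"
proof -
  define N where "N = {t\<in>{a..b}. \<not> (F has_vector_derivative f t) (at t within {a..b})}"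
  have N: "negligible N" using der by (simp add: AE_lebesgue_on_negligible N_def)
  define g where "g = (\<lambda>t. if t \<in> N then 0 else f t)"
  have "(g has_integral (F b - F a)) (cbox a b)"
    unfolding has_integral
  proof (intro allI impI)
    fix e :: real assume e: "e > 0"
    obtain \<delta> where \<delta>: "\<delta> > 0" and AC': "\<And>D T. D division_of T \<Longrightarrow> T \<subseteq> {a..b} \<Longrightarrow> (\<Sum>K\<in>D. Sup K - Inf K) < \<delta>
        \<Longrightarrow> (\<Sum>K\<in>D. cmod (F (Sup K) - F (Inf K))) < e / 2"
      using AC[unfolded abs_continuous_on_def, rule_format, OF half_gt_zero[OF e]] by blast
    obtain U where U: "open U" "N \<subseteq> U" "U - N \<in> lmeasurable" "emeasure lebesgue (U - N) < ennreal \<delta>"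
      using sets_lebesgue_outer_open[of N \<delta>] N \<delta> by (auto simp: negligible_imp_sets)
    have Ulm: "U \<in> lmeasurable"
      using U(2,3) N by (metis Diff_partition Un_commute fmeasurable.Un negligible_imp_measurable)
    have Um: "measure lebesgue U < \<delta>"
    proof -
      have "measure lebesgue U \<le> measure lebesgue (U - N) + measure lebesgue N"
        using U(2,3) N measure_Un_le[of "U - N" lebesgue N]
        by (metis Diff_partition Un_commute fmeasurableD negligible_imp_sets)
      also have "\<dots> = measure lebesgue (U - N)" using N by (simp add: negligible_imp_measure0)
      also have "\<dots> < \<delta>" using U(3,4) \<delta> by (simp add: emeasure_eq_measure2 ennreal_less_iff)
      finally show ?thesis .
    qed
    define e' where "e' = e / (2 * (b - a + 1))"
    have e': "e' > 0" using e ab by (simp add: e'_def)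
    have "\<exists>d>0. \<forall>y\<in>{a..b}. norm (y - t) < d \<longrightarrow> norm (F y - F t - (y - t) *\<^sub>R f t) \<le> e' * norm (y - t)"
      if "t \<in> {a..b} - N" for t
      using that e' unfolding N_def has_vector_derivative_def has_derivative_within_alt by auto
    then obtain d where d: "\<And>t. t \<in> {a..b} - N \<Longrightarrow> d t > 0"
      "\<And>t y. t \<in> {a..b} - N \<Longrightarrow> y \<in> {a..b} \<Longrightarrow> norm (y - t) < d t \<Longrightarrow>
        norm (F y - F t - (y - t) *\<^sub>R f t) \<le> e' * norm (y - t)"
      by metis
    define \<gamma> where "\<gamma> = (\<lambda>t. if t \<in> N then U else if t \<in> {a..b} then ball t (d t) else UNIV)"
    have gau: "gauge \<gamma>" using U d by (auto simp: gauge_def \<gamma>_def)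
    show "\<exists>\<gamma>. gauge \<gamma> \<and> (\<forall>D. D tagged_division_of cbox a b \<and> \<gamma> fine D \<longrightarrow>
              norm ((\<Sum>(x,k)\<in>D. measure lborel k *\<^sub>R g x) - (F b - F a)) < e)"
    proof (intro exI[of _ \<gamma>] conjI gau allI impI, elim conjE)
      fix D assume D: "D tagged_division_of cbox a b" and fine: "\<gamma> fine D"
      have finD: "finite D" using D by blast
      define \<Phi> where "\<Phi> = (\<lambda>(x::real,K::real set). measure lborel K *\<^sub>R g x - (F (Sup K) - F (Inf K)))"
      define A where "A = {(x,K)\<in>D. x \<in> N}"
      have AD: "A \<subseteq> D" by (auto simp: A_def)
      have finA: "finite A" using AD finD finite_subset by blast
      have form: "\<exists>u v. K = {u..v} \<and> u \<le> x \<and> x \<le> v \<and> a \<le> u \<and> v \<le> b" if xK: "(x,K) \<in> D" for x K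
      proof -
        obtain u v where "K = cbox u v" using tagged_division_ofD(4)[OF D xK] by blast
        moreover have "x \<in> K" "K \<subseteq> cbox a b" using tagged_division_ofD(2,3)[OF D xK] by auto
        ultimately show ?thesis by (intro exI[of _ u] exI[of _ v]) auto
      qed
      have "F b - F a = (\<Sum>(x,K)\<in>D. F (Sup K) - F (Inf K))"
        using additive_tagged_division_1[OF ab, of D F] D by simp
      then have "(\<Sum>(x,k)\<in>D. measure lborel k *\<^sub>R g x) - (F b - F a) = sum \<Phi> D"
        by (simp add: \<Phi>_def sum_subtractf case_prod_unfold)
      also have "\<dots> = sum \<Phi> (D - A) + sum \<Phi> A" using finD AD by (simp add: sum.subset_diff)
      finally have eq: "(\<Sum>(x,k)\<in>D. measure lborel k *\<^sub>R g x) - (F b - F a) = sum \<Phi> (D - A) + sum \<Phi> A" .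
      \<comment> \<open>Off the exceptional set the gauge makes each increment of \<open>F\<close> nearly \<open>f x\<close> times the length.\<close>
      have "norm (sum \<Phi> (D - A)) \<le> (\<Sum>(x,K)\<in>D - A. e' * measure lborel K)"
      proof (rule sum_norm_le, clarify)
        fix x K assume xK: "(x,K) \<in> D" "(x,K) \<notin> A"
        then have xN: "x \<notin> N" by (auto simp: A_def)
        obtain u v where uv: "K = {u..v}" "u \<le> x" "x \<le> v" "a \<le> u" "v \<le> b" using form[OF xK(1)] by auto
        have "K \<subseteq> \<gamma> x" using fine xK by (auto simp: fine_def)
        then have sub: "K \<subseteq> ball x (d x)" using xN uv by (auto simp: \<gamma>_def split: if_splits)
        have "u \<in> K" "v \<in> K" using uv by auto
        then have uvd: "norm (u - x) < d x" "norm (v - x) < d x"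
          using sub by (auto simp: dist_real_def subset_iff)
        have 1: "norm (F v - F x - (v - x) *\<^sub>R f x) \<le> e' * (v - x)"
          using d(2)[of x v] uv xN uvd by simp
        have 2: "norm (F u - F x - (u - x) *\<^sub>R f x) \<le> e' * (x - u)"
          using d(2)[of x u] uv xN uvd by simp
        have "\<Phi> (x,K) = (F u - F x - (u - x) *\<^sub>R f x) - (F v - F x - (v - x) *\<^sub>R f x)"
          using uv xN by (simp add: \<Phi>_def g_def algebra_simps)
        also have "norm \<dots> \<le> e' * (x - u) + e' * (v - x)"
          using 1 2 norm_triangle_ineq4 by (smt (verit, best))
        also have "\<dots> = e' * measure lborel K" using uv by (simp add: algebra_simps)
        finally show "norm (\<Phi> (x,K)) \<le> e' * measure lborel K" .
      qed
      also have "\<dots> \<le> (\<Sum>(x,K)\<in>D. e' * measure lborel K)"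
        using finD e' by (intro sum_mono2) auto
      also have "\<dots> = e' * (b - a)"
        using additive_content_tagged_division[OF D] ab by (simp add: case_prod_unfold flip: sum_distrib_left)
      also have "\<dots> < e / 2"
        using e ab by (simp add: e'_def field_simps)
      finally have part1: "norm (sum \<Phi> (D - A)) < e / 2" .
      \<comment> \<open>Intervals tagged in \<open>N\<close> lie in the small open set \<open>U\<close>, so absolute continuity bounds the
         total increment of \<open>F\<close> over them.\<close>
      define A' where "A' = snd ` A"
      have inj: "inj_on snd A"
      proof (rule inj_onI)
        fix i j assume ij: "i \<in> A" "j \<in> A" "snd i = snd j"
        then obtain x1 x2 K where i: "i = (x1,K)" and j: "j = (x2,K)" by (metis prod.collapse)
        have x: "(x1,K) \<in> A" "(x2,K) \<in> A" using ij i j by auto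
        have "x1 = x2"
        proof (rule ccontr)
          assume ne: "x1 \<noteq> x2"
          have "interior K \<inter> interior K = {}"
            using tagged_division_ofD(5)[OF D, of x1 K x2 K] x ne AD by auto
          moreover obtain u v where uv: "K = {u..v}" "u \<le> x1" "x1 \<le> v" using form[of x1 K] x AD by auto
          moreover have "u \<le> x2" "x2 \<le> v" using form[of x2 K] x AD uv by auto
          ultimately show False using ne by (auto simp: interior_atLeastAtMost_real)
        qed
        then show "i = j" using i j by simp
      qed
      have div: "A' division_of \<Union>A'"
        unfolding A'_def
        by (rule partial_division_of_tagged_division, rule tagged_partial_division_subset[OF _ AD])
           (use D in \<open>auto simp: tagged_division_of_def\<close>)
      have sub: "\<Union>A' \<subseteq> {a..b}" using AD form by (fastforce simp: A'_def)
      have "K \<subseteq> U" if "(x,K) \<in> A" for x K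
      proof -
        have "K \<subseteq> \<gamma> x" "x \<in> N" using that fine by (auto simp: A_def fine_def)
        then show ?thesis by (simp add: \<gamma>_def)
      qed
      then have AU: "\<Union>A' \<subseteq> U" unfolding A'_def by fastforce
      have "(\<Sum>K\<in>A'. Sup K - Inf K) = (\<Sum>K\<in>A'. measure lebesgue K)"
      proof (rule sum.cong[OF refl])
        fix K assume "K \<in> A'"
        then obtain x where "(x,K) \<in> D" using AD by (auto simp: A'_def)
        then show "Sup K - Inf K = measure lebesgue K" using form by fastforce
      qed
      also have "\<dots> = measure lebesgue (\<Union>A')" by (rule content_division[OF div])
      also have "\<dots> \<le> measure lebesgue U"
        using lmeasurable_division[OF div] Ulm AU by (intro measure_mono_fmeasurable) auto
      also have "\<dots> < \<delta>" by (rule Um)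
      finally have "(\<Sum>K\<in>A'. cmod (F (Sup K) - F (Inf K))) < e / 2"
        by (rule AC'[OF div sub])
      moreover have "norm (sum \<Phi> A) \<le> (\<Sum>K\<in>A'. cmod (F (Sup K) - F (Inf K)))"
        unfolding A'_def sum.reindex[OF inj] comp_def
        by (rule sum_norm_le) (auto simp: \<Phi>_def A_def g_def norm_minus_commute)
      ultimately have part2: "norm (sum \<Phi> A) < e / 2" by linarith
      show "norm ((\<Sum>(x,k)\<in>D. measure lborel k *\<^sub>R g x) - (F b - F a)) < e"
        unfolding eq using part1 part2 norm_triangle_ineq[of "sum \<Phi> (D - A)" "sum \<Phi> A"] by linarith
    qed
  qed
  then show ?thesis
    using N by (subst has_integral_spike_eq[of N _ g f]) (auto simp: g_def)
qed


lemma abs_continuous_on_subinterval: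
  "abs_continuous_on a b F \<Longrightarrow> {c..d} \<subseteq> {a..b} \<Longrightarrow> abs_continuous_on c d F"
  unfolding abs_continuous_on_def by (meson subset_trans)

text \<open>
  The form in which absolute continuity is used from here on.  The Henstock integral is
  convenient for subintervals; integrability is demanded in Lebesgue's sense.
\<close>
definition primitive :: "real \<Rightarrow> real \<Rightarrow> (real \<Rightarrow> complex) \<Rightarrow> (real \<Rightarrow> complex) \<Rightarrow> bool" where
  "primitive a b f F \<longleftrightarrow> integrable (lebesgue_on {a..b}) f \<and> (\<forall>t\<in>{a..b}. F t = F a + integral {a..t} f)"

lemma
  assumes "primitive a b f F"
  shows primitive_integrable: "integrable (lebesgue_on {a..b}) f"
    and primitive_eq: "\<And>t. t \<in> {a..b} \<Longrightarrow> F t = F a + integral {a..t} f"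
    and primitive_abs_continuous: "abs_continuous_on a b F"
  using assms unfolding primitive_def by (blast intro: abs_continuous_indefinite_integral)+

lemma primitive_integrable_on: "primitive a b f F \<Longrightarrow> f integrable_on {a..b}"
  by (rule integrable_on_lebesgue_on[OF primitive_integrable]) auto

lemma primitive_continuous:
  assumes "primitive a b f F" shows "continuous_on {a..b} F"
proof -
  have "continuous_on {a..b} (\<lambda>t. F a + integral {a..t} f)"
    by (intro continuous_intros indefinite_integral_continuous_1 primitive_integrable_on[OF assms])
  then show ?thesis by (rule continuous_on_eq) (metis primitive_eq[OF assms])
qed

lemma primitive_has_derivative:
  assumes "primitive a b f F"
  shows "AE t in lebesgue_on {a..b}. (F has_vector_derivative f t) (at t within {a..b})"
proof -
  obtain N where N: "negligible N"
    "\<And>x. x \<in> {a..b} - N \<Longrightarrow> ((\<lambda>t. integral {a..t} f) has_vector_derivative f x) (at x within {a..b})"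
    using lebesgue_differentiation[OF primitive_integrable_on[OF assms]] by blast
  have "(F has_vector_derivative f t) (at t within {a..b})" if t: "t \<in> {a..b} - N" for t
  proof -
    have "((\<lambda>t. F a + integral {a..t} f) has_vector_derivative (0 + f t)) (at t within {a..b})"
      by (intro has_vector_derivative_add N(2)[OF t] has_vector_derivative_const)
    then have "((\<lambda>t. F a + integral {a..t} f) has_vector_derivative f t) (at t within {a..b})" by simp
    then show ?thesis
      by (rule has_vector_derivative_transform[rotated 2]) (use t primitive_eq[OF assms] in blast)+
  qed
  then show ?thesis
    unfolding AE_lebesgue_on_negligible by (intro negligible_subset[OF N(1)]) blast
qed

lemma primitiveI:
  assumes ab: "a \<le> b" and f: "integrable (lebesgue_on {a..b}) f" and AC: "abs_continuous_on a b F"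
    and der: "AE t in lebesgue_on {a..b}. (F has_vector_derivative f t) (at t within {a..b})"
  shows "primitive a b f F"
  unfolding primitive_def
proof (intro conjI ballI f)
  fix t assume t: "t \<in> {a..b}"
  have "(f has_integral (F t - F a)) {a..t}"
  proof (rule abs_continuous_has_integral)
    show "abs_continuous_on a t F" using AC by (rule abs_continuous_on_subinterval) (use t in auto)
    have sub: "{a..t} \<subseteq> {a..b}" using t by auto
    have "{s \<in> {a..t}. \<not> (F has_vector_derivative f s) (at s within {a..t})} \<subseteq>
          {s \<in> {a..b}. \<not> (F has_vector_derivative f s) (at s within {a..b})}"
      using has_vector_derivative_within_subset[OF _ sub] sub by blast
    then show "AE s in lebesgue_on {a..t}. (F has_vector_derivative f s) (at s within {a..t})"
      using der negligible_subset unfolding AE_lebesgue_on_negligible by blast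
  qed (use t in auto)
  then show "F t = F a + integral {a..t} f" by (simp add: integral_unique)
qed

lemma continuous_on_interval_bounded:
  fixes G :: "real \<Rightarrow> 'a::real_normed_vector"
  assumes "continuous_on {a..b} G"
  obtains B where "B > 0" "\<And>t. t \<in> {a..b} \<Longrightarrow> norm (G t) \<le> B"
proof -
  have "bounded (G ` {a..b})"
    using assms by (auto intro!: compact_imp_bounded compact_continuous_image)
  then show thesis using that by (metis bounded_pos imageI)
qed

text \<open>
  Gives absolute continuity of products and of smooth functions of absolutely continuous functions.
\<close>
lemma abs_continuous_on_dominated:
  assumes F: "abs_continuous_on a b F" and G: "abs_continuous_on a b G" and C: "C > 0"
    and dom: "\<And>s t. s \<in> {a..b} \<Longrightarrow> t \<in> {a..b} \<Longrightarrow>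
       cmod (h s - h t) \<le> C * cmod (F s - F t) + C * cmod (G s - G t)"
  shows "abs_continuous_on a b h"
  unfolding abs_continuous_on_def
proof (intro allI impI)
  fix e :: real assume e: "e > 0"
  then have e': "e / (2 * C) > 0" using C by simp
  obtain d1 where d1: "d1 > 0" "\<forall>D T. D division_of T \<and> T \<subseteq> {a..b} \<and> (\<Sum>K\<in>D. Sup K - Inf K) < d1
      \<longrightarrow> (\<Sum>K\<in>D. cmod (F (Sup K) - F (Inf K))) < e / (2 * C)"
    using F[unfolded abs_continuous_on_def, rule_format, OF e'] by blast
  obtain d2 where d2: "d2 > 0" "\<forall>D T. D division_of T \<and> T \<subseteq> {a..b} \<and> (\<Sum>K\<in>D. Sup K - Inf K) < d2
      \<longrightarrow> (\<Sum>K\<in>D. cmod (G (Sup K) - G (Inf K))) < e / (2 * C)"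
    using G[unfolded abs_continuous_on_def, rule_format, OF e'] by blast
  show "\<exists>d>0. \<forall>D T. D division_of T \<and> T \<subseteq> {a..b} \<and> (\<Sum>K\<in>D. Sup K - Inf K) < d
      \<longrightarrow> (\<Sum>K\<in>D. cmod (h (Sup K) - h (Inf K))) < e"
  proof (intro exI[of _ "min d1 d2"] conjI allI impI, goal_cases)
    case 1 then show ?case using d1 d2 by simp
  next
    case (2 D T)
    have each: "cmod (h (Sup K) - h (Inf K)) \<le>
        C * cmod (F (Sup K) - F (Inf K)) + C * cmod (G (Sup K) - G (Inf K))" if K: "K \<in> D" for K
    proof -
      obtain u v where uv: "K = {u..v}" "u \<le> v"
        using division_ofD(3,4)[of D T K] 2 K by (metis atLeastatMost_empty_iff2 box_real(2))
      have "{u..v} \<subseteq> {a..b}" using division_ofD(2)[of D T K] 2 K uv(1) by blast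
      then show ?thesis using dom[of v u] uv by auto
    qed
    have "(\<Sum>K\<in>D. cmod (h (Sup K) - h (Inf K)))
       \<le> C * (\<Sum>K\<in>D. cmod (F (Sup K) - F (Inf K))) + C * (\<Sum>K\<in>D. cmod (G (Sup K) - G (Inf K)))"
      unfolding sum_distrib_left sum.distrib[symmetric] using each by (rule sum_mono)
    also have "\<dots> < C * (e / (2 * C)) + C * (e / (2 * C))"
      using d1(2) d2(2) 2 C by (intro add_strict_mono mult_strict_left_mono) auto
    also have "\<dots> = e" using C by simp
    finally show ?case .
  qed
qed

lemma abs_continuous_on_mult:
  assumes F: "abs_continuous_on a b F" "continuous_on {a..b} F"
    and G: "abs_continuous_on a b G" "continuous_on {a..b} G"
  shows "abs_continuous_on a b (\<lambda>t. F t * G t)"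
proof -
  obtain A B where A: "A > 0" "\<And>t. t \<in> {a..b} \<Longrightarrow> cmod (F t) \<le> A"
      and B: "B > 0" "\<And>t. t \<in> {a..b} \<Longrightarrow> cmod (G t) \<le> B"
    using continuous_on_interval_bounded[OF F(2)] continuous_on_interval_bounded[OF G(2)] by metis
  show ?thesis
  proof (rule abs_continuous_on_dominated[OF F(1) G(1), of "A + B"])
    fix s t assume st: "s \<in> {a..b}" "t \<in> {a..b}"
    have "F s * G s - F t * G t = (F s - F t) * G s + F t * (G s - G t)" by (simp add: algebra_simps)
    also have "cmod \<dots> \<le> cmod (F s - F t) * cmod (G s) + cmod (F t) * cmod (G s - G t)"
      by (metis norm_mult norm_triangle_ineq)
    also have "\<dots> \<le> cmod (F s - F t) * (A + B) + (A + B) * cmod (G s - G t)"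
      using A(1) B(1) A(2)[OF st(2)] B(2)[OF st(1)] by (intro add_mono mult_left_mono mult_right_mono) auto
    finally show "cmod (F s * G s - F t * G t) \<le> (A + B) * cmod (F s - F t) + (A + B) * cmod (G s - G t)"
      by (simp add: mult.commute)
  qed (use A B in simp)
qed

lemma integrable_mult_continuous:
  fixes f G :: "real \<Rightarrow> complex"
  assumes f: "integrable (lebesgue_on {a..b}) f" and G: "continuous_on {a..b} G"
  shows "integrable (lebesgue_on {a..b}) (\<lambda>t. f t * G t)"
proof -
  obtain B where B: "\<And>t. t \<in> {a..b} \<Longrightarrow> cmod (G t) \<le> B"
    using continuous_on_interval_bounded[OF G] by metis
  have Gm: "G \<in> borel_measurable (lebesgue_on {a..b})"
    using G by (intro continuous_imp_measurable_on_sets_lebesgue) auto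
  have fm: "f \<in> borel_measurable (lebesgue_on {a..b})" using f by auto
  have "integrable (lebesgue_on {a..b}) (\<lambda>t. B * cmod (f t))" using f by simp
  then show ?thesis
  proof (rule Bochner_Integration.integrable_bound)
    show "AE t in lebesgue_on {a..b}. norm (f t * G t) \<le> norm (B * cmod (f t))"
    proof (rule AE_I2)
      fix t assume "t \<in> space (lebesgue_on {a..b})"
      then have t: "t \<in> {a..b}" by simp
      have "norm (f t * G t) \<le> B * cmod (f t)"
        using mult_left_mono[OF B[OF t], of "cmod (f t)"] by (simp add: norm_mult mult.commute)
      then show "norm (f t * G t) \<le> norm (B * cmod (f t))" by simp
    qed
  qed (use fm Gm in auto)
qed

text \<open>
  The product rule in integral form, that is, integration by parts.
\<close>
lemma primitive_mult:
  assumes ab: "a \<le> b" and F: "primitive a b f F" and G: "primitive a b g G"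
  shows "primitive a b (\<lambda>t. f t * G t + F t * g t) (\<lambda>t. F t * G t)"
proof (rule primitiveI[OF ab])
  show "integrable (lebesgue_on {a..b}) (\<lambda>t. f t * G t + F t * g t)"
    using integrable_mult_continuous[OF primitive_integrable[OF F] primitive_continuous[OF G]]
      integrable_mult_continuous[OF primitive_integrable[OF G] primitive_continuous[OF F]]
    by (simp add: mult.commute)
  show "abs_continuous_on a b (\<lambda>t. F t * G t)"
    by (intro abs_continuous_on_mult primitive_abs_continuous[OF F] primitive_abs_continuous[OF G]
      primitive_continuous[OF F] primitive_continuous[OF G])
  show "AE t in lebesgue_on {a..b}. ((\<lambda>t. F t * G t) has_vector_derivative f t * G t + F t * g t) (at t within {a..b})"
    using primitive_has_derivative[OF F] primitive_has_derivative[OF G]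
    by eventually_elim (auto intro!: derivative_eq_intros)
qed

lemma primitive_cong:
  assumes F: "primitive a b f F" and f: "\<And>t. t \<in> {a..b} \<Longrightarrow> f t = g t" and G: "\<And>t. t \<in> {a..b} \<Longrightarrow> F t = G t"
  shows "primitive a b g G"
  unfolding primitive_def
proof (intro conjI ballI)
  show "integrable (lebesgue_on {a..b}) g"
    using primitive_integrable[OF F] f by (subst Bochner_Integration.integrable_cong[of _ _ g f]) auto
  fix t assume t: "t \<in> {a..b}"
  have "integral {a..t} f = integral {a..t} g"
    using t by (intro integral_cong f) auto
  moreover have "a \<in> {a..b}" using t by auto
  ultimately show "G t = G a + integral {a..t} g"
    using primitive_eq[OF F t] G[OF t] G[of a] by simp
qed

lemma primitive_add:
  assumes "primitive a b f F" "primitive a b g G"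
  shows "primitive a b (\<lambda>t. f t + g t) (\<lambda>t. F t + G t)"
  unfolding primitive_def
proof (intro conjI ballI)
  fix t assume t: "t \<in> {a..b}"
  have "f integrable_on {a..t}" "g integrable_on {a..t}"
    using integrable_on_subinterval[OF primitive_integrable_on, of a b] t assms by auto
  then show "F t + G t = F a + G a + integral {a..t} (\<lambda>t. f t + g t)"
    using primitive_eq[OF assms(1) t] primitive_eq[OF assms(2) t]
    by (simp add: Henstock_Kurzweil_Integration.integral_add)
qed (use assms in \<open>auto dest!: primitive_integrable\<close>)

lemma primitive_cmult:
  assumes "primitive a b f F"
  shows "primitive a b (\<lambda>t. c * f t) (\<lambda>t. c * F t)"
  unfolding primitive_def
proof (intro conjI ballI)
  fix t assume t: "t \<in> {a..b}"
  show "c * F t = c * F a + integral {a..t} (\<lambda>t. c * f t)"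
    using primitive_eq[OF assms(1) t] by (simp add: algebra_simps)
qed (use assms in \<open>auto dest!: primitive_integrable\<close>)

lemma primitive_cnj:
  assumes "primitive a b f F"
  shows "primitive a b (\<lambda>t. cnj (f t)) (\<lambda>t. cnj (F t))"
  unfolding primitive_def
proof (intro conjI ballI)
  fix t assume t: "t \<in> {a..b}"
  show "cnj (F t) = cnj (F a) + integral {a..t} (\<lambda>t. cnj (f t))"
    using primitive_eq[OF assms(1) t] by (simp add: integral_cnj)
qed (use assms in \<open>auto dest!: primitive_integrable\<close>)

lemma primitive_indefinite:
  assumes "integrable (lebesgue_on {a..b}) f"
  shows "primitive a b f (\<lambda>t. c + integral {a..t} f)"
  using assms by (simp add: primitive_def)

lemma primitive_integral:
  assumes "a \<le> b" "primitive a b f F"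
  shows "integral\<^sup>L (lebesgue_on {a..b}) f = F b - F a"
proof -
  have "b \<in> {a..b}" using assms(1) by simp
  from primitive_eq[OF assms(2) this] lebesgue_integral_eq_integral[OF primitive_integrable[OF assms(2)]]
  show ?thesis by simp
qed

lemma continuous_AE_0_imp_0:
  fixes f :: "real \<Rightarrow> complex"
  assumes ab: "a < b" and f: "continuous_on {a..b} f" and 0: "AE t in lebesgue_on {a..b}. f t = 0"
    and t: "t \<in> {a..b}"
  shows "f t = 0"
proof -
  have "((\<lambda>t. cmod (f t)) has_integral 0) {a..b}"
  proof (rule has_integral_spike[of "{t\<in>{a..b}. f t \<noteq> 0}" "{a..b}" "\<lambda>t. cmod (f t)" "\<lambda>t. 0"])
    show "negligible {t\<in>{a..b}. f t \<noteq> 0}" using 0 by (simp add: AE_lebesgue_on_negligible)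
  qed auto
  then have "integral {a..b} (\<lambda>t. cmod (f t)) = 0" by (rule integral_unique)
  then show ?thesis
    using integral_eq_0_iff[OF continuous_on_norm[OF f] ab] t by simp
qed

section \<open>Linear systems with integrable coefficients\<close>

lemma primitive_exp:
  assumes ab: "a \<le> b" and F: "primitive a b f F"
  shows "primitive a b (\<lambda>t. f t * exp (F t)) (\<lambda>t. exp (F t))"
proof (rule primitiveI[OF ab])
  have cont: "continuous_on {a..b} (\<lambda>t. exp (F t))"
    by (intro continuous_intros primitive_continuous[OF F])
  show "integrable (lebesgue_on {a..b}) (\<lambda>t. f t * exp (F t))"
    by (rule integrable_mult_continuous[OF primitive_integrable[OF F] cont])
  obtain R where R: "\<And>t. t \<in> {a..b} \<Longrightarrow> cmod (F t) \<le> R"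
    using continuous_on_interval_bounded[OF primitive_continuous[OF F]] by metis
  show "abs_continuous_on a b (\<lambda>t. exp (F t))"
  proof (rule abs_continuous_on_dominated[OF primitive_abs_continuous[OF F] primitive_abs_continuous[OF F], of "exp R"])
    fix s t assume "s \<in> {a..b}" "t \<in> {a..b}"
    then have st: "F s \<in> cball 0 R" "F t \<in> cball 0 R" using R by auto
    have "cmod (exp (F s) - exp (F t)) \<le> exp R * cmod (F s - F t)"
    proof (rule field_differentiable_bound[where S = "cball 0 R" and f' = exp])
      fix z :: complex assume "z \<in> cball 0 R"
      then show "cmod (exp z) \<le> exp R" using complex_Re_le_cmod[of z] by simp
    qed (use st in \<open>auto intro: DERIV_exp has_field_derivative_at_within\<close>)
    then show "cmod (exp (F s) - exp (F t)) \<le> exp R * cmod (F s - F t) + exp R * cmod (F s - F t)"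
      by (rule order_trans) simp
  qed simp
  show "AE t in lebesgue_on {a..b}. ((\<lambda>t. exp (F t)) has_vector_derivative f t * exp (F t)) (at t within {a..b})"
    using primitive_has_derivative[OF F]
  proof eventually_elim
    case (elim t)
    show ?case
      using field_vector_diff_chain_within[OF elim, of exp "exp (F t)"]
      by (simp add: comp_def DERIV_exp has_field_derivative_at_within)
  qed
qed

lemma primitive_of_integral:
  assumes "integrable (lebesgue_on {a..b}) (f :: real \<Rightarrow> complex)"
  shows "primitive a b f (\<lambda>t. integral {a..t} f)"
  using primitive_indefinite[OF assms, of 0] by simp

text \<open>
  Banach's fixed point theorem for the integral equations, in unknowns divided by the weight
  \<open>E = exp (2 M)\<close> where \<open>M' = |A| + |B|\<close>.  As \<open>\<integral> (|A| + |B|) E = (E - 1) / 2\<close>, the weight makes the integral operator a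
  contraction with constant \<open>1/2\<close> on the whole interval.
\<close>
lemma linear_system_exists:
  fixes A B :: "real \<Rightarrow> complex" and c d :: complex
  assumes ab: "a \<le> b" and A: "integrable (lebesgue_on {a..b}) A" and B: "integrable (lebesgue_on {a..b}) B"
  obtains y u where "primitive a b (\<lambda>t. A t * u t) y" "primitive a b (\<lambda>t. B t * y t) u" "y a = c" "u a = d"
proof -
  define m where "m = (\<lambda>t. cmod (A t) + cmod (B t))"
  have m_int: "integrable (lebesgue_on {a..b}) m" using A B by (simp add: m_def)
  have m_on: "m integrable_on {a..t}" if "t \<in> {a..b}" for t
    using integrable_on_subinterval[OF integrable_on_lebesgue_on[OF m_int]] that by auto
  define M where "M = (\<lambda>t. integral {a..t} m)"
  have M_cont: "continuous_on {a..b} M" unfolding M_def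
    by (rule indefinite_integral_continuous_1) (use m_on[of b] ab in auto)
  define E where "E = (\<lambda>t. exp (2 * M t))"
  have E_cont: "continuous_on {a..b} E" unfolding E_def by (intro continuous_intros M_cont)
  have Epos: "E t > 0" for t by (simp add: E_def)
  have mc: "primitive a b (\<lambda>t. 2 * complex_of_real (m t)) (\<lambda>t. 2 * integral {a..t} (\<lambda>t. complex_of_real (m t)))"
    using m_int by (intro primitive_cmult primitive_of_integral) simp
  have Mc: "integral {a..t} (\<lambda>t. complex_of_real (m t)) = of_real (M t)" if "t \<in> {a..b}" for t
    using has_integral_linear[where h = complex_of_real, OF integrable_integral[OF m_on[OF that]] bounded_linear_of_real]
    by (simp add: M_def comp_def integral_unique)
  have mE: "((\<lambda>s. m s * E s) has_integral (E t - 1) / 2) {a..t}" if t: "t \<in> {a..b}" for t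
  proof -
    have "primitive a b (\<lambda>t. 2 * complex_of_real (m t) * exp (2 * integral {a..t} (\<lambda>t. complex_of_real (m t))))
        (\<lambda>t. exp (2 * integral {a..t} (\<lambda>t. complex_of_real (m t))))"
      by (rule primitive_exp[OF ab mc])
    then have P: "primitive a b (\<lambda>t. complex_of_real (2 * m t * E t)) (\<lambda>t. complex_of_real (E t))"
      by (rule primitive_cong) (auto simp: Mc E_def simp flip: exp_of_real)
    have a: "a \<in> {a..b}" using ab by simp
    have Ea: "E a = 1" by (simp add: E_def M_def)
    have ion: "(\<lambda>s. complex_of_real (2 * m s * E s)) integrable_on {a..t}"
      using integrable_on_subinterval[OF primitive_integrable_on[OF P]] t by auto
    have "((\<lambda>s. complex_of_real (2 * m s * E s)) has_integral of_real (E t) - of_real (E a)) {a..t}"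
      using primitive_eq[OF P t] ion by (metis add_diff_cancel_left' integrable_integral)
    then have "((\<lambda>s. Re (complex_of_real (2 * m s * E s))) has_integral Re (of_real (E t) - of_real (E a))) {a..t}"
      by (rule has_integral_Re)
    then have "((\<lambda>s. 2 * m s * E s) has_integral (E t - 1)) {a..t}" using Ea by simp
    then show ?thesis using has_integral_mult_right[of "\<lambda>s. 2 * m s * E s" "E t - 1" "{a..t}" "1/2"] by simp
  qed
  \<comment> \<open>Clamping the argument to \<open>[a, b]\<close> turns continuous functions on \<open>[a, b]\<close> into bounded continuous functions
     on the line, which form a complete space.\<close>
  define cl where "cl = (\<lambda>t. max a (min b t))"
  have cl: "cl t \<in> {a..b}" "t \<in> {a..b} \<Longrightarrow> cl t = t" for t using ab by (auto simp: cl_def)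
  have cl_cont: "continuous_on UNIV cl" unfolding cl_def by (intro continuous_intros)
  have bc: "(\<lambda>t. J (cl t)) \<in> bcontfun" if J: "continuous_on {a..b} J" for J :: "real \<Rightarrow> complex \<times> complex"
  proof -
    obtain R where "\<And>t. t \<in> {a..b} \<Longrightarrow> norm (J t) \<le> R"
      using continuous_on_interval_bounded[OF J] by metis
    then show ?thesis
      using cl(1) by (intro bcontfun_normI[where b = R] continuous_on_compose2[OF J cl_cont]) auto
  qed
  have zc: "continuous_on {a..b} (\<lambda>t. of_real (E t) * fst (apply_bcontfun Z t))"
     "continuous_on {a..b} (\<lambda>t. of_real (E t) * snd (apply_bcontfun Z t))" for Z :: "real \<Rightarrow>\<^sub>C (complex \<times> complex)"
    by (intro continuous_intros E_cont continuous_on_apply_bcontfun)+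
  have i1: "integrable (lebesgue_on {a..b}) (\<lambda>t. A t * (of_real (E t) * snd (apply_bcontfun Z t)))" for Z :: "real \<Rightarrow>\<^sub>C (complex \<times> complex)"
    by (rule integrable_mult_continuous[OF A zc(2)])
  have i2: "integrable (lebesgue_on {a..b}) (\<lambda>t. B t * (of_real (E t) * fst (apply_bcontfun Z t)))" for Z :: "real \<Rightarrow>\<^sub>C (complex \<times> complex)"
    by (rule integrable_mult_continuous[OF B zc(1)])
  define J1 where "J1 = (\<lambda>(Z :: real \<Rightarrow>\<^sub>C (complex \<times> complex)) t. c + integral {a..t} (\<lambda>s. A s * (of_real (E s) * snd (apply_bcontfun Z s))))"
  define J2 where "J2 = (\<lambda>(Z :: real \<Rightarrow>\<^sub>C (complex \<times> complex)) t. d + integral {a..t} (\<lambda>s. B s * (of_real (E s) * fst (apply_bcontfun Z s))))"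
  define J where "J = (\<lambda>Z t. (J1 Z t / of_real (E t), J2 Z t / of_real (E t)))"
  have P1: "primitive a b (\<lambda>s. A s * (of_real (E s) * snd (apply_bcontfun Z s))) (J1 Z)" for Z :: "real \<Rightarrow>\<^sub>C (complex \<times> complex)"
    unfolding J1_def by (rule primitive_indefinite[OF i1])
  have P2: "primitive a b (\<lambda>s. B s * (of_real (E s) * fst (apply_bcontfun Z s))) (J2 Z)" for Z :: "real \<Rightarrow>\<^sub>C (complex \<times> complex)"
    unfolding J2_def by (rule primitive_indefinite[OF i2])
  have J_cont: "continuous_on {a..b} (J Z)" for Z :: "real \<Rightarrow>\<^sub>C (complex \<times> complex)"
    unfolding J_def using Epos
    by (intro continuous_intros primitive_continuous[OF P1] primitive_continuous[OF P2] E_cont)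
       (metis less_irrefl of_real_eq_0_iff)+
  define T where "T = (\<lambda>Z. Bcontfun (\<lambda>t. J Z (cl t)))"
  have T: "apply_bcontfun (T Z) t = J Z (cl t)" for Z t
    unfolding T_def using bc[OF J_cont] by (simp add: Bcontfun_inverse)
  have contr: "dist (T Z) (T Z') \<le> 1/2 * dist Z Z'" for Z Z'
  proof (rule dist_bound)
    fix t
    define s where "s = cl t"
    have s: "s \<in> {a..b}" using cl by (simp add: s_def)
    define D where "D = dist Z Z'"
    have D: "cmod (fst (apply_bcontfun Z x) - fst (apply_bcontfun Z' x)) \<le> D"
            "cmod (snd (apply_bcontfun Z x) - snd (apply_bcontfun Z' x)) \<le> D" for x
      using dist_bounded[of Z x Z'] dist_fst_le[of "apply_bcontfun Z x" "apply_bcontfun Z' x"]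
        dist_snd_le[of "apply_bcontfun Z x" "apply_bcontfun Z' x"]
      unfolding D_def dist_norm by linarith+
    have sub: "{a..s} \<subseteq> {a..b}" using s by auto
    have comp: "(\<lambda>x. cmod (G x) * E x) integrable_on {a..s}"
       "cmod (integral {a..s} (\<lambda>x. G x * (of_real (E x) * h x)) - integral {a..s} (\<lambda>x. G x * (of_real (E x) * h' x)))
          \<le> integral {a..s} (\<lambda>x. cmod (G x) * E x) * D"
      if G: "integrable (lebesgue_on {a..b}) G"
        and h: "continuous_on {a..b} (\<lambda>x. of_real (E x) * h x)" "continuous_on {a..b} (\<lambda>x. of_real (E x) * h' x)"
        and hh': "\<And>x. cmod (h x - h' x) \<le> D" for G h h'
    proof -
      have on: "(\<lambda>x. G x * k x) integrable_on {a..s}" if "continuous_on {a..b} k" for k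
        by (rule integrable_on_subinterval[OF integrable_on_lebesgue_on[OF integrable_mult_continuous[OF G that]] sub]) simp
      have nG: "integrable (lebesgue_on {a..b}) (\<lambda>x. G x * of_real (E x))"
        by (intro integrable_mult_continuous[OF G] continuous_intros E_cont)
      show nG': "(\<lambda>x. cmod (G x) * E x) integrable_on {a..s}"
        using integrable_on_subinterval[OF integrable_on_lebesgue_on[OF integrable_norm[OF nG]] sub] Epos
        by (simp add: norm_mult abs_of_pos)
      have "cmod (integral {a..s} (\<lambda>x. G x * (of_real (E x) * h x)) - integral {a..s} (\<lambda>x. G x * (of_real (E x) * h' x)))
        = cmod (integral {a..s} (\<lambda>x. G x * (of_real (E x) * h x) - G x * (of_real (E x) * h' x)))"
        using on[OF h(1)] on[OF h(2)] by (simp add: Henstock_Kurzweil_Integration.integral_diff)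
      also have "\<dots> \<le> integral {a..s} (\<lambda>x. cmod (G x) * E x * D)"
      proof (rule integral_norm_bound_integral)
        fix x
        have "cmod (G x * (of_real (E x) * h x) - G x * (of_real (E x) * h' x)) = cmod (G x) * E x * cmod (h x - h' x)"
          using Epos[of x] by (simp add: norm_mult abs_of_pos flip: right_diff_distrib)
        also have "\<dots> \<le> cmod (G x) * E x * D" using Epos[of x] by (intro mult_left_mono hh') auto
        finally show "cmod (G x * (of_real (E x) * h x) - G x * (of_real (E x) * h' x)) \<le> cmod (G x) * E x * D" .
      qed (use on[OF h(1)] on[OF h(2)] nG' in \<open>auto intro: integrable_diff integrable_on_mult_left\<close>)
      finally show "cmod (integral {a..s} (\<lambda>x. G x * (of_real (E x) * h x)) - integral {a..s} (\<lambda>x. G x * (of_real (E x) * h' x)))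
          \<le> integral {a..s} (\<lambda>x. cmod (G x) * E x) * D" by simp
    qed
    note compA = comp[OF A zc(2) zc(2) D(2)] and compB = comp[OF B zc(1) zc(1) D(1)]
    have b1: "cmod (J1 Z s - J1 Z' s) \<le> integral {a..s} (\<lambda>t. cmod (A t) * E t) * D"
      using compA(2) by (simp add: J1_def)
    have b2: "cmod (J2 Z s - J2 Z' s) \<le> integral {a..s} (\<lambda>t. cmod (B t) * E t) * D"
      using compB(2) by (simp add: J2_def)
    have mEeq: "integral {a..s} (\<lambda>t. cmod (A t) * E t) + integral {a..s} (\<lambda>t. cmod (B t) * E t) = (E s - 1) / 2"
      using integral_unique[OF mE[OF s]] compA(1) compB(1)
      by (simp add: m_def distrib_right Henstock_Kurzweil_Integration.integral_add)
    have D0: "D \<ge> 0" by (simp add: D_def)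
    have "dist (apply_bcontfun (T Z) t) (apply_bcontfun (T Z') t)
       = norm ((J1 Z s - J1 Z' s) / of_real (E s), (J2 Z s - J2 Z' s) / of_real (E s))"
      by (simp add: T s_def[symmetric] J_def dist_norm diff_divide_distrib)
    also have "\<dots> \<le> cmod ((J1 Z s - J1 Z' s) / of_real (E s)) + cmod ((J2 Z s - J2 Z' s) / of_real (E s))"
      by (rule norm_Pair_le)
    also have "\<dots> = (cmod (J1 Z s - J1 Z' s) + cmod (J2 Z s - J2 Z' s)) / E s"
      using Epos[of s] by (simp add: norm_divide abs_of_pos add_divide_distrib)
    also have "\<dots> \<le> ((E s - 1) / 2 * D) / E s"
      using b1 b2 Epos[of s] unfolding mEeq[symmetric] by (intro divide_right_mono) (auto simp: distrib_right)
    also have "\<dots> \<le> 1/2 * D"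
      using Epos[of s] D0 by (simp add: field_simps)
    finally show "dist (apply_bcontfun (T Z) t) (apply_bcontfun (T Z') t) \<le> 1/2 * dist Z Z'" by (simp add: D_def)
  qed
  obtain Z where Z: "T Z = Z"
    using banach_fix_type[of "1/2" T] contr by auto
  define y where "y = (\<lambda>t. of_real (E t) * fst (apply_bcontfun Z t))"
  define u where "u = (\<lambda>t. of_real (E t) * snd (apply_bcontfun Z t))"
  have yu: "J1 Z t = y t" "J2 Z t = u t" if t: "t \<in> {a..b}" for t
  proof -
    have "apply_bcontfun Z t = J Z t" using T[of Z t] Z cl(2)[OF t] by simp
    then show "J1 Z t = y t" "J2 Z t = u t" using Epos[of t] by (auto simp: y_def u_def J_def)
  qed
  have aa: "a \<in> {a..b}" using ab by simp
  show thesis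
  proof (rule that[of u y])
    show "primitive a b (\<lambda>t. A t * u t) y" using P1[of Z] by (rule primitive_cong) (auto simp: u_def yu)
    show "primitive a b (\<lambda>t. B t * y t) u" using P2[of Z] by (rule primitive_cong) (auto simp: y_def yu)
    show "y a = c" "u a = d" using yu[OF aa] by (auto simp: J1_def J2_def)
  qed
qed

section \<open>Zero sets and quasi-derivatives\<close>

text \<open>
  Each isolated point is the only point of \<open>Z\<close> in some interval with rational end points.
\<close>
lemma countable_isolated_points:
  fixes Z :: "real set"
  shows "countable {x\<in>Z. \<not> x islimpt Z}"
proof -
  define W where "W = (\<lambda>(l::rat, r::rat). {x\<in>Z. Z \<inter> {of_rat l<..<of_rat r} = {x}})"
  have "countable (W k)" for k
  proof -
    obtain l r where k: "k = (l,r)" by (cases k)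
    have "x = y" if "x \<in> W k" "y \<in> W k" for x y
      using that unfolding W_def k by (metis (mono_tags, lifting) case_prod_conv mem_Collect_eq singleton_inject)
    then have "W k \<subseteq> {SOME x. x \<in> W k}" by (metis insertI1 someI subsetI)
    then show ?thesis using countable_subset by blast
  qed
  then have "countable (\<Union>k. W k)" by auto
  moreover have "{x\<in>Z. \<not> x islimpt Z} \<subseteq> (\<Union>k. W k)"
  proof clarify
    fix x assume x: "x \<in> Z" "\<not> x islimpt Z"
    then obtain e where e: "e > 0" "\<forall>y\<in>Z. y \<noteq> x \<longrightarrow> e \<le> dist y x" by (auto simp: islimpt_approachable not_less)
    obtain l r :: rat where l: "x - e < of_rat l" "of_rat l < x" and r: "x < of_rat r" "of_rat r < x + e"
      using of_rat_dense[of "x - e" x] of_rat_dense[of x "x + e"] e(1) by auto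
    have "Z \<inter> {of_rat l<..<of_rat r} = {x}"
      using x(1) l r e(2) by (force simp: dist_real_def abs_if split: if_splits)
    then show "x \<in> (\<Union>k. W k)" using x(1) by (auto simp: W_def)
  qed
  ultimately show ?thesis using countable_subset by blast
qed

text \<open>
  All but countably many points of the zero set of \<open>F\<close> are accumulation points of it, and there the
  derivative of \<open>F\<close>, if it exists, is zero.
\<close>
lemma primitive_zero_set:
  assumes F: "primitive a b f F"
  shows "AE t in lebesgue_on {a..b}. F t = 0 \<longrightarrow> f t = 0"
proof -
  define Z where "Z = {t\<in>{a..b}. F t = 0}"
  have "negligible {x\<in>Z. \<not> x islimpt Z}"
    unfolding negligible_iff_null_sets
    by (intro null_sets_completionI countable_imp_null_set_lborel countable_isolated_points)
  then have "negligible {x\<in>{a..b}. \<not> (x \<in> Z \<longrightarrow> x islimpt Z)}"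
    by (rule negligible_subset) (auto simp: Z_def)
  then have "AE t in lebesgue_on {a..b}. t \<in> Z \<longrightarrow> t islimpt Z" by (simp add: AE_lebesgue_on_negligible)
  moreover have "AE t in lebesgue_on {a..b}. t \<in> {a..b}" by (rule AE_I2) simp
  ultimately show ?thesis
    using primitive_has_derivative[OF F]
  proof eventually_elim
    case (elim t)
    show ?case
    proof
      assume "F t = 0"
      then have tZ: "t \<in> Z" "t islimpt Z" using elim by (auto simp: Z_def)
      have "(F has_vector_derivative f t) (at t within Z)"
        using elim(3) by (rule has_vector_derivative_within_subset) (auto simp: Z_def)
      moreover have "(F has_vector_derivative 0) (at t within Z)"
        by (rule has_vector_derivative_transform[OF tZ(1), where f = "\<lambda>_. 0"]) (auto simp: Z_def)
      moreover have "at t within Z \<noteq> bot" using tZ(2) by (simp add: trivial_limit_within)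
      ultimately show "f t = 0" by (rule vector_derivative_unique_within[rotated])
    qed
  qed
qed

lemma abs_continuous_on_imp_continuous:
  assumes AC: "abs_continuous_on a b F"
  shows "continuous_on {a..b} F"
proof (rule continuous_onI)
  fix x e :: real assume x: "x \<in> {a..b}" and e: "e > 0"
  obtain d where d: "d > 0" "\<forall>D T. D division_of T \<and> T \<subseteq> {a..b} \<and> (\<Sum>K\<in>D. Sup K - Inf K) < d
        \<longrightarrow> (\<Sum>K\<in>D. cmod (F (Sup K) - F (Inf K))) < e"
    using AC[unfolded abs_continuous_on_def, rule_format, OF e] by blast
  have *: "cmod (F v - F u) < e" if uv: "a \<le> u" "u \<le> v" "v \<le> b" "v - u < d" for u v
  proof -
    have "{{u..v}} division_of {u..v}" using division_of_self[of u v] uv by simp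
    moreover have "{u..v} \<subseteq> {a..b}" using uv by auto
    moreover have "(\<Sum>K\<in>{{u..v}}. Sup K - Inf K) < d" using uv by simp
    ultimately have "(\<Sum>K\<in>{{u..v}}. cmod (F (Sup K) - F (Inf K))) < e" using d(2) by blast
    then show ?thesis using uv by simp
  qed
  have "dist (F x') (F x) \<le> e" if "x' \<in> {a..b}" "dist x' x < d" for x'
    using *[of x x'] *[of x' x] x that
    by (cases "x \<le> x'") (auto simp: dist_norm norm_minus_commute)
  then show "\<exists>d>0. \<forall>x'\<in>{a..b}. dist x' x < d \<longrightarrow> dist (F x') (F x) \<le> e"
    using d(1) by blast
qed

lemma quasi_deriv_eq:
  assumes ab: "a < b" and u: "is_quasi_deriv a b p y u"
  shows "quasi_deriv a b p y = u"
  unfolding quasi_deriv_def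
proof (rule the_equality[where P = "is_quasi_deriv a b p y", OF u])
  fix v assume v: "is_quasi_deriv a b p y v"
  have "v t - u t = 0" if t: "t \<in> {a..b}" for t
  proof (rule continuous_AE_0_imp_0[OF ab _ _ t])
    show "continuous_on {a..b} (\<lambda>t. v t - u t)"
      using u v by (intro continuous_intros abs_continuous_on_imp_continuous) (auto simp: is_quasi_deriv_def)
    have "AE t in lebesgue_on {a..b}. u t = of_real (p t) * vector_derivative y (at t within {a..b})"
      "AE t in lebesgue_on {a..b}. v t = of_real (p t) * vector_derivative y (at t within {a..b})"
      using u v by (auto simp: is_quasi_deriv_def elim: AE_mp)
    then show "AE t in lebesgue_on {a..b}. v t - u t = 0" by eventually_elim simp
  qed
  moreover have "v t = u t" if "t \<notin> {a..b}" for t using u v that by (simp add: is_quasi_deriv_def)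
  ultimately show "v = u" by (metis eq_iff_diff_eq_0 ext)
qed

section \<open>The weighted space of square integrable functions\<close>

lemma borel_measurable_cnj: 
  assumes "f \<in> borel_measurable N" shows "(\<lambda>t. cnj (f t)) \<in> borel_measurable N"
  using measurable_compose[OF assms borel_measurable_continuous_onI[of cnj]] by (simp add: continuous_on_cnj continuous_on_id)

lemma borel_measurable_lebesgue_on:
  fixes f :: "real \<Rightarrow> complex"
  assumes "f \<in> borel_measurable (restrict_space borel {a..b})"
  shows "f \<in> borel_measurable (lebesgue_on {a..b})"
proof -
  have "(\<lambda>x. indicator {a..b} x *\<^sub>R f x) \<in> borel_measurable lborel"
    using assms by (simp add: borel_measurable_restrict_space_iff)
  then have "(\<lambda>x. indicator {a..b} x *\<^sub>R f x) \<in> borel_measurable lebesgue" by (rule measurable_completion)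
  then show ?thesis by (simp add: borel_measurable_restrict_space_iff)
qed

lemma wL2_measurable: "f \<in> wL2 a b \<Delta> \<Longrightarrow> f \<in> borel_measurable (lebesgue_on {a..b})"
  by (simp add: wL2_def borel_measurable_lebesgue_on)

lemma wL2_square_integrable:
  "f \<in> wL2 a b \<Delta> \<Longrightarrow> integrable (lebesgue_on {a..b}) (\<lambda>t. \<Delta> t * (cmod (f t))\<^sup>2)"
  by (simp add: wL2_def)

locale weight =
  fixes a b :: real and \<Delta> :: "real \<Rightarrow> real"
  assumes ab: "a < b"
    and \<Delta>_int: "integrable (lebesgue_on {a..b}) \<Delta>"
    and \<Delta>_nonneg: "t \<in> {a..b} \<Longrightarrow> 0 \<le> \<Delta> t"
begin

abbreviation "M \<equiv> lebesgue_on {a..b}"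
abbreviation "H \<equiv> wL2 a b \<Delta>"
abbreviation "ip \<equiv> wip a b \<Delta>"

lemma \<Delta>_measurable: "\<Delta> \<in> borel_measurable M"
  using \<Delta>_int by auto

lemma wL2_mult_integrable:
  assumes f: "f \<in> H" and g: "g \<in> H"
  shows "integrable M (\<lambda>t. of_real (\<Delta> t) * f t * cnj (g t))"
proof (rule Bochner_Integration.integrable_bound)
  show "integrable M (\<lambda>t. \<Delta> t * (cmod (f t))\<^sup>2 + \<Delta> t * (cmod (g t))\<^sup>2)"
    using wL2_square_integrable[OF f] wL2_square_integrable[OF g] by simp
  show "(\<lambda>t. of_real (\<Delta> t) * f t * cnj (g t)) \<in> borel_measurable M"
    using wL2_measurable[OF f] wL2_measurable[OF g] \<Delta>_measurable
    by (intro borel_measurable_times borel_measurable_cnj) auto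
  show "AE t in M. cmod (of_real (\<Delta> t) * f t * cnj (g t)) \<le> norm (\<Delta> t * (cmod (f t))\<^sup>2 + \<Delta> t * (cmod (g t))\<^sup>2)"
  proof (rule AE_I2)
    fix t assume "t \<in> space M"
    then have d: "0 \<le> \<Delta> t" using \<Delta>_nonneg by simp
    have "cmod (f t) * cmod (g t) \<le> (cmod (f t))\<^sup>2 + (cmod (g t))\<^sup>2"
      using sum_squares_bound[of "cmod (f t)" "cmod (g t)"] mult_nonneg_nonneg[OF norm_ge_zero[of "f t"] norm_ge_zero[of "g t"]]
      unfolding mult.assoc by linarith
    then have "\<Delta> t * (cmod (f t) * cmod (g t)) \<le> \<Delta> t * ((cmod (f t))\<^sup>2 + (cmod (g t))\<^sup>2)"
      using d by (rule mult_left_mono)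
    then show "cmod (of_real (\<Delta> t) * f t * cnj (g t)) \<le> norm (\<Delta> t * (cmod (f t))\<^sup>2 + \<Delta> t * (cmod (g t))\<^sup>2)"
      using d by (simp add: norm_mult abs_of_nonneg distrib_left mult.assoc)
  qed
qed

lemma wL2_I:
  assumes f: "f \<in> borel_measurable (restrict_space borel {a..b})"
    and g: "integrable M (\<lambda>t. \<Delta> t * g t)" and le: "\<And>t. t \<in> {a..b} \<Longrightarrow> (cmod (f t))\<^sup>2 \<le> g t"
  shows "f \<in> H"
proof -
  have fm: "f \<in> borel_measurable M" by (rule borel_measurable_lebesgue_on[OF f])
  have "integrable M (\<lambda>t. \<Delta> t * (cmod (f t))\<^sup>2)"
  proof (rule Bochner_Integration.integrable_bound[OF g])
    show "(\<lambda>t. \<Delta> t * (cmod (f t))\<^sup>2) \<in> borel_measurable M" using fm \<Delta>_measurable by measurable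
    show "AE t in M. norm (\<Delta> t * (cmod (f t))\<^sup>2) \<le> norm (\<Delta> t * g t)"
    proof (rule AE_I2)
      fix t assume "t \<in> space M"
      then have t: "t \<in> {a..b}" by simp
      have "0 \<le> (cmod (f t))\<^sup>2" by simp
      then have "0 \<le> g t" using le[OF t] by linarith
      then show "norm (\<Delta> t * (cmod (f t))\<^sup>2) \<le> norm (\<Delta> t * g t)"
        using mult_left_mono[OF le[OF t] \<Delta>_nonneg[OF t]] \<Delta>_nonneg[OF t] by (simp add: abs_mult)
    qed
  qed
  then show ?thesis using f by (simp add: wL2_def)
qed

lemma wL2_bounded:
  assumes f: "f \<in> borel_measurable (restrict_space borel {a..b})" and B: "\<And>t. t \<in> {a..b} \<Longrightarrow> cmod (f t) \<le> B"
  shows "f \<in> H"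
  by (rule wL2_I[OF f, of "\<lambda>_. B\<^sup>2"]) (use \<Delta>_int B in \<open>auto intro!: power_mono\<close>)

lemma wL2_continuous:
  assumes "continuous_on {a..b} f" shows "f \<in> H"
proof -
  obtain B where "\<And>t. t \<in> {a..b} \<Longrightarrow> cmod (f t) \<le> B" using continuous_on_interval_bounded[OF assms] by metis
  then show ?thesis using wL2_bounded[OF borel_measurable_continuous_on_restrict[OF assms]] by blast
qed

lemma wL2_integrable:
  assumes f: "f \<in> H" shows "integrable M (\<lambda>t. of_real (\<Delta> t) * f t)"
  using wL2_mult_integrable[OF f wL2_continuous[of "\<lambda>_. 1"]] by simp

lemma wL2_add: assumes f: "f \<in> H" and g: "g \<in> H" shows "(\<lambda>t. f t + g t) \<in> H"
proof (rule wL2_I[where g = "\<lambda>t. 2 * (cmod (f t))\<^sup>2 + 2 * (cmod (g t))\<^sup>2"])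
  show "(\<lambda>t. f t + g t) \<in> borel_measurable (restrict_space borel {a..b})"
    using f g unfolding wL2_def by (intro borel_measurable_add) auto
  show "integrable M (\<lambda>t. \<Delta> t * (2 * (cmod (f t))\<^sup>2 + 2 * (cmod (g t))\<^sup>2))"
    using integrable_mult_right[OF wL2_square_integrable[OF f], of 2] integrable_mult_right[OF wL2_square_integrable[OF g], of 2]
    by (simp add: distrib_left mult.left_commute)
  fix t
  have "(cmod (f t + g t))\<^sup>2 \<le> (cmod (f t) + cmod (g t))\<^sup>2" by (intro power_mono norm_triangle_ineq) simp
  also have "\<dots> \<le> 2 * (cmod (f t))\<^sup>2 + 2 * (cmod (g t))\<^sup>2"
    using sum_squares_bound[of "cmod (f t)" "cmod (g t)"] by (simp add: power2_sum)
  finally show "(cmod (f t + g t))\<^sup>2 \<le> 2 * (cmod (f t))\<^sup>2 + 2 * (cmod (g t))\<^sup>2" .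
qed

lemma wL2_cmult: assumes f: "f \<in> H" shows "(\<lambda>t. c * f t) \<in> H"
proof (rule wL2_I[where g = "\<lambda>t. (cmod c)\<^sup>2 * (cmod (f t))\<^sup>2"])
  show "(\<lambda>t. c * f t) \<in> borel_measurable (restrict_space borel {a..b})"
    using f unfolding wL2_def by auto
  show "integrable M (\<lambda>t. \<Delta> t * ((cmod c)\<^sup>2 * (cmod (f t))\<^sup>2))"
    using integrable_mult_right[OF wL2_square_integrable[OF f], of "(cmod c)\<^sup>2"]
    by (simp add: mult.left_commute)
qed (simp add: norm_mult power_mult_distrib)

lemma wip_self:
  assumes "f \<in> H"
  shows "ip f f = of_real (LINT t|M. \<Delta> t * (cmod (f t))\<^sup>2)"
proof -
  have "ip f f = (LINT t|M. complex_of_real (\<Delta> t * (cmod (f t))\<^sup>2))"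
    unfolding wip_def
    by (intro Bochner_Integration.integral_cong refl) (simp only: complex_norm_square of_real_mult mult.assoc flip: of_real_power)
  also have "\<dots> = of_real (LINT t|M. \<Delta> t * (cmod (f t))\<^sup>2)" by (rule integral_complex_of_real)
  finally show ?thesis .
qed

lemma ip_zero_AE:
  assumes f: "f \<in> H" and 0: "Re (ip f f) = 0"
  shows "AE t in M. \<Delta> t > 0 \<longrightarrow> f t = 0"
proof -
  have "(LINT t|M. \<Delta> t * (cmod (f t))\<^sup>2) = 0" using 0 wip_self[OF f] by simp
  moreover have "AE t in M. 0 \<le> \<Delta> t * (cmod (f t))\<^sup>2" by (rule AE_I2) (use \<Delta>_nonneg in simp)
  ultimately have "AE t in M. \<Delta> t * (cmod (f t))\<^sup>2 = 0"
    using integral_nonneg_eq_0_iff_AE[OF wL2_square_integrable[OF f]] by simp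
  then show ?thesis by eventually_elim auto
qed

end

section \<open>The boundary value problem in integral form\<close>

lemma real_cos_sin_det_zero:
  fixes y1 u1 y2 u2 :: complex and \<theta> :: real
  assumes "of_real (cos \<theta>) * y1 + of_real (sin \<theta>) * u1 = 0" "of_real (cos \<theta>) * y2 + of_real (sin \<theta>) * u2 = 0"
  shows "y1 * u2 - u1 * y2 = 0"
proof -
  have "of_real (cos \<theta>) * (y1 * u2 - u1 * y2)
      = (of_real (cos \<theta>) * y1 + of_real (sin \<theta>) * u1) * u2 - u1 * (of_real (cos \<theta>) * y2 + of_real (sin \<theta>) * u2)"
    by (simp add: algebra_simps)
  then have c: "of_real (cos \<theta>) * (y1 * u2 - u1 * y2) = 0" using assms by simp
  have "of_real (sin \<theta>) * (y1 * u2 - u1 * y2)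
      = y1 * (of_real (cos \<theta>) * y2 + of_real (sin \<theta>) * u2) - (of_real (cos \<theta>) * y1 + of_real (sin \<theta>) * u1) * y2"
    by (simp add: algebra_simps)
  then have s: "of_real (sin \<theta>) * (y1 * u2 - u1 * y2) = 0" using assms by simp
  have "cos \<theta> \<noteq> 0 \<or> sin \<theta> \<noteq> 0" using sin_cos_squared_add[of \<theta>] by (metis add_0 power_zero_numeral zero_neq_one)
  then show ?thesis using c s by auto
qed

locale sturm_liouville = weight a b \<Delta> for a b :: real and \<Delta> :: "real \<Rightarrow> real" +
  fixes p q :: "real \<Rightarrow> real" and \<alpha> \<beta> :: real
  assumes p_nz: "AE t in lebesgue_on {a..b}. p t \<noteq> 0"
    and p_int: "integrable (lebesgue_on {a..b}) (\<lambda>t. 1 / p t)"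
    and q_int: "integrable (lebesgue_on {a..b}) q"
    and \<Delta>_pos: "emeasure lebesgue {t\<in>{a..b}. 0 < \<Delta> t} \<noteq> 0"
begin

text \<open>
  \<open>sys g y u\<close> is the equation \<open>l[y] = g\<close> with \<open>u\<close> the quasi-derivative of \<open>y\<close>; \<open>bvp\<close> adds the boundary
  conditions and the normalisation outside \<open>[a, b]\<close>.
\<close>
definition sys :: "(real \<Rightarrow> complex) \<Rightarrow> (real \<Rightarrow> complex) \<Rightarrow> (real \<Rightarrow> complex) \<Rightarrow> bool" where
  "sys g y u \<longleftrightarrow> primitive a b (\<lambda>t. of_real (1 / p t) * u t) y \<and> primitive a b (\<lambda>t. of_real (q t) * y t - g t) u"

definition left_bc where "left_bc y u \<longleftrightarrow> of_real (cos \<alpha>) * y a + of_real (sin \<alpha>) * u a = (0::complex)"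
definition right_bc where "right_bc y u \<longleftrightarrow> of_real (cos \<beta>) * y b + of_real (sin \<beta>) * u b = (0::complex)"

definition bvp :: "(real \<Rightarrow> complex) \<Rightarrow> (real \<Rightarrow> complex) \<Rightarrow> (real \<Rightarrow> complex) \<Rightarrow> bool" where
  "bvp g y u \<longleftrightarrow> (\<forall>t. t \<notin> {a..b} \<longrightarrow> y t = 0 \<and> u t = 0) \<and> sys g y u \<and> left_bc y u \<and> right_bc y u"

abbreviation "hom \<mu> y u \<equiv> sys (\<lambda>t. \<mu> * of_real (\<Delta> t) * y t) y u"
abbreviation "eigen \<mu> y u \<equiv> bvp (\<lambda>t. \<mu> * of_real (\<Delta> t) * y t) y u"
abbreviation "L \<equiv> sl_sols a b p q \<Delta> \<alpha> \<beta>"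
abbreviation "EV \<equiv> sl_EV a b p q \<Delta> \<alpha> \<beta>"

lemma ab_le: "a \<le> b" and a_in: "a \<in> {a..b}" and b_in: "b \<in> {a..b}" using ab by auto

lemma sys_continuous: "sys g y u \<Longrightarrow> continuous_on {a..b} y" "sys g y u \<Longrightarrow> continuous_on {a..b} u"
  by (auto simp: sys_def dest: primitive_continuous)

lemma q_mult_integrable:
  fixes y :: "real \<Rightarrow> complex"
  assumes "continuous_on {a..b} y"
  shows "integrable M (\<lambda>t. of_real (q t) * y t)" "integrable M (\<lambda>t. of_real (1 / p t) * y t)"
     "integrable M (\<lambda>t. of_real (\<Delta> t) * y t)"
proof -
  have int: "integrable M (\<lambda>t. of_real (r t) * y t)" if "integrable M r" for r :: "real \<Rightarrow> real"
  proof -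
    have "integrable M (\<lambda>t. complex_of_real (r t))" using that by simp
    from integrable_mult_continuous[OF this assms] show ?thesis .
  qed
  show "integrable M (\<lambda>t. of_real (q t) * y t)" "integrable M (\<lambda>t. of_real (1 / p t) * y t)"
     "integrable M (\<lambda>t. of_real (\<Delta> t) * y t)"
    by (rule int[OF q_int] int[OF p_int] int[OF \<Delta>_int])+
qed

lemma sys_integrable: assumes "sys g y u" shows "integrable M g"
proof -
  have "integrable M (\<lambda>t. of_real (q t) * y t - (of_real (q t) * y t - g t))"
  proof (rule Bochner_Integration.integrable_diff)
    show "integrable M (\<lambda>t. of_real (q t) * y t)" by (rule q_mult_integrable(1)[OF sys_continuous(1)[OF assms]])
    show "integrable M (\<lambda>t. of_real (q t) * y t - g t)"
      using assms unfolding sys_def by (blast dest: primitive_integrable)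
  qed
  then show ?thesis by simp
qed

text \<open>
  Almost everywhere derivatives and indefinite integrals correspond to each other for absolutely continuous
  functions; division by \<open>p\<close>, which is nonzero almost everywhere, turns \<open>u = p y'\<close> into \<open>y' = u / p\<close>.
\<close>
lemma bvp_iff:
  assumes g: "integrable M g"
  shows "y \<in> sl_dom a b p \<and> sl_eq a b p q y g \<and> sl_bc a b p \<alpha> \<beta> y \<longleftrightarrow> (\<exists>u. bvp g y u)"
proof (intro iffI; (elim conjE exE)?)
  assume dom: "y \<in> sl_dom a b p" and eq: "sl_eq a b p q y g" and bc: "sl_bc a b p \<alpha> \<beta> y"
  then obtain u where u: "is_quasi_deriv a b p y u" by (auto simp: sl_dom_def)
  then have qd: "quasi_deriv a b p y = u" by (rule quasi_deriv_eq[OF ab])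
  have yAC: "abs_continuous_on a b y" and uAC: "abs_continuous_on a b u"
    using dom u by (auto simp: sl_dom_def is_quasi_deriv_def)
  note yc = abs_continuous_on_imp_continuous[OF yAC] and uc = abs_continuous_on_imp_continuous[OF uAC]
  have "primitive a b (\<lambda>t. of_real (1 / p t) * u t) y"
  proof (rule primitiveI[OF ab_le q_mult_integrable(2)[OF uc] yAC])
    have "AE t in M. y differentiable (at t within {a..b}) \<and>
        u t = of_real (p t) * vector_derivative y (at t within {a..b})" using u by (simp add: is_quasi_deriv_def)
    with p_nz show "AE t in M. (y has_vector_derivative of_real (1 / p t) * u t) (at t within {a..b})"
      by eventually_elim (auto simp: vector_derivative_works)
  qed
  moreover have "primitive a b (\<lambda>t. of_real (q t) * y t - g t) u"
  proof (rule primitiveI[OF ab_le _ uAC])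
    show "integrable M (\<lambda>t. of_real (q t) * y t - g t)" using q_mult_integrable(1)[OF yc] g by simp
    have "AE t in M. u differentiable (at t within {a..b}) \<and>
        - vector_derivative u (at t within {a..b}) + of_real (q t) * y t = g t"
      using eq by (simp add: sl_eq_def sl_expr_def qd)
    then show "AE t in M. (u has_vector_derivative of_real (q t) * y t - g t) (at t within {a..b})"
    proof eventually_elim
      case (elim t)
      then have "vector_derivative u (at t within {a..b}) = of_real (q t) * y t - g t" by (simp add: algebra_simps)
      then show ?case using elim by (metis vector_derivative_works)
    qed
  qed
  moreover have "\<forall>t. t \<notin> {a..b} \<longrightarrow> y t = 0 \<and> u t = 0" using dom u by (auto simp: sl_dom_def is_quasi_deriv_def)
  ultimately show "\<exists>u. bvp g y u"
    using bc qd by (auto simp: bvp_def sys_def sl_bc_def left_bc_def right_bc_def)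
next
  fix u assume B: "bvp g y u"
  then have y: "primitive a b (\<lambda>t. of_real (1 / p t) * u t) y" and u: "primitive a b (\<lambda>t. of_real (q t) * y t - g t) u"
    by (auto simp: bvp_def sys_def)
  have in_ab: "AE t in M. t \<in> {a..b}" by (rule AE_I2) simp
  have "AE t in M. y differentiable (at t within {a..b}) \<and>
        u t = of_real (p t) * vector_derivative y (at t within {a..b})"
    using primitive_has_derivative[OF y] p_nz in_ab
  proof eventually_elim
    case (elim t)
    have "vector_derivative y (at t within {a..b}) = of_real (1 / p t) * u t"
      by (rule vector_derivative_within_closed_interval[OF ab elim(3,1)])
    then show ?case using elim by (auto intro: differentiableI_vector)
  qed
  then have quasi: "is_quasi_deriv a b p y u"
    using B primitive_abs_continuous[OF u] by (auto simp: is_quasi_deriv_def bvp_def)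
  then have qd: "quasi_deriv a b p y = u" by (rule quasi_deriv_eq[OF ab])
  have "y \<in> sl_dom a b p"
    using B primitive_abs_continuous[OF y] quasi by (auto simp: sl_dom_def bvp_def)
  moreover have "sl_eq a b p q y g"
    unfolding sl_eq_def sl_expr_def qd
    using primitive_has_derivative[OF u] in_ab
  proof eventually_elim
    case (elim t)
    have "vector_derivative u (at t within {a..b}) = of_real (q t) * y t - g t"
      by (rule vector_derivative_within_closed_interval[OF ab elim(2,1)])
    then show ?case using elim by (auto intro: differentiableI_vector)
  qed
  moreover have "sl_bc a b p \<alpha> \<beta> y" using B by (auto simp: sl_bc_def bvp_def qd left_bc_def right_bc_def)
  ultimately show "y \<in> sl_dom a b p \<and> sl_eq a b p q y g \<and> sl_bc a b p \<alpha> \<beta> y" by blast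
qed

lemma sols_iff: "y \<in> L \<mu> \<longleftrightarrow> (\<exists>u. eigen \<mu> y u)"
proof -
  have int: "integrable M (\<lambda>t. \<mu> * of_real (\<Delta> t) * y t)" if "continuous_on {a..b} y"
    using q_mult_integrable(3)[OF that] by (simp add: mult.assoc)
  have "continuous_on {a..b} y" if "y \<in> L \<mu> \<or> (\<exists>u. eigen \<mu> y u)"
    using that
    by (auto simp: sl_sols_def sl_dom_def bvp_def intro: sys_continuous abs_continuous_on_imp_continuous)
  then show ?thesis using bvp_iff[OF int] by (auto simp: sl_sols_def)
qed

lemma F_iff: "y \<in> sl_F a b p q \<Delta> \<alpha> \<beta> \<longleftrightarrow> (\<exists>f\<in>H. \<exists>u. bvp (\<lambda>t. of_real (\<Delta> t) * f t) y u)"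
  using bvp_iff[OF wL2_integrable] unfolding sl_F_def by blast

lemma sys_lin:
  assumes "sys g y u" "sys h z w"
  shows "sys (\<lambda>t. g t + c * h t) (\<lambda>t. y t + c * z t) (\<lambda>t. u t + c * w t)"
  unfolding sys_def
proof (intro conjI)
  show "primitive a b (\<lambda>t. of_real (1 / p t) * (u t + c * w t)) (\<lambda>t. y t + c * z t)"
    using primitive_add[of a b _ y _ "\<lambda>t. c * z t", OF _ primitive_cmult[of a b _ z c]] assms unfolding sys_def
    by (elim conjE) (rule primitive_cong, assumption?, auto simp: algebra_simps)
  show "primitive a b (\<lambda>t. of_real (q t) * (y t + c * z t) - (g t + c * h t)) (\<lambda>t. u t + c * w t)"
    using primitive_add[of a b _ u _ "\<lambda>t. c * w t", OF _ primitive_cmult[of a b _ w c]] assms unfolding sys_def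
    by (elim conjE) (rule primitive_cong, assumption?, auto simp: algebra_simps)
qed

lemma bvp_lin:
  assumes "bvp g y u" "bvp h z w"
  shows "bvp (\<lambda>t. g t + c * h t) (\<lambda>t. y t + c * z t) (\<lambda>t. u t + c * w t)"
proof -
  have "left_bc (\<lambda>t. y t + c * z t) (\<lambda>t. u t + c * w t)"
  proof -
    have "of_real (cos \<alpha>) * (y a + c * z a) + of_real (sin \<alpha>) * (u a + c * w a) =
      (of_real (cos \<alpha>) * y a + of_real (sin \<alpha>) * u a) + c * (of_real (cos \<alpha>) * z a + of_real (sin \<alpha>) * w a)"
      by (simp add: algebra_simps)
    then show ?thesis using assms by (simp add: bvp_def left_bc_def)
  qed
  moreover have "right_bc (\<lambda>t. y t + c * z t) (\<lambda>t. u t + c * w t)"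
  proof -
    have "of_real (cos \<beta>) * (y b + c * z b) + of_real (sin \<beta>) * (u b + c * w b) =
      (of_real (cos \<beta>) * y b + of_real (sin \<beta>) * u b) + c * (of_real (cos \<beta>) * z b + of_real (sin \<beta>) * w b)"
      by (simp add: algebra_simps)
    then show ?thesis using assms by (simp add: bvp_def right_bc_def)
  qed
  ultimately show ?thesis using assms by (auto simp: bvp_def intro: sys_lin)
qed

lemma sys_cong:
  assumes "sys g y u" "\<And>t. t \<in> {a..b} \<Longrightarrow> g t = h t" "\<And>t. t \<in> {a..b} \<Longrightarrow> y t = z t" "\<And>t. t \<in> {a..b} \<Longrightarrow> u t = w t"
  shows "sys h z w"
  using assms unfolding sys_def
  by (auto intro: primitive_cong)

lemma bvp_cong:
  assumes "bvp g y u" "\<And>t. t \<in> {a..b} \<Longrightarrow> g t = h t" shows "bvp h y u"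
  using assms sys_cong[of g y u h y u] by (auto simp: bvp_def)

lemma sys_cnj:
  assumes "sys g y u" shows "sys (\<lambda>t. cnj (g t)) (\<lambda>t. cnj (y t)) (\<lambda>t. cnj (u t))"
proof -
  have "primitive a b (\<lambda>t. of_real (1 / p t) * cnj (u t)) (\<lambda>t. cnj (y t))"
    using assms primitive_cnj[of a b "\<lambda>t. of_real (1 / p t) * u t" y] by (simp add: sys_def)
  moreover have "primitive a b (\<lambda>t. of_real (q t) * cnj (y t) - cnj (g t)) (\<lambda>t. cnj (u t))"
    using assms primitive_cnj[of a b "\<lambda>t. of_real (q t) * y t - g t" u] by (simp add: sys_def)
  ultimately show ?thesis by (simp add: sys_def)
qed

text \<open>
  The Wronskian of two solutions has derivative \<open>g1 y2 - y1 g2\<close>, because the terms with \<open>1/p\<close> and \<open>q\<close> cancel.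
\<close>
lemma lagrange:
  assumes 1: "sys g1 y1 u1" and 2: "sys g2 y2 u2"
  shows "primitive a b (\<lambda>t. g1 t * y2 t - y1 t * g2 t) (\<lambda>t. y1 t * u2 t - u1 t * y2 t)"
proof -
  have A: "primitive a b (\<lambda>t. (of_real (1 / p t) * u1 t) * u2 t + y1 t * (of_real (q t) * y2 t - g2 t)) (\<lambda>t. y1 t * u2 t)"
    using 1 2 by (intro primitive_mult[OF ab_le]) (auto simp: sys_def)
  have B: "primitive a b (\<lambda>t. (of_real (q t) * y1 t - g1 t) * y2 t + u1 t * (of_real (1 / p t) * u2 t)) (\<lambda>t. u1 t * y2 t)"
    using 1 2 by (intro primitive_mult[OF ab_le]) (auto simp: sys_def)
  show ?thesis
    by (rule primitive_cong[OF primitive_add[OF A primitive_cmult[OF B, of "-1"]]]) (auto simp: algebra_simps)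
qed

lemma sys_exists:
  obtains y u where "hom \<mu> y u" "y a = c" "u a = d"
proof -
  have A: "integrable M (\<lambda>t. complex_of_real (1 / p t))" using p_int by (rule integrable_of_real)
  have B: "integrable M (\<lambda>t. complex_of_real (q t) - \<mu> * of_real (\<Delta> t))" using q_int \<Delta>_int by simp
  obtain y u where "primitive a b (\<lambda>t. of_real (1 / p t) * u t) y"
    "primitive a b (\<lambda>t. (of_real (q t) - \<mu> * of_real (\<Delta> t)) * y t) u" "y a = c" "u a = d"
    using linear_system_exists[OF ab_le A B] by metis
  then show thesis by (intro that[of y u]) (auto simp: sys_def algebra_simps)
qed

lemma wronskian_const:
  assumes "hom \<mu> y1 u1" "hom \<mu> y2 u2" "t \<in> {a..b}"
  shows "y1 t * u2 t - u1 t * y2 t = y1 a * u2 a - u1 a * y2 a"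
proof -
  have "primitive a b (\<lambda>t. 0) (\<lambda>t. y1 t * u2 t - u1 t * y2 t)"
    by (rule primitive_cong[OF lagrange[OF assms(1,2)]]) auto
  from primitive_eq[OF this assms(3)] show ?thesis by simp
qed

lemma fundamental:
  obtains \<phi> \<phi>' \<psi> \<psi>' where
    "hom \<mu> \<phi> \<phi>'" "\<phi> a = of_real (sin \<alpha>)" "\<phi>' a = - of_real (cos \<alpha>)"
    "hom \<mu> \<psi> \<psi>'" "\<psi> a = of_real (cos \<alpha>)" "\<psi>' a = of_real (sin \<alpha>)"
    "\<forall>t\<in>{a..b}. \<phi> t * \<psi>' t - \<phi>' t * \<psi> t = 1"
proof -
  obtain \<phi> \<phi>' where 1: "hom \<mu> \<phi> \<phi>'" "\<phi> a = of_real (sin \<alpha>)" "\<phi>' a = - of_real (cos \<alpha>)"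
    by (rule sys_exists)
  obtain \<psi> \<psi>' where 2: "hom \<mu> \<psi> \<psi>'" "\<psi> a = of_real (cos \<alpha>)" "\<psi>' a = of_real (sin \<alpha>)"
    by (rule sys_exists)
  have "complex_of_real (sin \<alpha>) * of_real (sin \<alpha>) + of_real (cos \<alpha>) * of_real (cos \<alpha>) = of_real ((sin \<alpha>)\<^sup>2 + (cos \<alpha>)\<^sup>2)"
    by (simp add: power2_eq_square)
  then have "\<forall>t\<in>{a..b}. \<phi> t * \<psi>' t - \<phi>' t * \<psi> t = 1"
    using wronskian_const[OF 1(1) 2(1)] 1 2 by simp
  from that[OF 1 2 this] show thesis .
qed

text \<open>
  Variation of constants without integrals: Wronskians with a fundamental system are constant, so the
  coefficients of \<open>y\<close> can be read off at any point \<open>s\<close>.  This gives uniqueness for initial values at every \<open>s\<close>.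
\<close>
lemma sys_representation:
  assumes y: "hom \<mu> y u"
    and \<phi>: "hom \<mu> \<phi> \<phi>'" and \<psi>: "hom \<mu> \<psi> \<psi>'"
    and W: "\<forall>t\<in>{a..b}. \<phi> t * \<psi>' t - \<phi>' t * \<psi> t = 1"
    and s: "s \<in> {a..b}" and t: "t \<in> {a..b}"
  shows "y t = (y s * \<psi>' s - u s * \<psi> s) * \<phi> t - (y s * \<phi>' s - u s * \<phi> s) * \<psi> t"
    "u t = (y s * \<psi>' s - u s * \<psi> s) * \<phi>' t - (y s * \<phi>' s - u s * \<phi> s) * \<psi>' t"
proof -
  have 1: "y s * \<psi>' s - u s * \<psi> s = y t * \<psi>' t - u t * \<psi> t"
    using wronskian_const[OF y \<psi> s] wronskian_const[OF y \<psi> t] by simp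
  have 2: "y s * \<phi>' s - u s * \<phi> s = y t * \<phi>' t - u t * \<phi> t"
    using wronskian_const[OF y \<phi> s] wronskian_const[OF y \<phi> t] by simp
  have "(y t * \<psi>' t - u t * \<psi> t) * \<phi> t - (y t * \<phi>' t - u t * \<phi> t) * \<psi> t = y t * (\<phi> t * \<psi>' t - \<phi>' t * \<psi> t)"
    "(y t * \<psi>' t - u t * \<psi> t) * \<phi>' t - (y t * \<phi>' t - u t * \<phi> t) * \<psi>' t = u t * (\<phi> t * \<psi>' t - \<phi>' t * \<psi> t)"
    by (simp_all add: algebra_simps)
  then show "y t = (y s * \<psi>' s - u s * \<psi> s) * \<phi> t - (y s * \<phi>' s - u s * \<phi> s) * \<psi> t"
    "u t = (y s * \<psi>' s - u s * \<psi> s) * \<phi>' t - (y s * \<phi>' s - u s * \<phi> s) * \<psi>' t"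
    unfolding 1 2 using W t by simp_all
qed

lemma sys_zero:
  assumes y: "hom \<mu> y u" and s: "s \<in> {a..b}" "y s = 0" "u s = 0" and t: "t \<in> {a..b}"
  shows "y t = 0" "u t = 0"
proof -
  obtain \<phi> \<phi>' \<psi> \<psi>' where *:
    "hom \<mu> \<phi> \<phi>'" "\<phi> a = of_real (sin \<alpha>)" "\<phi>' a = - of_real (cos \<alpha>)"
    "hom \<mu> \<psi> \<psi>'" "\<psi> a = of_real (cos \<alpha>)" "\<psi>' a = of_real (sin \<alpha>)"
    "\<forall>t\<in>{a..b}. \<phi> t * \<psi>' t - \<phi>' t * \<psi> t = 1" by (rule fundamental[of \<mu>])
  show "y t = 0" "u t = 0" using sys_representation[OF y *(1,4,7) s(1) t] s by simp_all
qed

text \<open>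
  Two applications of \<open>primitive_zero_set\<close>: \<open>y = 0\<close> forces \<open>u / p = 0\<close>, and then \<open>u = 0\<close> forces \<open>q y - g = 0\<close>.
\<close>
lemma sys_zero_set:
  assumes "sys g y u"
  shows "AE t in M. y t = 0 \<longrightarrow> u t = 0 \<and> g t = 0"
proof -
  have "AE t in M. y t = 0 \<longrightarrow> of_real (1 / p t) * u t = 0"
    "AE t in M. u t = 0 \<longrightarrow> of_real (q t) * y t - g t = 0"
    using assms[unfolded sys_def, THEN conjunct1, THEN primitive_zero_set]
      assms[unfolded sys_def, THEN conjunct2, THEN primitive_zero_set] .
  with p_nz show ?thesis by eventually_elim auto
qed

lemma AE_pos_witness:
  assumes "AE t in M. \<Delta> t > 0 \<longrightarrow> P t"
  obtains t where "t \<in> {a..b}" "P t"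
proof -
  have "\<not> negligible {t\<in>{a..b}. 0 < \<Delta> t}" using \<Delta>_pos by (auto simp: negligible_iff_emeasure0 negligible_imp_sets negligible_iff_null_sets)
  moreover have "negligible {t\<in>{a..b}. \<not> (\<Delta> t > 0 \<longrightarrow> P t)}" using assms by (simp add: AE_lebesgue_on_negligible)
  ultimately have "\<not> {t\<in>{a..b}. 0 < \<Delta> t} \<subseteq> {t\<in>{a..b}. \<not> (\<Delta> t > 0 \<longrightarrow> P t)}" using negligible_subset by blast
  then show thesis using that by blast
qed

text \<open>
  The weighted norm is only a seminorm, but it is definite on solutions of \<open>l[y] = \<mu> \<Delta> y\<close>: if it vanishes,
  \<open>y\<close> and \<open>u\<close> vanish together at some point of the set \<open>{\<Delta> > 0}\<close>, which has positive measure.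
\<close>
lemma eigen_definite:
  assumes y: "hom \<mu> y u" and 0: "Re (ip y y) = 0" and t: "t \<in> {a..b}"
  shows "y t = 0" "u t = 0"
proof -
  have "AE t in M. \<Delta> t > 0 \<longrightarrow> y t = 0" by (rule ip_zero_AE[OF wL2_continuous[OF sys_continuous(1)[OF y]] 0])
  with sys_zero_set[OF y] have "AE t in M. \<Delta> t > 0 \<longrightarrow> y t = 0 \<and> u t = 0" by eventually_elim auto
  then obtain s where "s \<in> {a..b}" "y s = 0 \<and> u s = 0" by (rule AE_pos_witness)
  then show "y t = 0" "u t = 0" using sys_zero[OF y _ _ _ t] by auto
qed

text \<open>
  Lagrange's identity for \<open>y1\<close> and the conjugate of \<open>y2\<close>; real boundary conditions make the Wronskian vanish
  at both ends.
\<close>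
lemma bvp_symmetric:
  assumes 1: "bvp g1 y1 u1" and 2: "bvp g2 y2 u2"
  shows "(LINT t|M. g1 t * cnj (y2 t)) = (LINT t|M. y1 t * cnj (g2 t))"
proof -
  have s1: "sys g1 y1 u1" and s2: "sys g2 y2 u2" using 1 2 by (auto simp: bvp_def)
  have P: "primitive a b (\<lambda>t. g1 t * cnj (y2 t) - y1 t * cnj (g2 t)) (\<lambda>t. y1 t * cnj (u2 t) - u1 t * cnj (y2 t))"
    by (rule lagrange[OF s1 sys_cnj[OF s2]])
  have "cnj (of_real (cos \<alpha>) * y2 a + of_real (sin \<alpha>) * u2 a) = 0" "cnj (of_real (cos \<beta>) * y2 b + of_real (sin \<beta>) * u2 b) = 0"
    using 2 by (simp_all add: bvp_def left_bc_def right_bc_def)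
  then have W: "y1 a * cnj (u2 a) - u1 a * cnj (y2 a) = 0" "y1 b * cnj (u2 b) - u1 b * cnj (y2 b) = 0"
    using 1 real_cos_sin_det_zero[of \<alpha> "y1 a" "u1 a" "cnj (y2 a)" "cnj (u2 a)"]
      real_cos_sin_det_zero[of \<beta> "y1 b" "u1 b" "cnj (y2 b)" "cnj (u2 b)"]
    by (simp_all add: bvp_def left_bc_def right_bc_def)
  have "integrable M (\<lambda>t. g1 t * cnj (y2 t))"
    by (rule integrable_mult_continuous[OF sys_integrable[OF s1] continuous_on_cnj[OF sys_continuous(1)[OF s2]]])
  moreover have "integrable M (\<lambda>t. cnj (g2 t) * y1 t)"
    using sys_integrable[OF sys_cnj[OF s2]] sys_continuous(1)[OF s1] by (rule integrable_mult_continuous)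
  ultimately have "(LINT t|M. g1 t * cnj (y2 t)) - (LINT t|M. y1 t * cnj (g2 t)) = (LINT t|M. g1 t * cnj (y2 t) - y1 t * cnj (g2 t))"
    by (subst Bochner_Integration.integral_diff) (auto simp: mult.commute)
  then show ?thesis using primitive_integral[OF ab_le P] W by simp
qed

lemma zero_in_sols: "(\<lambda>t. 0) \<in> L \<mu>"
proof -
  have "sys (\<lambda>t. 0) (\<lambda>t. 0) (\<lambda>t. 0)" by (simp add: sys_def primitive_def)
  then have "bvp (\<lambda>t. \<mu> * of_real (\<Delta> t) * 0) (\<lambda>t. 0) (\<lambda>t. 0)" by (simp add: bvp_def left_bc_def right_bc_def)
  then show ?thesis unfolding sols_iff by blast
qed

lemma EV_iff: "\<mu> \<in> EV \<longleftrightarrow> (\<exists>y u. eigen \<mu> y u \<and> y \<noteq> (\<lambda>t. 0))"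
proof -
  have "L \<mu> \<noteq> {\<lambda>t. 0} \<longleftrightarrow> (\<exists>y. y \<in> L \<mu> \<and> y \<noteq> (\<lambda>t. 0))" using zero_in_sols[of \<mu>] by blast
  then show ?thesis unfolding sl_EV_def mem_Collect_eq sols_iff by blast
qed

lemma eigen_norm_pos:
  assumes "eigen \<mu> y u" "y \<noteq> (\<lambda>t. 0)"
  shows "Re (ip y y) > 0"
proof -
  have s: "hom \<mu> y u" using assms by (simp add: bvp_def)
  have "Re (ip y y) \<noteq> 0"
  proof
    assume "Re (ip y y) = 0"
    then have "y t = 0" if "t \<in> {a..b}" for t using eigen_definite[OF s _ that] by simp
    then have "y t = 0" for t using assms(1) by (cases "t \<in> {a..b}") (auto simp: bvp_def)
    then show False using assms(2) by auto
  qed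
  moreover have "Re (ip y y) \<ge> 0"
    using wip_self[OF wL2_continuous[OF sys_continuous(1)[OF s]]] \<Delta>_nonneg
    by (auto intro!: Bochner_Integration.integral_nonneg)
  ultimately show ?thesis by simp
qed

lemma EV_real: assumes "\<mu> \<in> EV" shows "cnj \<mu> = \<mu>"
proof -
  obtain y u where B: "eigen \<mu> y u" "y \<noteq> (\<lambda>t. 0)" using assms by (auto simp: EV_iff)
  have "(LINT t|M. \<mu> * of_real (\<Delta> t) * y t * cnj (y t)) = (LINT t|M. y t * cnj (\<mu> * of_real (\<Delta> t) * y t))"
    by (rule bvp_symmetric[OF B(1) B(1)])
  then have "\<mu> * ip y y = cnj \<mu> * ip y y"
    unfolding wip_def by (simp add: mult.assoc mult.left_commute)
  moreover have "ip y y \<noteq> 0" using eigen_norm_pos[OF B] by auto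
  ultimately show ?thesis by simp
qed

lemma EV_subset_Reals: "EV \<subseteq> \<real>" using EV_real by (auto simp: Reals_cnj_iff)

text \<open>
  The solution \<open>\<phi>\<close> of the fundamental system satisfies the left boundary condition, so the coefficient of
  \<open>\<psi>\<close> in any other such solution is zero.
\<close>
lemma left_bc_unique:
  assumes y: "hom \<mu> y u" "left_bc y u"
    and z: "hom \<mu> z w" "left_bc z w" "z \<noteq> (\<lambda>t. 0)" "\<And>t. t \<notin> {a..b} \<Longrightarrow> z t = 0"
  obtains c where "\<And>t. t \<in> {a..b} \<Longrightarrow> y t = c * z t \<and> u t = c * w t"
proof -
  obtain \<phi> \<phi>' \<psi> \<psi>' where f:
    "hom \<mu> \<phi> \<phi>'" "\<phi> a = of_real (sin \<alpha>)" "\<phi>' a = - of_real (cos \<alpha>)"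
    "hom \<mu> \<psi> \<psi>'" "\<psi> a = of_real (cos \<alpha>)" "\<psi>' a = of_real (sin \<alpha>)"
    "\<forall>t\<in>{a..b}. \<phi> t * \<psi>' t - \<phi>' t * \<psi> t = 1" by (rule fundamental[of \<mu>])
  have phi: "\<exists>k. \<forall>t\<in>{a..b}. y t = k * \<phi> t \<and> u t = k * \<phi>' t"
    if y: "hom \<mu> y u" "left_bc y u" for y u
  proof -
    have 0: "y a * \<phi>' a - u a * \<phi> a = 0"
      using y(2) f(2,3) by (simp add: left_bc_def algebra_simps add_eq_0_iff)
    show ?thesis
    proof (rule exI[of _ "y a * \<psi>' a - u a * \<psi> a"], intro ballI conjI)
      fix t assume t: "t \<in> {a..b}"
      note rep = sys_representation[OF y(1) f(1,4,7) a_in t, unfolded 0 mult_zero_left diff_zero]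
      show "y t = (y a * \<psi>' a - u a * \<psi> a) * \<phi> t" "u t = (y a * \<psi>' a - u a * \<psi> a) * \<phi>' t"
        by (rule rep)+
    qed
  qed
  obtain k where k: "\<And>t. t \<in> {a..b} \<Longrightarrow> y t = k * \<phi> t \<and> u t = k * \<phi>' t" using phi[OF y] by blast
  obtain l where l: "\<And>t. t \<in> {a..b} \<Longrightarrow> z t = l * \<phi> t \<and> w t = l * \<phi>' t" using phi[OF z(1,2)] by blast
  have "l \<noteq> 0"
  proof
    assume "l = 0"
    then have "z t = 0" for t using l[of t] z(4)[of t] by (cases "t \<in> {a..b}") auto
    then show False using z(3) by auto
  qed
  then show thesis using k l by (intro that[of "k / l"]) auto
qed

lemma sols_dim:
  assumes "\<mu> \<in> EV" shows "cfun_dim (L \<mu>) = 1"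
proof -
  interpret vector_space cfun_scale by (rule vector_space_cfun_scale)
  obtain z w where z: "eigen \<mu> z w" "z \<noteq> (\<lambda>t. 0)" using assms by (auto simp: EV_iff)
  have "L \<mu> = span {z}"
  proof (intro equalityI subsetI)
    fix y assume "y \<in> L \<mu>"
    then obtain u where y: "eigen \<mu> y u" by (auto simp: sols_iff)
    obtain c where c: "\<And>t. t \<in> {a..b} \<Longrightarrow> y t = c * z t \<and> u t = c * w t"
      by (rule left_bc_unique[of \<mu> y u z w]) (use y z in \<open>auto simp: bvp_def\<close>)
    then have "y t = c * z t" for t using y z by (cases "t \<in> {a..b}") (auto simp: bvp_def)
    then have "y = cfun_scale c z" by (auto simp: cfun_scale_def)
    then show "y \<in> span {z}" by (simp add: span_base span_scale)
  next
    fix y assume "y \<in> span {z}"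
    then obtain c where "y = cfun_scale c z" by (auto simp: span_singleton)
    then have yc: "y = (\<lambda>t. c * z t)" by (simp add: cfun_scale_def)
    have "bvp (\<lambda>t. \<mu> * of_real (\<Delta> t) * z t + (c - 1) * (\<mu> * of_real (\<Delta> t) * z t)) (\<lambda>t. z t + (c - 1) * z t) (\<lambda>t. w t + (c - 1) * w t)"
      by (rule bvp_lin[OF z(1) z(1)])
    then have "eigen \<mu> y (\<lambda>t. c * w t)" by (simp add: yc algebra_simps)
    then show "y \<in> L \<mu>" by (auto simp: sols_iff)
  qed
  moreover have "independent {z}" using z(2) by (simp add: fun_eq_iff zero_fun_def)
  ultimately show ?thesis using dim_span_eq_card_independent[of "{z}"] by simp
qed

end

section \<open>Spaces with a positive semidefinite Hermitian form\<close>

lemma of_real_cmod_square: "(complex_of_real (cmod z))\<^sup>2 = z * cnj z"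
  using complex_norm_square[of z] by simp

text \<open>
  The form lives on a subspace \<open>H\<close> of a vector space and may be degenerate, since functions
  that differ only where \<open>\<Delta> = 0\<close> or on a null set are not identified.
\<close>
locale hermitian_space = vector_space scale
  for scale :: "complex \<Rightarrow> 'v::ab_group_add \<Rightarrow> 'v" (infixr \<open>*s\<close> 75) +
  fixes H :: "'v set" and ip :: "'v \<Rightarrow> 'v \<Rightarrow> complex"
  assumes subspace_H: "subspace H"
    and ip_add: "x \<in> H \<Longrightarrow> y \<in> H \<Longrightarrow> z \<in> H \<Longrightarrow> ip (x + y) z = ip x z + ip y z"
    and ip_scale: "x \<in> H \<Longrightarrow> y \<in> H \<Longrightarrow> ip (c *s x) y = c * ip x y"
    and ip_cnj: "x \<in> H \<Longrightarrow> y \<in> H \<Longrightarrow> ip y x = cnj (ip x y)"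
    and ip_nonneg: "x \<in> H \<Longrightarrow> 0 \<le> Re (ip x x)"
begin

definition nrm :: "'v \<Rightarrow> real" where "nrm x = sqrt (Re (ip x x))"

lemma H_closed [simp, intro]:
  "0 \<in> H" "x \<in> H \<Longrightarrow> y \<in> H \<Longrightarrow> x + y \<in> H" "x \<in> H \<Longrightarrow> c *s x \<in> H"
  "x \<in> H \<Longrightarrow> y \<in> H \<Longrightarrow> x - y \<in> H" "x \<in> H \<Longrightarrow> - x \<in> H"
  using subspace_H by (auto intro: subspace_0 subspace_add subspace_scale subspace_diff subspace_neg)

lemma H_sum [intro]: "(\<And>i. i \<in> F \<Longrightarrow> x i \<in> H) \<Longrightarrow> sum x F \<in> H"
  by (rule subspace_sum[OF subspace_H])

lemma ip_add_right:
  assumes "x \<in> H" "y \<in> H" "z \<in> H" shows "ip z (x + y) = ip z x + ip z y"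
  using assms ip_add[of x y z] ip_cnj[of "x + y" z] ip_cnj[of x z] ip_cnj[of y z] by simp

lemma ip_scale_right:
  assumes "x \<in> H" "y \<in> H" shows "ip x (c *s y) = cnj c * ip x y"
  using assms ip_scale[of y x c] ip_cnj[of "c *s y" x] ip_cnj[of y x] by simp

lemma ip_diff: assumes "x \<in> H" "y \<in> H" "z \<in> H" shows "ip (x - y) z = ip x z - ip y z"
  using ip_add[of "x - y" y z] assms by simp

lemma ip_diff_right: assumes "x \<in> H" "y \<in> H" "z \<in> H" shows "ip z (x - y) = ip z x - ip z y"
  using ip_add_right[of "x - y" y z] assms by simp

lemma ip_zero [simp]: "z \<in> H \<Longrightarrow> ip 0 z = 0" "z \<in> H \<Longrightarrow> ip z 0 = 0"
  using ip_diff[of z z z] ip_diff_right[of z z z] by auto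

lemma ip_sum: 
  assumes "\<And>i. i \<in> F \<Longrightarrow> x i \<in> H" "z \<in> H" shows "ip (sum x F) z = (\<Sum>i\<in>F. ip (x i) z)"
  using assms by (induction F rule: infinite_finite_induct) (auto simp: ip_add H_sum)

lemma ip_sum_right: 
  assumes "\<And>i. i \<in> F \<Longrightarrow> x i \<in> H" "z \<in> H" shows "ip z (sum x F) = (\<Sum>i\<in>F. ip z (x i))"
  using assms by (induction F rule: infinite_finite_induct) (auto simp: ip_add_right H_sum)

lemma nrm_nonneg: "x \<in> H \<Longrightarrow> 0 \<le> nrm x" by (simp add: nrm_def ip_nonneg)

lemma nrm_square: "x \<in> H \<Longrightarrow> (nrm x)\<^sup>2 = Re (ip x x)" by (simp add: nrm_def ip_nonneg)

lemma ip_self: assumes "x \<in> H" shows "ip x x = of_real ((nrm x)\<^sup>2)"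
proof -
  have "Im (ip x x) = 0" using arg_cong[OF ip_cnj[OF assms assms], of Im] by simp
  then show ?thesis by (simp add: complex_eq_iff nrm_square assms)
qed

lemma nrm_scale: assumes "x \<in> H" shows "nrm (c *s x) = cmod c * nrm x"
proof -
  have "ip (c *s x) (c *s x) = c * cnj c * ip x x"
    using assms ip_scale[of x "c *s x" c] ip_scale_right[of x x c] by (simp add: mult.assoc)
  then have "(nrm (c *s x))\<^sup>2 = Re ((c * cnj c) * of_real ((nrm x)\<^sup>2))"
    unfolding ip_self[OF assms, symmetric] using assms by (simp add: nrm_square)
  also have "\<dots> = (cmod c * nrm x)\<^sup>2"
    by (simp flip: complex_norm_square add: power_mult_distrib Re_power2)
  finally show ?thesis
    using assms by (simp add: nrm_nonneg power2_eq_iff_nonneg)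
qed

lemma nrm_add_square: assumes "x \<in> H" "y \<in> H" shows "(nrm (x + y))\<^sup>2 = (nrm x)\<^sup>2 + 2 * Re (ip x y) + (nrm y)\<^sup>2"
  using assms ip_cnj[of x y] by (simp add: nrm_square ip_add ip_add_right)

lemma nrm_diff_square: assumes "x \<in> H" "y \<in> H" shows "(nrm (x - y))\<^sup>2 = (nrm x)\<^sup>2 - 2 * Re (ip x y) + (nrm y)\<^sup>2"
  using assms ip_cnj[of x y] by (simp add: nrm_square ip_diff ip_diff_right)

text \<open>
  The quadratic polynomial \<open>t \<mapsto> \<parallel>x - t (x, y) y\<parallel>\<^sup>2\<close> is nonnegative; if \<open>\<parallel>y\<parallel> = 0\<close> it is affine and forces
  \<open>(x, y) = 0\<close>.
\<close>
lemma cauchy_schwarz: assumes x: "x \<in> H" and y: "y \<in> H" shows "cmod (ip x y) \<le> nrm x * nrm y"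
proof -
  define A B C where "A = (nrm x)\<^sup>2" and "B = (cmod (ip x y))\<^sup>2" and "C = (nrm y)\<^sup>2"
  have quad: "0 \<le> A - 2 * t * B + t\<^sup>2 * B * C" for t :: real
  proof -
    define c where "c = of_real t * ip x y"
    have "0 \<le> (nrm (x - c *s y))\<^sup>2" by simp
    also have "\<dots> = A - 2 * Re (cnj c * ip x y) + (cmod c)\<^sup>2 * C"
      using x y by (simp add: nrm_diff_square ip_scale_right nrm_scale A_def C_def power_mult_distrib)
    also have "cnj c * ip x y = of_real (t * B)"
      by (simp add: c_def B_def of_real_cmod_square mult.commute mult.left_commute)
    also have "(cmod c)\<^sup>2 = t\<^sup>2 * B" by (simp add: c_def B_def norm_mult power_mult_distrib)
    finally show ?thesis by (simp add: algebra_simps)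
  qed
  have B0: "B \<ge> 0" "A \<ge> 0" "C \<ge> 0" by (auto simp: A_def B_def C_def)
  have "B \<le> A * C"
  proof (cases "C = 0")
    case True
    have "B = 0"
    proof (rule ccontr)
      assume "B \<noteq> 0"
      then show False using quad[of "(A + 1) / B"] mult_nonneg_nonneg[OF B0(2,1)] True B0 by (simp add: field_simps)
    qed
    then show ?thesis using True by simp
  next
    case False
    then have C: "C > 0" using B0 by simp
    have "0 \<le> A - B / C" using quad[of "1 / C"] C by (simp add: power2_eq_square field_simps)
    then show ?thesis using C by (simp add: field_simps)
  qed
  then have "(cmod (ip x y))\<^sup>2 \<le> (nrm x * nrm y)\<^sup>2" by (simp add: A_def B_def C_def power_mult_distrib)
  then show ?thesis by (rule power2_le_imp_le) (simp add: nrm_nonneg x y)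
qed

lemma nrm_triangle: assumes x: "x \<in> H" and y: "y \<in> H" shows "nrm (x + y) \<le> nrm x + nrm y"
proof (rule power2_le_imp_le)
  have "Re (ip x y) \<le> nrm x * nrm y" using cauchy_schwarz[OF x y] complex_Re_le_cmod order_trans by blast
  then show "(nrm (x + y))\<^sup>2 \<le> (nrm x + nrm y)\<^sup>2" using x y by (simp add: nrm_add_square power2_sum)
qed (simp add: nrm_nonneg x y)

lemma nrm_minus: "x \<in> H \<Longrightarrow> nrm (- x) = nrm x"
  using nrm_scale[of x "-1"] by simp

lemma nrm_triangle_diff: assumes x: "x \<in> H" and y: "y \<in> H" shows "nrm (x - y) \<le> nrm x + nrm y"
  using nrm_triangle[of x "- y"] nrm_minus[of y] assms by auto

lemma nrm_diff_commute: "x \<in> H \<Longrightarrow> y \<in> H \<Longrightarrow> nrm (x - y) = nrm (y - x)"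
  using nrm_minus[of "x - y"] by simp

definition orthonormal :: "'i set \<Rightarrow> ('i \<Rightarrow> 'v) \<Rightarrow> bool" where
  "orthonormal I e \<longleftrightarrow> (\<forall>i\<in>I. e i \<in> H) \<and> (\<forall>i\<in>I. \<forall>j\<in>I. ip (e i) (e j) = (if i = j then 1 else 0))"

lemma orthonormal_ip_sum:
  assumes e: "orthonormal I e" and F: "finite F" "F \<subseteq> I" and k: "k \<in> I"
  shows "ip (\<Sum>i\<in>F. c i *s e i) (e k) = (if k \<in> F then c k else 0)"
proof -
  have "ip (\<Sum>i\<in>F. c i *s e i) (e k) = (\<Sum>i\<in>F. if i = k then c i else 0)"
  proof (subst ip_sum)
    show "c i *s e i \<in> H" if "i \<in> F" for i using e F that by (auto simp: orthonormal_def)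
    show "(\<Sum>i\<in>F. ip (c i *s e i) (e k)) = (\<Sum>i\<in>F. if i = k then c i else 0)"
      using e F k by (intro sum.cong refl) (auto simp: orthonormal_def ip_scale subset_iff)
  qed (use e k in \<open>auto simp: orthonormal_def\<close>)
  then show ?thesis using F by simp
qed

lemma orthonormal_nrm_sum:
  assumes e: "orthonormal I e" and F: "finite F" "F \<subseteq> I"
  shows "(nrm (\<Sum>i\<in>F. c i *s e i))\<^sup>2 = (\<Sum>i\<in>F. (cmod (c i))\<^sup>2)"
proof -
  have eH: "e i \<in> H" if "i \<in> F" for i using e F that by (auto simp: orthonormal_def)
  have "ip (\<Sum>i\<in>F. c i *s e i) (\<Sum>i\<in>F. c i *s e i) = (\<Sum>k\<in>F. cnj (c k) * c k)"
    using eH F by (subst ip_sum_right) (auto simp: ip_scale_right H_sum orthonormal_ip_sum[OF e F] subset_iff intro!: sum.cong)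
  also have "\<dots> = of_real (\<Sum>i\<in>F. (cmod (c i))\<^sup>2)"
    by (simp add: of_real_cmod_square mult.commute)
  finally have "Re (ip (\<Sum>i\<in>F. c i *s e i) (\<Sum>i\<in>F. c i *s e i)) = (\<Sum>i\<in>F. (cmod (c i))\<^sup>2)" by simp
  then show ?thesis using eH by (subst nrm_square) (auto intro!: H_sum)
qed

lemma bessel:
  assumes e: "orthonormal I e" and F: "finite F" "F \<subseteq> I" and x: "x \<in> H"
  shows "(\<Sum>i\<in>F. (cmod (ip x (e i)))\<^sup>2) \<le> (nrm x)\<^sup>2"
proof -
  define s where "s = (\<Sum>i\<in>F. ip x (e i) *s e i)"
  have eH: "e i \<in> H" if "i \<in> F" for i using e F that by (auto simp: orthonormal_def)
  have sH: "s \<in> H" unfolding s_def using eH by auto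
  have "ip x s = (\<Sum>i\<in>F. cnj (ip x (e i)) * ip x (e i))"
    unfolding s_def using eH x by (subst ip_sum_right) (auto simp: ip_scale_right)
  also have "\<dots> = of_real (\<Sum>i\<in>F. (cmod (ip x (e i)))\<^sup>2)" by (simp add: of_real_cmod_square mult.commute)
  finally have "Re (ip x s) = (\<Sum>i\<in>F. (cmod (ip x (e i)))\<^sup>2)" by simp
  moreover have "(nrm s)\<^sup>2 = (\<Sum>i\<in>F. (cmod (ip x (e i)))\<^sup>2)" unfolding s_def by (rule orthonormal_nrm_sum[OF e F])
  moreover have "0 \<le> (nrm (x - s))\<^sup>2" by simp
  ultimately show ?thesis using nrm_diff_square[OF x sH] by simp
qed

text \<open>
  By Bessel's inequality the partial sums are a Cauchy sequence; \<open>x\<close> minus their limit is orthogonal to all \<open>e k\<close>.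
\<close>
lemma orthonormal_expansion:
  assumes e: "orthonormal (UNIV :: nat set) e" and x: "x \<in> H"
    and complete: "\<And>s :: nat \<Rightarrow> 'v. (\<And>n. s n \<in> H) \<Longrightarrow> (\<And>\<epsilon>. \<epsilon> > 0 \<Longrightarrow> \<exists>N. \<forall>m\<ge>N. \<forall>n\<ge>N. nrm (s m - s n) < \<epsilon>)
         \<Longrightarrow> \<exists>h\<in>H. (\<lambda>n. nrm (s n - h)) \<longlonglongrightarrow> 0"
    and total: "\<And>g. g \<in> H \<Longrightarrow> (\<And>k. ip g (e k) = 0) \<Longrightarrow> nrm g = 0"
  shows "(\<lambda>n. nrm (x - (\<Sum>k<n. ip x (e k) *s e k))) \<longlonglongrightarrow> 0"
proof -
  define s where "s = (\<lambda>n. \<Sum>k<n. ip x (e k) *s e k)"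
  have eH: "e k \<in> H" for k using e by (auto simp: orthonormal_def)
  have sH: "s n \<in> H" for n unfolding s_def using eH by auto
  define c where "c = (\<lambda>k. (cmod (ip x (e k)))\<^sup>2)"
  have "summable c"
  proof (rule summableI_nonneg_bounded)
    show "(\<Sum>k<n. c k) \<le> (nrm x)\<^sup>2" for n unfolding c_def by (rule bessel[OF e _ _ x]) auto
  qed (simp add: c_def)
  then have cau: "Cauchy (\<lambda>n. sum c {..<n})" by (simp add: summable_iff_convergent convergent_Cauchy)
  have diff: "(nrm (s m - s n))\<^sup>2 = \<bar>sum c {..<m} - sum c {..<n}\<bar>" for m n
  proof -
    have *: "(nrm (s m - s n))\<^sup>2 = \<bar>sum c {..<m} - sum c {..<n}\<bar>" if "n \<le> m" for m n
    proof -
      have split: "{..<m} = {..<n} \<union> {n..<m}" "{..<n} \<inter> {n..<m} = {}" using that by auto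
      have "s m - s n = (\<Sum>k\<in>{n..<m}. ip x (e k) *s e k)"
        unfolding s_def split(1) by (subst sum.union_disjoint) auto
      then have 1: "(nrm (s m - s n))\<^sup>2 = sum c {n..<m}"
        unfolding c_def by (simp add: orthonormal_nrm_sum[OF e])
      have 2: "sum c {n..<m} = sum c {..<m} - sum c {..<n}"
        unfolding split(1) by (subst sum.union_disjoint) auto
      have "sum c {n..<m} \<ge> 0" by (rule sum_nonneg) (simp add: c_def)
      then show ?thesis using 1 2 by linarith
    qed
    show ?thesis
      using *[of m n] *[of n m] nrm_diff_commute[OF sH sH, of m n] by (cases "n \<le> m") auto
  qed
  have "\<exists>N. \<forall>m\<ge>N. \<forall>n\<ge>N. nrm (s m - s n) < \<epsilon>" if "\<epsilon> > 0" for \<epsilon>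
  proof -
    have "\<epsilon>\<^sup>2 > 0" using that by simp
    then obtain N where N: "\<forall>m\<ge>N. \<forall>n\<ge>N. \<bar>sum c {..<m} - sum c {..<n}\<bar> < \<epsilon>\<^sup>2"
      using cau unfolding Cauchy_def dist_real_def by blast
    then have "\<forall>m\<ge>N. \<forall>n\<ge>N. nrm (s m - s n) < \<epsilon>"
      unfolding diff[symmetric] using that by (meson less_imp_le power2_less_imp_less)
    then show ?thesis by blast
  qed
  from complete[OF sH this] obtain h where h: "h \<in> H" "(\<lambda>n. nrm (s n - h)) \<longlonglongrightarrow> 0" by blast
  have "ip (x - h) (e k) = 0" for k
  proof -
    have "(\<lambda>n. cmod (ip (x - h) (e k))) \<longlonglongrightarrow> 0"
    proof (rule tendsto_sandwich[OF _ _ tendsto_const])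
      show "(\<lambda>n. nrm (s n - h) * nrm (e k)) \<longlonglongrightarrow> 0" using tendsto_mult_right[OF h(2)] by simp
      show "\<forall>\<^sub>F n in sequentially. cmod (ip (x - h) (e k)) \<le> nrm (s n - h) * nrm (e k)"
      proof (rule eventually_sequentiallyI[of "Suc k"])
        fix n assume "Suc k \<le> n"
        then have "ip (s n) (e k) = ip x (e k)" unfolding s_def using orthonormal_ip_sum[OF e] by auto
        then have "ip (x - h) (e k) = ip (s n - h) (e k)" using x h sH eH by (simp add: ip_diff)
        then show "cmod (ip (x - h) (e k)) \<le> nrm (s n - h) * nrm (e k)"
          using cauchy_schwarz[of "s n - h" "e k"] sH h eH by auto
      qed
    qed auto
    then show ?thesis using LIMSEQ_unique[OF _ tendsto_const] by (metis norm_eq_zero)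
  qed
  then have 0: "nrm (x - h) = 0" using total x h by blast
  show ?thesis
  proof (rule tendsto_sandwich[OF _ _ tendsto_const h(2)])
    show "\<forall>\<^sub>F n in sequentially. nrm (x - (\<Sum>k<n. ip x (e k) *s e k)) \<le> nrm (s n - h)"
    proof (rule always_eventually, rule allI)
      fix n
      have "nrm (x - s n) \<le> nrm (x - h) + nrm (s n - h)"
        using nrm_triangle_diff[of "x - h" "s n - h"] x h sH by (simp add: algebra_simps)
      then show "nrm (x - (\<Sum>k<n. ip x (e k) *s e k)) \<le> nrm (s n - h)" using 0 by (simp add: s_def)
    qed
    show "\<forall>\<^sub>F n in sequentially. 0 \<le> nrm (x - (\<Sum>k<n. ip x (e k) *s e k))"
      using x sH unfolding s_def by (intro always_eventually allI nrm_nonneg) auto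
  qed
qed

end

section \<open>Compact symmetric operators\<close>

locale compact_symmetric = hermitian_space scale H ip
  for scale :: "complex \<Rightarrow> 'v::ab_group_add \<Rightarrow> 'v" (infixr \<open>*s\<close> 75) and H ip +
  fixes K :: "'v \<Rightarrow> 'v"
  assumes K_in: "x \<in> H \<Longrightarrow> K x \<in> H"
    and K_add: "x \<in> H \<Longrightarrow> y \<in> H \<Longrightarrow> K (x + y) = K x + K y"
    and K_scale: "x \<in> H \<Longrightarrow> K (c *s x) = c *s K x"
    and K_sym: "x \<in> H \<Longrightarrow> y \<in> H \<Longrightarrow> ip (K x) y = ip x (K y)"
    and K_bounded: "\<exists>B. \<forall>x\<in>H. nrm (K x) \<le> B * nrm x"
    and K_compact: "\<And>x :: nat \<Rightarrow> 'v. (\<And>n. x n \<in> H \<and> nrm (x n) \<le> 1) \<Longrightarrow>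
        \<exists>z\<in>H. \<exists>r. strict_mono r \<and> (\<lambda>n. nrm (K (x (r n)) - z)) \<longlonglongrightarrow> 0"
begin

lemma K_diff: "x \<in> H \<Longrightarrow> y \<in> H \<Longrightarrow> K (x - y) = K x - K y"
  using K_add[of "x - y" y] by simp

text \<open>
  Let \<open>N\<close> be the orthogonal complement of \<open>V\<close>; it is invariant under \<open>K\<close>.  Let \<open>c > 0\<close> be the norm of \<open>K\<close> on \<open>N\<close>
  and let \<open>x n\<close> be vectors in the unit ball of \<open>N\<close> with \<open>\<parallel>K (x n)\<parallel> \<longlonglongrightarrow> c\<close>.  Symmetry gives
  \<open>\<parallel>K (K (x n)) - c\<^sup>2 x n\<parallel>\<^sup>2 \<le> c\<^sup>2 (c\<^sup>2 - \<parallel>K (x n)\<parallel>\<^sup>2)\<close>, so a limit \<open>z\<close> of the vectors \<open>K (x n)\<close> satisfies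
  \<open>K (K z) = c\<^sup>2 z\<close>.  Then either \<open>K z + c z\<close> is an eigenvector for \<open>c\<close>, or it has norm zero and \<open>z\<close> is an
  eigenvector for \<open>- c\<close>.
\<close>
theorem eigenvector_in_orthocomplement:
  assumes V: "V \<subseteq> H" "\<And>v. v \<in> V \<Longrightarrow> \<exists>\<kappa>::real. K v = of_real \<kappa> *s v"
    and g: "g \<in> H" "\<And>v. v \<in> V \<Longrightarrow> ip g v = 0" "nrm (K g) \<noteq> 0"
  obtains z \<kappa> where "z \<in> H" "\<And>v. v \<in> V \<Longrightarrow> ip z v = 0" "nrm z \<noteq> 0" "\<kappa> \<noteq> (0::real)" "nrm (K z - of_real \<kappa> *s z) = 0"
proof -
  define N where "N = {x\<in>H. \<forall>v\<in>V. ip x v = 0}"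
  have NH: "x \<in> H" if "x \<in> N" for x using that by (simp add: N_def)
  have KN: "K x \<in> N" if x: "x \<in> N" for x
  proof -
    have "ip (K x) v = 0" if v: "v \<in> V" for v
    proof -
      obtain \<kappa> :: real where "K v = of_real \<kappa> *s v" using V(2)[OF v] by blast
      then show ?thesis using x v V(1) K_sym[of x v] ip_scale_right[of x v] by (auto simp: N_def)
    qed
    then show ?thesis using x K_in by (auto simp: N_def)
  qed
  have N_add: "x + y \<in> N" if "x \<in> N" "y \<in> N" for x y using that V(1) by (auto simp: N_def ip_add subset_iff)
  have N_scale: "c *s x \<in> N" if "x \<in> N" for c x using that V(1) by (auto simp: N_def ip_scale subset_iff)
  obtain B where B: "\<And>x. x \<in> H \<Longrightarrow> nrm (K x) \<le> B * nrm x" using K_bounded by blast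
  define S where "S = {nrm (K x) | x. x \<in> N \<and> nrm x \<le> 1}"
  have Sbdd: "bdd_above S"
  proof (rule bdd_aboveI)
    fix s assume "s \<in> S"
    then obtain x where x: "x \<in> N" "nrm x \<le> 1" "s = nrm (K x)" by (auto simp: S_def)
    have "nrm (K x) \<le> B * nrm x" using B NH x by blast
    also have "\<dots> \<le> \<bar>B\<bar> * 1" using x(2) nrm_nonneg[OF NH[OF x(1)]] by (intro mult_mono) auto
    finally show "s \<le> \<bar>B\<bar>" using x by simp
  qed
  define c where "c = Sup S"
  have bound: "nrm (K x) \<le> c * nrm x" if x: "x \<in> N" for x
  proof (cases "nrm x = 0")
    case True
    then show ?thesis using B[OF NH[OF x]] by simp
  next
    case False
    then have pos: "nrm x > 0" using nrm_nonneg[OF NH[OF x]] by simp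
    have xH: "x \<in> H" using NH x by blast
    define y where "y = of_real (1 / nrm x) *s x"
    have "nrm y = 1" using pos xH unfolding y_def by (subst nrm_scale) (auto simp: norm_divide)
    moreover have "nrm (K y) = nrm (K x) / nrm x"
      using pos xH K_in[OF xH] unfolding y_def by (simp add: K_scale nrm_scale norm_divide)
    ultimately have "nrm (K x) / nrm x \<in> S" unfolding S_def using N_scale[OF x] y_def by (metis (mono_tags, lifting) mem_Collect_eq order_refl)
    then have "nrm (K x) / nrm x \<le> c" unfolding c_def using Sbdd by (rule cSup_upper)
    then show ?thesis using pos by (simp add: field_simps)
  qed
  have gN: "g \<in> N" using g by (simp add: N_def)
  have cpos: "c > 0"
  proof (rule ccontr)
    assume "\<not> c > 0"
    then have "c * nrm g \<le> 0" using nrm_nonneg[OF g(1)] by (simp add: mult_nonpos_nonneg)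
    then show False using bound[OF gN] g(3) nrm_nonneg[OF K_in[OF g(1)]] by simp
  qed
  have Sne: "S \<noteq> {}" unfolding S_def using N_scale[OF gN, of 0] nrm_scale[OF g(1), of 0] by force
  have "\<exists>x. x \<in> N \<and> nrm x \<le> 1 \<and> c - 1 / real (Suc n) < nrm (K x)" for n
  proof -
    have "c - 1 / real (Suc n) < Sup S" unfolding c_def by simp
    then obtain s where "s \<in> S" "c - 1 / real (Suc n) < s" using less_cSupD[OF Sne] by blast
    then show ?thesis by (auto simp: S_def)
  qed
  then obtain x where x: "\<And>n. x n \<in> N" "\<And>n. nrm (x n) \<le> 1" "\<And>n. c - 1 / real (Suc n) < nrm (K (x n))" by metis
  obtain z r where z: "z \<in> H" and r: "strict_mono r" and lim: "(\<lambda>n. nrm (K (x (r n)) - z)) \<longlonglongrightarrow> 0"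
    using K_compact[of x] x NH by blast
  define w where "w = (\<lambda>n. K (x (r n)))"
  have wN: "w n \<in> N" for n unfolding w_def using KN x(1) by blast
  have wH: "w n \<in> H" for n using wN NH by blast
  have lim: "(\<lambda>n. nrm (z - w n)) \<longlonglongrightarrow> 0" using lim nrm_diff_commute[OF z wH] unfolding w_def by simp
  have zN: "z \<in> N"
  proof -
    have "ip z v = 0" if v: "v \<in> V" for v
    proof -
      have vH: "v \<in> H" using v V by auto
      have "(\<lambda>n. cmod (ip z v)) \<longlonglongrightarrow> 0"
      proof (rule tendsto_sandwich[OF _ _ tendsto_const])
        show "(\<lambda>n. nrm (z - w n) * nrm v) \<longlonglongrightarrow> 0" using tendsto_mult_right[OF lim] by simp
        show "\<forall>\<^sub>F n in sequentially. cmod (ip z v) \<le> nrm (z - w n) * nrm v"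
        proof (rule always_eventually, rule allI)
          fix n
          have "ip (z - w n) v = ip z v" using z wH vH wN[of n] v by (simp add: ip_diff N_def)
          then show "cmod (ip z v) \<le> nrm (z - w n) * nrm v" using cauchy_schwarz[of "z - w n" v] z wH vH by auto
        qed
      qed auto
      then show ?thesis using LIMSEQ_unique[OF _ tendsto_const] by (metis norm_eq_zero)
    qed
    then show ?thesis using z by (simp add: N_def)
  qed
  have wlim: "(\<lambda>n. nrm (w n)) \<longlonglongrightarrow> c"
  proof (rule tendsto_sandwich[OF _ _ _ tendsto_const])
    have "(\<lambda>n. c - 1 / real (Suc (r n))) \<longlonglongrightarrow> c - 0"
      by (intro tendsto_diff tendsto_const LIMSEQ_subseq_LIMSEQ[OF LIMSEQ_Suc[OF lim_1_over_n] r, unfolded comp_def])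
    then show "(\<lambda>n. c - 1 / real (Suc (r n))) \<longlonglongrightarrow> c" by simp
    show "\<forall>\<^sub>F n in sequentially. c - 1 / real (Suc (r n)) \<le> nrm (w n)"
      unfolding w_def using x(3) by (intro always_eventually allI less_imp_le) auto
    show "\<forall>\<^sub>F n in sequentially. nrm (w n) \<le> c"
    proof (rule always_eventually, rule allI)
      fix n
      have "nrm (w n) \<le> c * nrm (x (r n))" unfolding w_def using bound x(1) by blast
      also have "\<dots> \<le> c * 1" using x(2) cpos by (intro mult_left_mono) auto
      finally show "nrm (w n) \<le> c" by simp
    qed
  qed
  have znorm: "nrm z \<noteq> 0"
  proof
    assume 0: "nrm z = 0"
    have "nrm (w n) \<le> nrm (z - w n)" for n
      using nrm_triangle_diff[of z "z - w n"] z wH 0 by simp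
    then have "c \<le> 0" using LIMSEQ_le[OF wlim lim] by blast
    then show False using cpos by simp
  qed
  define c2 :: complex where "c2 = of_real (c\<^sup>2)"
  have KKN: "K (K y) - c2 *s y \<in> N" if "y \<in> N" for y
  proof -
    have "K (K y) + (- c2) *s y \<in> N" using that KN N_add N_scale by blast
    then show ?thesis by simp
  qed
  have sq: "(nrm (K (K (x n)) - c2 *s x n))\<^sup>2 \<le> c\<^sup>2 * (c\<^sup>2 - (nrm (K (x n)))\<^sup>2)" for n
  proof -
    have xH: "x n \<in> H" using x NH by blast
    have KH: "K (x n) \<in> H" "K (K (x n)) \<in> H" using xH K_in by auto
    have "Re (ip (K (K (x n))) (c2 *s x n)) = c\<^sup>2 * (nrm (K (x n)))\<^sup>2"
      using ip_scale_right[OF KH(2) xH, of c2] K_sym[OF KH(1) xH] ip_self[OF KH(1)] by (simp add: c2_def)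
    then have "(nrm (K (K (x n)) - c2 *s x n))\<^sup>2
       = (nrm (K (K (x n))))\<^sup>2 - 2 * (c\<^sup>2 * (nrm (K (x n)))\<^sup>2) + (c\<^sup>2)\<^sup>2 * (nrm (x n))\<^sup>2"
      using xH KH by (simp add: nrm_diff_square nrm_scale c2_def power_mult_distrib norm_power)
    moreover have "(nrm (K (K (x n))))\<^sup>2 \<le> c\<^sup>2 * (nrm (K (x n)))\<^sup>2"
      using power_mono[OF bound[OF KN[OF x(1)]] nrm_nonneg[OF KH(2)], of 2] by (simp add: power_mult_distrib)
    moreover have "(c\<^sup>2)\<^sup>2 * (nrm (x n))\<^sup>2 \<le> (c\<^sup>2)\<^sup>2 * 1"
      using x(2)[of n] nrm_nonneg[OF xH] by (intro mult_left_mono) (auto simp: power_le_one)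
    ultimately show ?thesis by (simp add: power2_eq_square algebra_simps)
  qed
  have res0: "(\<lambda>n. nrm (K (K (x (r n))) - c2 *s x (r n))) \<longlonglongrightarrow> 0"
  proof -
    have "(\<lambda>n. c\<^sup>2 * (c\<^sup>2 - (nrm (w n))\<^sup>2)) \<longlonglongrightarrow> c\<^sup>2 * (c\<^sup>2 - c\<^sup>2)"
      by (intro tendsto_intros wlim)
    then have up: "(\<lambda>n. c\<^sup>2 * (c\<^sup>2 - (nrm (w n))\<^sup>2)) \<longlonglongrightarrow> 0" by simp
    have "(\<lambda>n. (nrm (K (K (x (r n))) - c2 *s x (r n)))\<^sup>2) \<longlonglongrightarrow> 0"
    proof (rule tendsto_sandwich[OF _ _ tendsto_const up])
      show "\<forall>\<^sub>F n in sequentially. (nrm (K (K (x (r n))) - c2 *s x (r n)))\<^sup>2 \<le> c\<^sup>2 * (c\<^sup>2 - (nrm (w n))\<^sup>2)"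
        unfolding w_def by (rule always_eventually, rule allI, rule sq)
    qed simp
    from tendsto_real_sqrt[OF this] show ?thesis
      using nrm_nonneg[OF NH[OF KKN[OF x(1)]]] by simp
  qed
  have eig2: "nrm (K (K z) - c2 *s z) = 0"
  proof -
    have le: "nrm (K (K z) - c2 *s z) \<le> c * (c * nrm (z - w n)) + c\<^sup>2 * nrm (z - w n) + c * nrm (K (K (x (r n))) - c2 *s x (r n))" for n
    proof -
      define d where "d = z - w n"
      define f where "f = K (K (x (r n))) - c2 *s x (r n)"
      have dN: "d \<in> N" using N_add[OF zN N_scale[OF wN, of "-1"]] by (simp add: d_def)
      have fN: "f \<in> N" unfolding f_def by (rule KKN[OF x(1)])
      have H: "d \<in> H" "f \<in> H" "K d \<in> H" "K (K d) \<in> H" "K f \<in> H" using dN fN NH K_in by auto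
      have xH: "x (r n) \<in> H" using x(1) NH by blast
      have "z = w n + d" by (simp add: d_def)
      then have "K (K z) - c2 *s z = (K (K d) - c2 *s d) + (K (K (w n)) - c2 *s w n)"
        using wH H by (simp add: K_add K_in scale_right_distrib)
      moreover have "K (K (w n)) - c2 *s w n = K f"
        unfolding f_def w_def using xH K_in by (simp add: K_diff K_scale)
      ultimately have "nrm (K (K z) - c2 *s z) \<le> nrm (K (K d) - c2 *s d) + nrm (K f)"
        using H nrm_triangle[of "K (K d) - c2 *s d" "K f"] by simp
      also have "nrm (K (K d) - c2 *s d) \<le> nrm (K (K d)) + nrm (c2 *s d)" using H by (intro nrm_triangle_diff) auto
      also have "nrm (c2 *s d) = c\<^sup>2 * nrm d" using H by (simp add: nrm_scale c2_def norm_power)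
      also have "nrm (K (K d)) \<le> c * nrm (K d)" by (rule bound[OF KN[OF dN]])
      also have "nrm (K d) \<le> c * nrm d" by (rule bound[OF dN])
      also have "nrm (K f) \<le> c * nrm f" by (rule bound[OF fN])
      finally show ?thesis using cpos by (simp add: d_def f_def mult_left_mono)
    qed
    have "(\<lambda>n. c * (c * nrm (z - w n)) + c\<^sup>2 * nrm (z - w n) + c * nrm (K (K (x (r n))) - c2 *s x (r n)))
       \<longlonglongrightarrow> c * (c * 0) + c\<^sup>2 * 0 + c * 0"
      by (intro tendsto_intros lim res0)
    then have "nrm (K (K z) - c2 *s z) \<le> 0" using LIMSEQ_le_const le by (metis (no_types, lifting) add_0 mult_zero_right)
    then show ?thesis using nrm_nonneg[OF NH[OF KKN[OF zN]]] by simp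
  qed
  define y where "y = K z + of_real c *s z"
  have yN: "y \<in> N" unfolding y_def using N_add[OF KN[OF zN] N_scale[OF zN]] .
  show thesis
  proof (cases "nrm y = 0")
    case True
    then show thesis
      using that[of z "- c"] zN znorm cpos unfolding y_def N_def by simp
  next
    case False
    have "K y - of_real c *s y = K (K z) - c2 *s z"
      unfolding y_def c2_def using z K_in[OF z]
      by (simp add: K_add K_scale scale_right_distrib power2_eq_square)
    then show thesis
      using that[of y c] yN False cpos eig2 by (simp add: N_def)
  qed
qed

end

section \<open>Infinite dimension and completeness of the weighted space\<close>

lemma equally_spaced_levels:
  fixes D :: "real \<Rightarrow> real"
  assumes ab: "a \<le> b" and D: "continuous_on {a..b} D" "D a = 0" "D b \<ge> 0" and n: "n > 0"
  obtains \<tau> where "\<And>j. j \<le> n \<Longrightarrow> a \<le> \<tau> j \<and> \<tau> j \<le> b \<and> D (\<tau> j) = real j / real n * D b"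
proof -
  have "\<exists>t. a \<le> t \<and> t \<le> b \<and> D t = real j / real n * D b" if j: "j \<le> n" for j
  proof (rule IVT')
    show "D a \<le> real j / real n * D b" using D by simp
    have "real j / real n * D b \<le> 1 * D b" using j n D by (intro mult_right_mono) auto
    then show "real j / real n * D b \<le> D b" by simp
  qed (use ab D in auto)
  then show thesis using that by metis
qed

text \<open>
  Elimination of one unknown and one equation at a time.
\<close>
lemma underdetermined_system:
  fixes A :: "'i \<Rightarrow> 'j \<Rightarrow> complex"
  assumes "finite I" "finite J" "card I < card J"
  obtains c where "\<exists>j\<in>J. c j \<noteq> 0" "\<And>i. i \<in> I \<Longrightarrow> (\<Sum>j\<in>J. A i j * c j) = 0"
proof -
  have "\<exists>c. (\<exists>j\<in>J. c j \<noteq> 0) \<and> (\<forall>i\<in>I. (\<Sum>j\<in>J. A i j * c j) = 0)"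
    using assms
  proof (induction I arbitrary: J A rule: finite_induct)
    case empty
    then obtain j where "j \<in> J" by fastforce
    then show ?case by (intro exI[of _ "\<lambda>_. 1"]) auto
  next
    case (insert i I)
    show ?case
    proof (cases "\<forall>j\<in>J. A i j = 0")
      case True
      have "card I < card J" using insert by simp
      then obtain c where "\<exists>j\<in>J. c j \<noteq> 0" "\<forall>k\<in>I. (\<Sum>j\<in>J. A k j * c j) = 0"
        using insert.IH[OF insert.prems(1), of A] by blast
      then show ?thesis using True by (intro exI[of _ c]) auto
    next
      case False
      then obtain l where l: "l \<in> J" "A i l \<noteq> 0" by blast
      define J' where "J' = J - {l}"
      have J': "finite J'" "card I < card J'" "l \<notin> J'" "J = insert l J'" using insert l by (auto simp: J'_def)
      obtain c where c: "\<exists>j\<in>J'. c j \<noteq> 0" "\<forall>k\<in>I. (\<Sum>j\<in>J'. (A k j - A k l * A i j / A i l) * c j) = 0"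
        using insert.IH[OF J'(1,2), of "\<lambda>k j. A k j - A k l * A i j / A i l"] by blast
      define S where "S = (\<Sum>j\<in>J'. A i j * c j)"
      define c' where "c' = (\<lambda>j. if j = l then - S / A i l else c j)"
      have sum': "(\<Sum>j\<in>J. A k j * c' j) = A k l * (- S / A i l) + (\<Sum>j\<in>J'. A k j * c j)" for k
      proof -
        have "(\<Sum>j\<in>J'. A k j * c' j) = (\<Sum>j\<in>J'. A k j * c j)"
          using J'(3) by (intro sum.cong) (auto simp: c'_def)
        then show ?thesis unfolding J'(4) using J'(1,3) by (simp add: c'_def)
      qed
      have "(\<Sum>j\<in>J. A k j * c' j) = 0" if k: "k \<in> insert i I" for k
      proof (cases "k = i")
        case True
        then show ?thesis using l(2) by (simp add: sum' S_def[symmetric])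
      next
        case False
        then have "(\<Sum>j\<in>J'. (A k j - A k l * A i j / A i l) * c j) = 0" using c(2) k by blast
        then have "(\<Sum>j\<in>J'. A k j * c j) - A k l / A i l * S = 0"
          by (simp add: S_def sum_distrib_left left_diff_distrib sum_subtractf mult.assoc)
        then show ?thesis by (simp add: sum')
      qed
      moreover have "\<exists>j\<in>J. c' j \<noteq> 0" using c(1) J'(3,4) by (auto simp: c'_def)
      ultimately show ?thesis by blast
    qed
  qed
  then show thesis using that by blast
qed

context hermitian_space
begin

lemma exists_orthogonal:
  assumes e: "orthonormal J e" "finite J" and I: "finite I" "card I < card J" and v: "\<And>i. i \<in> I \<Longrightarrow> v i \<in> H"
  obtains g where "g \<in> H" "nrm g \<noteq> 0" "\<And>i. i \<in> I \<Longrightarrow> ip g (v i) = 0"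
proof -
  obtain c where c: "\<exists>j\<in>J. c j \<noteq> 0" "\<And>i. i \<in> I \<Longrightarrow> (\<Sum>j\<in>J. ip (e j) (v i) * c j) = 0"
    using underdetermined_system[OF I(1) e(2) I(2), of "\<lambda>i j. ip (e j) (v i)"] by blast
  define g where "g = (\<Sum>j\<in>J. c j *s e j)"
  have eH: "e j \<in> H" if "j \<in> J" for j using e that by (auto simp: orthonormal_def)
  have gH: "g \<in> H" unfolding g_def using eH by auto
  have "(nrm g)\<^sup>2 = (\<Sum>j\<in>J. (cmod (c j))\<^sup>2)" unfolding g_def by (rule orthonormal_nrm_sum[OF e]) simp
  moreover have "(\<Sum>j\<in>J. (cmod (c j))\<^sup>2) \<noteq> 0"
    using c(1) e(2) by (subst sum_nonneg_eq_0_iff) auto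
  ultimately have "nrm g \<noteq> 0" by auto
  moreover have "ip g (v i) = 0" if "i \<in> I" for i
    unfolding g_def using c(2)[OF that] v[OF that] eH
    by (subst ip_sum) (auto simp: ip_scale mult.commute)
  ultimately show thesis using that gH by blast
qed

end

sublocale weight \<subseteq> hs: hermitian_space cfun_scale "wL2 a b \<Delta>" "wip a b \<Delta>"
proof (rule hermitian_space.intro[OF vector_space_cfun_scale], unfold_locales)
  interpret vector_space cfun_scale by (rule vector_space_cfun_scale)
  show "subspace H"
  proof (rule subspaceI)
    show "0 \<in> H" using wL2_continuous[of "\<lambda>_. 0"] by (simp add: zero_fun_def)
  qed (use wL2_add wL2_cmult in \<open>auto simp: plus_fun_def cfun_scale_def\<close>)
  fix x y z :: "real \<Rightarrow> complex" and c :: complex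
  show "ip (x + y) z = ip x z + ip y z" if "x \<in> H" "y \<in> H" "z \<in> H"
    unfolding wip_def plus_fun_def
    using Bochner_Integration.integral_add[OF wL2_mult_integrable[OF that(1,3)] wL2_mult_integrable[OF that(2,3)]]
    by (simp add: algebra_simps)
  show "ip (cfun_scale c x) y = c * ip x y" if "x \<in> H" "y \<in> H"
  proof -
    have "ip (cfun_scale c x) y = (LINT t|M. c * (of_real (\<Delta> t) * x t * cnj (y t)))"
      unfolding wip_def cfun_scale_def by (simp add: algebra_simps)
    then show ?thesis by (simp add: wip_def)
  qed
  show "ip y x = cnj (ip x y)" if "x \<in> H" "y \<in> H"
    unfolding wip_def by (subst Bochner_Integration.integral_cnj[symmetric]) (simp add: mult.commute mult.left_commute)
  show "0 \<le> Re (ip x x)" if "x \<in> H"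
    unfolding wip_self[OF that] using \<Delta>_nonneg by (auto intro!: Bochner_Integration.integral_nonneg)
qed

context weight
begin

lemma wnorm_eq_nrm: "wnorm a b \<Delta> f = hs.nrm f"
  by (simp add: wnorm_def hs.nrm_def)

lemma nrm_square_integral: "f \<in> H \<Longrightarrow> (hs.nrm f)\<^sup>2 = (LINT t|M. \<Delta> t * (cmod (f t))\<^sup>2)"
  by (simp add: hs.nrm_square wip_self)

lemma nn_integral_square:
  assumes f: "f \<in> H" shows "(\<integral>\<^sup>+t. ennreal (\<Delta> t * (cmod (f t))\<^sup>2) \<partial>M) = ennreal ((hs.nrm f)\<^sup>2)"
  unfolding nrm_square_integral[OF f]
  by (rule nn_integral_eq_integral[OF wL2_square_integrable[OF f]]) (rule AE_I2, use \<Delta>_nonneg in simp)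

lemma wL2_norm_fun: assumes f: "f \<in> H" shows "(\<lambda>t. complex_of_real (cmod (f t))) \<in> H"
proof (rule wL2_I[OF _ wL2_square_integrable[OF f]])
  show "(\<lambda>t. complex_of_real (cmod (f t))) \<in> borel_measurable (restrict_space borel {a..b})"
    using f unfolding wL2_def by auto
qed simp

text \<open>
  The square root of \<open>\<integral> \<Delta>\<close>, the constant in the comparison of the weighted norm with the supremum norm and with
  \<open>\<integral> \<Delta> |f|\<close>.
\<close>
definition nrm_one :: real where "nrm_one = hs.nrm (\<lambda>t. 1)"

lemma one_in_H: "(\<lambda>t. 1) \<in> H"
  by (rule wL2_continuous) simp

lemma nrm_one_square: "nrm_one\<^sup>2 = (LINT t|M. \<Delta> t)"
  using nrm_square_integral[OF one_in_H] by (simp add: nrm_one_def)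

lemma nrm_one_nonneg: "nrm_one \<ge> 0"
  unfolding nrm_one_def by (rule hs.nrm_nonneg[OF one_in_H])

text \<open>
  The inequality of Cauchy and Schwarz for \<open>|f|\<close> and the constant \<open>1\<close>.
\<close>
lemma weighted_L1_bound:
  assumes f: "f \<in> H" shows "integrable M (\<lambda>t. \<Delta> t * cmod (f t))" "(LINT t|M. \<Delta> t * cmod (f t)) \<le> nrm_one * hs.nrm f"
proof -
  define g where "g = (\<lambda>t. complex_of_real (cmod (f t)))"
  have g: "g \<in> H" unfolding g_def by (rule wL2_norm_fun[OF f])
  have "integrable M (\<lambda>t. norm (of_real (\<Delta> t) * f t))" using wL2_integrable[OF f] by (rule integrable_norm)
  moreover have "norm (of_real (\<Delta> t) * f t) = \<Delta> t * cmod (f t)" if "t \<in> {a..b}" for t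
    using \<Delta>_nonneg[OF that] by (simp add: norm_mult)
  ultimately show "integrable M (\<lambda>t. \<Delta> t * cmod (f t))"
    by (subst Bochner_Integration.integrable_cong[OF refl, of _ _ "\<lambda>t. norm (of_real (\<Delta> t) * f t)"]) auto
  have "hs.nrm g = hs.nrm f"
    using nrm_square_integral[OF f] nrm_square_integral[OF g] hs.nrm_nonneg[OF f] hs.nrm_nonneg[OF g]
      power2_eq_iff_nonneg[of "hs.nrm g" "hs.nrm f"]
    by (simp add: g_def)
  moreover have "ip g (\<lambda>t. 1) = of_real (LINT t|M. \<Delta> t * cmod (f t))"
    unfolding wip_def g_def by (simp flip: integral_complex_of_real)
  ultimately have "cmod (of_real (LINT t|M. \<Delta> t * cmod (f t))) \<le> hs.nrm f * nrm_one"
    using hs.cauchy_schwarz[OF g one_in_H] by (simp add: nrm_one_def)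
  then show "(LINT t|M. \<Delta> t * cmod (f t)) \<le> nrm_one * hs.nrm f" by (simp add: mult.commute)
qed

text \<open>
  A subsequence whose consecutive distances are summable converges almost everywhere on \<open>{\<Delta> > 0}\<close>, since the
  series of its increments converges absolutely there by monotone convergence.  Fatou's lemma shows
  that its pointwise limit is the limit in norm.
\<close>
theorem riesz_fischer:
  assumes s: "\<And>n::nat. s n \<in> H" and cau: "\<And>\<epsilon>. \<epsilon> > 0 \<Longrightarrow> \<exists>N. \<forall>m\<ge>N. \<forall>n\<ge>N. hs.nrm (s m - s n) < \<epsilon>"
  shows "\<exists>h\<in>H. (\<lambda>n. hs.nrm (s n - h)) \<longlonglongrightarrow> 0"
proof -
  have "\<exists>N. \<forall>m\<ge>N. \<forall>n\<ge>N. hs.nrm (s m - s n) < (1/2)^k" for k :: nat by (rule cau) simp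
  then obtain N where N: "\<And>k m n. m \<ge> N k \<Longrightarrow> n \<ge> N k \<Longrightarrow> hs.nrm (s m - s n) < (1/2)^k" by metis
  define r where "r = (\<lambda>k. sum N {..k})"
  have rN: "N k \<le> r k" for k unfolding r_def by (rule member_le_sum) auto
  have rSuc: "N k \<le> r (Suc k)" for k using rN[of k] by (simp add: r_def)
  define x where "x = (\<lambda>k. s (r k))"
  have xH: "x k \<in> H" for k using s by (simp add: x_def)
  have dH: "(\<lambda>t. x (Suc k) t - x k t) \<in> H" for k using hs.H_closed(4)[OF xH xH] by (simp add: fun_diff_def)
  have dn: "hs.nrm (\<lambda>t. x (Suc k) t - x k t) < (1/2)^k" for k
    using N[OF rSuc rN, of k] unfolding x_def by (simp add: fun_diff_def)
  define d where "d = (\<lambda>k t. \<Delta> t * cmod (x (Suc k) t - x k t))"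
  have d_int: "integrable M (d k)" for k unfolding d_def by (rule weighted_L1_bound(1)[OF dH])
  have d0: "0 \<le> d k t" if "t \<in> {a..b}" for k t using \<Delta>_nonneg[OF that] by (simp add: d_def)
  have "(\<integral>\<^sup>+t. (\<Sum>k. ennreal (d k t)) \<partial>M) = (\<Sum>k. \<integral>\<^sup>+t. ennreal (d k t) \<partial>M)"
    using d_int by (intro nn_integral_suminf) auto
  also have "\<dots> \<le> (\<Sum>k. ennreal (nrm_one * (1/2)^k))"
  proof (intro suminf_le summableI)
    fix k
    have "(\<integral>\<^sup>+t. ennreal (d k t) \<partial>M) = ennreal (LINT t|M. d k t)"
      by (rule nn_integral_eq_integral[OF d_int]) (rule AE_I2, use d0 in simp)
    also have "(LINT t|M. d k t) \<le> nrm_one * hs.nrm (\<lambda>t. x (Suc k) t - x k t)"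
      unfolding d_def by (rule weighted_L1_bound(2)[OF dH])
    also have "\<dots> \<le> nrm_one * (1/2)^k" using dn[of k] nrm_one_nonneg by (intro mult_left_mono) auto
    finally show "(\<integral>\<^sup>+t. ennreal (d k t) \<partial>M) \<le> ennreal (nrm_one * (1/2)^k)" by (simp add: ennreal_leI)
  qed
  also have "\<dots> = ennreal (\<Sum>k. nrm_one * (1/2)^k)"
    using nrm_one_nonneg by (intro suminf_ennreal2 summable_mult summable_geometric) auto
  also have "\<dots> < \<infinity>" by simp
  finally have "(\<integral>\<^sup>+t. (\<Sum>k. ennreal (d k t)) \<partial>M) \<noteq> \<infinity>" by simp
  then have "AE t in M. (\<Sum>k. ennreal (d k t)) \<noteq> \<infinity>"
    using d_int by (intro nn_integral_noteq_infinite) auto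
  moreover have in_ab: "AE t in M. t \<in> {a..b}" by (rule AE_I2) simp
  ultimately have conv: "AE t in M. \<Delta> t > 0 \<longrightarrow> convergent (\<lambda>k. x k t)"
  proof eventually_elim
    case (elim t)
    show ?case
    proof
      assume pos: "\<Delta> t > 0"
      have "summable (\<lambda>k. d k t)" using elim d0 by (intro summable_suminf_not_top) auto
      then have "summable (\<lambda>k. (1 / \<Delta> t) * d k t)" by (rule summable_mult)
      then have "summable (\<lambda>k. cmod (x (Suc k) t - x k t))" using pos by (simp add: d_def)
      then have "summable (\<lambda>k. x (Suc k) t - x k t)" by (rule summable_norm_cancel)
      then have "convergent (\<lambda>n. \<Sum>k<n. x (Suc k) t - x k t)" by (simp add: summable_iff_convergent)
      then have "convergent (\<lambda>n. x n t - x 0 t)" unfolding sum_lessThan_telescope[of "\<lambda>k. x k t"] .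
      then have "convergent (\<lambda>n. (x n t - x 0 t) + x 0 t)" by (intro convergent_add convergent_const)
      then show "convergent (\<lambda>k. x k t)" by simp
    qed
  qed
  define h where "h = (\<lambda>t. lim (\<lambda>k. x k t))"
  have xm: "x k \<in> borel_measurable (restrict_space borel {a..b})" for k using xH by (simp add: wL2_def)
  have hm: "h \<in> borel_measurable (restrict_space borel {a..b})"
    unfolding h_def by (intro borel_measurable_lim_metric xm)
  have sm: "s n \<in> borel_measurable (restrict_space borel {a..b})" for n using s by (simp add: wL2_def)
  have Fatou: "(\<integral>\<^sup>+t. ennreal (\<Delta> t * (cmod (s n t - h t))\<^sup>2) \<partial>M) \<le> ennreal (\<epsilon>\<^sup>2)"
    if "\<And>k. k \<ge> K \<Longrightarrow> hs.nrm (s n - x k) < \<epsilon>" for n K \<epsilon>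
  proof -
    have sxH: "(\<lambda>t. s n t - x k t) \<in> H" for k using hs.H_closed(4)[OF s xH] by (simp add: fun_diff_def)
    have "(\<integral>\<^sup>+t. ennreal (\<Delta> t * (cmod (s n t - h t))\<^sup>2) \<partial>M)
        = (\<integral>\<^sup>+t. liminf (\<lambda>k. ennreal (\<Delta> t * (cmod (s n t - x k t))\<^sup>2)) \<partial>M)"
    proof (rule nn_integral_cong_AE)
      show "AE t in M. ennreal (\<Delta> t * (cmod (s n t - h t))\<^sup>2) = liminf (\<lambda>k. ennreal (\<Delta> t * (cmod (s n t - x k t))\<^sup>2))"
        using conv in_ab
      proof eventually_elim
        case (elim t)
        show ?case
        proof (cases "\<Delta> t > 0")
          case True
          then have "(\<lambda>k. x k t) \<longlonglongrightarrow> h t" unfolding h_def using elim by (simp add: convergent_LIMSEQ_iff)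
          then have "(\<lambda>k. ennreal (\<Delta> t * (cmod (s n t - x k t))\<^sup>2)) \<longlonglongrightarrow> ennreal (\<Delta> t * (cmod (s n t - h t))\<^sup>2)"
            by (intro tendsto_ennrealI tendsto_intros)
          then show ?thesis by (metis lim_imp_Liminf sequentially_bot)
        next
          case False
          then have "\<Delta> t = 0" using \<Delta>_nonneg elim by force
          then show ?thesis by (simp add: Liminf_const)
        qed
      qed
    qed
    also have "\<dots> \<le> liminf (\<lambda>k. \<integral>\<^sup>+t. ennreal (\<Delta> t * (cmod (s n t - x k t))\<^sup>2) \<partial>M)"
      using wL2_square_integrable[OF sxH] by (intro nn_integral_liminf) auto
    also have "\<dots> \<le> limsup (\<lambda>k. \<integral>\<^sup>+t. ennreal (\<Delta> t * (cmod (s n t - x k t))\<^sup>2) \<partial>M)"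
      by (rule Liminf_le_Limsup) simp
    also have "\<dots> \<le> ennreal (\<epsilon>\<^sup>2)"
    proof (rule Limsup_bounded, rule eventually_sequentiallyI)
      fix k assume "K \<le> k"
      then have "hs.nrm (\<lambda>t. s n t - x k t) < \<epsilon>" using that by (simp add: fun_diff_def)
      then have "(hs.nrm (\<lambda>t. s n t - x k t))\<^sup>2 \<le> \<epsilon>\<^sup>2" using hs.nrm_nonneg[OF sxH] by (intro power_mono) auto
      then show "(\<integral>\<^sup>+t. ennreal (\<Delta> t * (cmod (s n t - x k t))\<^sup>2) \<partial>M) \<le> ennreal (\<epsilon>\<^sup>2)"
        unfolding nn_integral_square[OF sxH] by (rule ennreal_leI)
    qed
    finally show ?thesis .
  qed
  have close: "s n - h \<in> H \<and> hs.nrm (s n - h) \<le> \<epsilon>" if e: "\<epsilon> > 0" and K: "\<And>k. k \<ge> K \<Longrightarrow> hs.nrm (s n - x k) < \<epsilon>" for n K \<epsilon>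
  proof -
    note F = Fatou[of K n \<epsilon>, OF K]
    have m: "(\<lambda>t. s n t - h t) \<in> borel_measurable (restrict_space borel {a..b})"
      by (intro borel_measurable_diff sm hm)
    note mM = borel_measurable_lebesgue_on[OF m]
    have "integrable M (\<lambda>t. \<Delta> t * (cmod (s n t - h t))\<^sup>2)"
    proof (rule integrableI_nonneg)
      show "(\<lambda>t. \<Delta> t * (cmod (s n t - h t))\<^sup>2) \<in> borel_measurable M" using mM \<Delta>_measurable by measurable
      show "AE t in M. 0 \<le> \<Delta> t * (cmod (s n t - h t))\<^sup>2" by (rule AE_I2) (use \<Delta>_nonneg in simp)
      show "(\<integral>\<^sup>+t. ennreal (\<Delta> t * (cmod (s n t - h t))\<^sup>2) \<partial>M) < \<infinity>" using F by (simp add: le_less_trans)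
    qed
    then have H: "(\<lambda>t. s n t - h t) \<in> H" using m by (simp add: wL2_def)
    have "(hs.nrm (\<lambda>t. s n t - h t))\<^sup>2 \<le> \<epsilon>\<^sup>2" using F e unfolding nn_integral_square[OF H] by simp
    then have "hs.nrm (\<lambda>t. s n t - h t) \<le> \<epsilon>" using e by (auto intro: power2_le_imp_le)
    then show ?thesis using H by (simp add: fun_diff_def)
  qed
  have ev: "\<exists>N. \<forall>n\<ge>N. s n - h \<in> H \<and> hs.nrm (s n - h) \<le> \<epsilon>" if e: "\<epsilon> > 0" for \<epsilon>
  proof -
    obtain N' where N': "\<forall>m\<ge>N'. \<forall>n\<ge>N'. hs.nrm (s m - s n) < \<epsilon>" using cau[OF e] by blast
    obtain k0 where k0: "(1/2::real)^k0 < \<epsilon>" using real_arch_pow_inv[OF e, of "1/2"] by auto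
    have "s n - h \<in> H \<and> hs.nrm (s n - h) \<le> \<epsilon>" if n: "n \<ge> N k0" for n
    proof (rule close[OF e, of k0])
      fix k assume k: "k \<ge> k0"
      have "N k0 \<le> r k0" by (rule rN)
      also have "\<dots> \<le> r k" unfolding r_def using k by (intro sum_mono2) auto
      finally show "hs.nrm (s n - x k) < \<epsilon>" using N[OF n, of "r k"] k0 by (simp add: x_def)
    qed
    then show ?thesis by blast
  qed
  obtain n0 where "s n0 - h \<in> H" using ev[of 1] by auto
  then have "s n0 - (s n0 - h) \<in> H" by (rule hs.H_closed(4)[OF s])
  moreover have "s n0 - (s n0 - h) = h" by (simp add: fun_eq_iff)
  ultimately have hH: "h \<in> H" by (simp only:)
  have "(\<lambda>n. hs.nrm (s n - h)) \<longlonglongrightarrow> 0"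
  proof (rule LIMSEQ_I)
    fix e :: real assume "e > 0"
    then obtain N where "\<forall>n\<ge>N. hs.nrm (s n - h) \<le> e / 2" using ev[of "e/2"] by auto
    then show "\<exists>N. \<forall>n\<ge>N. norm (hs.nrm (s n - h) - 0) < e"
      using \<open>e > 0\<close> hs.nrm_nonneg[OF hs.H_closed(4)[OF s hH]] by (intro exI[of _ N]) fastforce
  qed
  then show ?thesis using hH by blast
qed

text \<open>
  Cut \<open>[a, b]\<close> into \<open>n\<close> intervals on which \<open>\<Delta>\<close> has equal integrals and normalise their indicator functions.
\<close>
lemma exists_orthonormal:
  assumes pos: "integral {a..b} \<Delta> > 0"
  shows "\<exists>e. hs.orthonormal {..<n::nat} e"
proof (cases "n = 0")
  case True
  then show ?thesis by (auto simp: hs.orthonormal_def)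
next
  case False
  define m where "m = integral {a..b} \<Delta>"
  define D where "D = (\<lambda>t. integral {a..t} \<Delta>)"
  have on: "\<Delta> integrable_on {a..b}" by (rule integrable_on_lebesgue_on[OF \<Delta>_int]) auto
  have onuv: "\<Delta> integrable_on {u..v}" if "a \<le> u" "v \<le> b" for u v
    using integrable_on_subinterval[OF on] that by auto
  have cont: "continuous_on {a..b} D" unfolding D_def by (rule indefinite_integral_continuous_1[OF on])
  have Dm: "D a = 0" "D b = m" by (simp_all add: D_def m_def)
  obtain \<tau> where \<tau>: "\<And>j. j \<le> n \<Longrightarrow> a \<le> \<tau> j \<and> \<tau> j \<le> b \<and> D (\<tau> j) = real j / real n * m"
    using equally_spaced_levels[of a b D n] ab cont Dm pos False by (auto simp: m_def)
  have comb: "D u + integral {u..v} \<Delta> = D v" if "a \<le> u" "u \<le> v" "v \<le> b" for u v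
    unfolding D_def using that onuv by (intro Henstock_Kurzweil_Integration.integral_combine) auto
  have \<tau>_mono: "\<tau> i < \<tau> j" if "i < j" "j \<le> n" for i j
  proof (rule ccontr)
    assume "\<not> \<tau> i < \<tau> j"
    then have "D (\<tau> j) + integral {\<tau> j..\<tau> i} \<Delta> = D (\<tau> i)" using \<tau>[of i] \<tau>[of j] that by (intro comb) auto
    moreover have "integral {\<tau> j..\<tau> i} \<Delta> \<ge> 0"
      using \<tau>[of i] \<tau>[of j] that \<Delta>_nonneg by (intro Henstock_Kurzweil_Integration.integral_nonneg onuv) auto
    moreover have "D (\<tau> i) < D (\<tau> j)"
      using \<tau>[of i] \<tau>[of j] that pos False by (simp add: m_def divide_strict_right_mono)
    ultimately show False by simp
  qed
  define E where "E = (\<lambda>j. {\<tau> j<..\<tau> (Suc j)})"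
  define k where "k = sqrt (real n / m)"
  define e where "e = (\<lambda>j t. complex_of_real (k * indicator (E j) t))"
  have eH: "e j \<in> H" for j
  proof (rule wL2_bounded)
    show "e j \<in> borel_measurable (restrict_space borel {a..b})"
      unfolding e_def E_def by (intro measurable_restrict_space1 borel_measurable_of_real borel_measurable_times borel_measurable_indicator) auto
    show "cmod (e j t) \<le> \<bar>k\<bar>" for t by (auto simp: e_def indicator_def)
  qed
  have diag: "ip (e j) (e j) = 1" if j: "j < n" for j
  proof -
    have sub: "{\<tau> j..\<tau> (Suc j)} \<subseteq> {a..b}" using \<tau>[of j] \<tau>[of "Suc j"] j by auto
    have "ip (e j) (e j) = of_real (LINT t|M. \<Delta> t * (cmod (e j t))\<^sup>2)" by (rule wip_self[OF eH])
    also have "(LINT t|M. \<Delta> t * (cmod (e j t))\<^sup>2) = integral {a..b} (\<lambda>t. \<Delta> t * (cmod (e j t))\<^sup>2)"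
      by (rule lebesgue_integral_eq_integral[OF wL2_square_integrable[OF eH]]) simp
    also have "\<dots> = integral {a..b} (\<lambda>t. if t \<in> {\<tau> j..\<tau> (Suc j)} then k\<^sup>2 * \<Delta> t else 0)"
      by (rule integral_spike[of "{\<tau> j}"]) (auto simp: e_def E_def indicator_def power_mult_distrib)
    also have "\<dots> = integral {\<tau> j..\<tau> (Suc j)} (\<lambda>t. k\<^sup>2 * \<Delta> t)"
      unfolding Henstock_Kurzweil_Integration.integral_restrict_Int inf_absorb1[OF sub] ..
    also have "\<dots> = k\<^sup>2 * integral {\<tau> j..\<tau> (Suc j)} \<Delta>" by simp
    also have "integral {\<tau> j..\<tau> (Suc j)} \<Delta> = D (\<tau> (Suc j)) - D (\<tau> j)"
      using comb[of "\<tau> j" "\<tau> (Suc j)"] \<tau>[of j] \<tau>[of "Suc j"] \<tau>_mono[of j "Suc j"] j by simp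
    also have "\<dots> = real (Suc j) / real n * m - real j / real n * m" using \<tau>[of j] \<tau>[of "Suc j"] j by simp
    also have "\<dots> = m / real n" using False by (simp add: field_simps)
    also have "k\<^sup>2 * (m / real n) = 1" using pos False by (simp add: k_def m_def)
    finally show ?thesis by simp
  qed
  have offdiag: "ip (e i) (e j) = 0" if "i < n" "j < n" "i \<noteq> j" for i j
  proof -
    have "E i \<inter> E j = {}"
    proof -
      have *: "\<tau> (Suc i) \<le> \<tau> j" if "i < j" "j \<le> n" for i j
        using \<tau>_mono[of "Suc i" j] that by (cases "Suc i = j") auto
      show ?thesis using *[of i j] *[of j i] that by (cases "i < j") (auto simp: E_def)
    qed
    then have "of_real (\<Delta> t) * e i t * cnj (e j t) = 0" for t
      by (auto simp: e_def indicator_def)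
    then show ?thesis unfolding wip_def by (simp only: Bochner_Integration.integral_zero)
  qed
  have "hs.orthonormal {..<n} e"
    using eH diag offdiag by (auto simp: hs.orthonormal_def)
  then show ?thesis by blast
qed

end

section \<open>The resolvent\<close>

lemma primitive_increment_bound:
  assumes F: "primitive a b f F" and st: "a \<le> s" "s \<le> t" "t \<le> b"
    and g: "g integrable_on {a..b}" and le: "\<And>x. x \<in> {a..b} \<Longrightarrow> cmod (f x) \<le> g x"
  shows "cmod (F t - F s) \<le> integral {s..t} g"
proof -
  have fon: "f integrable_on {u..v}" if "a \<le> u" "v \<le> b" for u v
    using integrable_on_subinterval[OF primitive_integrable_on[OF F]] that by auto
  have "integral {a..s} f + integral {s..t} f = integral {a..t} f"
    using st fon by (intro Henstock_Kurzweil_Integration.integral_combine) auto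
  moreover have "s \<in> {a..b}" "t \<in> {a..b}" using st by auto
  then have "F s = F a + integral {a..s} f" "F t = F a + integral {a..t} f" using primitive_eq[OF F] by blast+
  ultimately have "F t - F s = integral {s..t} f" by (simp add: algebra_simps)
  also have "cmod \<dots> \<le> integral {s..t} g"
    using st fon le integrable_on_subinterval[OF g, of s t] by (intro integral_norm_bound_integral) auto
  finally show ?thesis .
qed

context weight
begin

lemma nrm_sup_bound:
  assumes f: "f \<in> H" and B: "B \<ge> 0" "\<And>t. t \<in> {a..b} \<Longrightarrow> cmod (f t) \<le> B"
  shows "hs.nrm f \<le> B * nrm_one"
proof (rule power2_le_imp_le)
  have "(hs.nrm f)\<^sup>2 = (LINT t|M. \<Delta> t * (cmod (f t))\<^sup>2)" by (rule nrm_square_integral[OF f])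
  also have "\<dots> \<le> (LINT t|M. B\<^sup>2 * \<Delta> t)"
  proof (rule integral_mono)
    fix t assume "t \<in> space M"
    then have t: "t \<in> {a..b}" by simp
    have "(cmod (f t))\<^sup>2 \<le> B\<^sup>2" using B(2)[OF t] by (intro power_mono) auto
    then show "\<Delta> t * (cmod (f t))\<^sup>2 \<le> B\<^sup>2 * \<Delta> t" using mult_left_mono[OF _ \<Delta>_nonneg[OF t]] by (metis mult.commute)
  qed (use wL2_square_integrable[OF f] \<Delta>_int in auto)
  also have "\<dots> = (B * nrm_one)\<^sup>2" by (simp add: nrm_one_square power_mult_distrib)
  finally show "(hs.nrm f)\<^sup>2 \<le> (B * nrm_one)\<^sup>2" .
  show "0 \<le> B * nrm_one" using B(1) nrm_one_nonneg by simp
qed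

end

context sturm_liouville
begin

text \<open>
  \<open>y\<close> is the image of \<open>f\<close> under the resolvent at \<open>\<mu>\<close>: \<open>l[y] - \<mu> \<Delta> y = \<Delta> f\<close> with both boundary conditions.
\<close>
definition inhom :: "complex \<Rightarrow> (real \<Rightarrow> complex) \<Rightarrow> (real \<Rightarrow> complex) \<Rightarrow> (real \<Rightarrow> complex) \<Rightarrow> bool" where
  "inhom \<mu> f y u \<longleftrightarrow> bvp (\<lambda>t. \<mu> * of_real (\<Delta> t) * y t + of_real (\<Delta> t) * f t) y u"

lemma inhom_sys: "inhom \<mu> f y u \<Longrightarrow> sys (\<lambda>t. \<mu> * of_real (\<Delta> t) * y t + of_real (\<Delta> t) * f t) y u"
  by (simp add: inhom_def bvp_def)

lemma inhom_continuous: "inhom \<mu> f y u \<Longrightarrow> continuous_on {a..b} y"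
  by (drule inhom_sys) (rule sys_continuous)

lemma inhom_lin:
  assumes "inhom \<mu> f y u" "inhom \<mu> g z w"
  shows "inhom \<mu> (\<lambda>t. f t + c * g t) (\<lambda>t. y t + c * z t) (\<lambda>t. u t + c * w t)"
  unfolding inhom_def
  by (rule bvp_cong[OF bvp_lin[OF assms[unfolded inhom_def], of c]]) (simp add: algebra_simps)

lemma inhom_unique:
  assumes \<mu>: "\<mu> \<notin> EV" and 1: "inhom \<mu> f y u" and 2: "inhom \<mu> f z w"
  shows "y = z"
proof -
  define d where "d = (\<lambda>t. y t + (-1) * z t)"
  have "eigen \<mu> d (\<lambda>t. u t + (-1) * w t)"
    using inhom_lin[OF 1 2, of "-1"] unfolding inhom_def d_def by (rule bvp_cong) simp
  then have "d = (\<lambda>t. 0)" using \<mu> unfolding EV_iff by blast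
  then show ?thesis by (simp add: fun_eq_iff d_def)
qed

text \<open>
  Let \<open>\<phi>\<close> and \<open>\<omega>\<close> be homogeneous solutions with the left and the right boundary condition and Wronskian \<open>1\<close>.
  Then \<open>y t = - (\<omega> t * \<integral>\<^bsub>a\<^esub>\<^bsup>t\<^esup> \<phi> \<Delta> f + \<phi> t * \<integral>\<^bsub>t\<^esub>\<^bsup>b\<^esup> \<omega> \<Delta> f)\<close> is the solution, and the bound is that of
  \<open>\<integral> \<Delta> |f|\<close> by the norm of \<open>f\<close>.
\<close>
lemma green_exists:
  assumes \<mu>: "\<mu> \<notin> EV"
  obtains C where "C \<ge> 0" "\<forall>f\<in>H. \<exists>y u. inhom \<mu> f y u \<and>
     (\<forall>t\<in>{a..b}. cmod (y t) \<le> C * hs.nrm f \<and> cmod (u t) \<le> C * hs.nrm f)"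
proof -
  obtain \<phi> \<phi>' \<psi> \<psi>' where fu:
    "hom \<mu> \<phi> \<phi>'" "\<phi> a = of_real (sin \<alpha>)" "\<phi>' a = - of_real (cos \<alpha>)"
    "hom \<mu> \<psi> \<psi>'" "\<psi> a = of_real (cos \<alpha>)" "\<psi>' a = of_real (sin \<alpha>)"
    "\<forall>t\<in>{a..b}. \<phi> t * \<psi>' t - \<phi>' t * \<psi> t = 1" by (rule fundamental[of \<mu>])
  define B where "B = (\<lambda>y u. of_real (cos \<beta>) * y b + of_real (sin \<beta>) * u b :: complex)"
  have lbc: "left_bc \<phi> \<phi>'" using fu by (simp add: left_bc_def)
  have B\<phi>: "B \<phi> \<phi>' \<noteq> 0"
  proof
    assume B0: "B \<phi> \<phi>' = 0"
    define y where "y = (\<lambda>t. if t \<in> {a..b} then \<phi> t else 0)"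
    define u where "u = (\<lambda>t. if t \<in> {a..b} then \<phi>' t else 0)"
    have "hom \<mu> y u" by (rule sys_cong[OF fu(1)]) (auto simp: y_def u_def)
    then have yb: "eigen \<mu> y u"
      using lbc B0 a_in b_in by (auto simp: bvp_def left_bc_def right_bc_def B_def y_def u_def)
    then have yz: "y = (\<lambda>t. 0)" using \<mu> unfolding EV_iff by blast
    have y0: "\<phi> t = 0" if "t \<in> {a..b}" for t using fun_cong[OF yz, of t] that by (simp add: y_def)
    have "AE t in M. t \<in> {a..b}" by (rule AE_I2) simp
    with sys_zero_set[OF fu(1)] have "AE t in M. \<Delta> t > 0 \<longrightarrow> \<phi>' t = 0" by eventually_elim (use y0 in auto)
    then obtain t where "t \<in> {a..b}" "\<phi>' t = 0" by (rule AE_pos_witness)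
    then show False using bspec[OF fu(7), of t] y0[of t] by simp
  qed
  \<comment> \<open>Adding a multiple of \<open>\<phi>\<close> to \<open>\<psi>\<close> keeps the Wronskian and achieves the right boundary condition.\<close>
  define k where "k = - B \<psi> \<psi>' / B \<phi> \<phi>'"
  define \<omega> where "\<omega> = (\<lambda>t. \<psi> t + k * \<phi> t)"
  define \<omega>' where "\<omega>' = (\<lambda>t. \<psi>' t + k * \<phi>' t)"
  have \<omega>sys: "hom \<mu> \<omega> \<omega>'"
    by (rule sys_cong[OF sys_lin[OF fu(4,1), of k]]) (auto simp: \<omega>_def \<omega>'_def algebra_simps)
  have "B \<omega> \<omega>' = B \<psi> \<psi>' + k * B \<phi> \<phi>'" by (simp add: B_def \<omega>_def \<omega>'_def algebra_simps)
  then have B\<omega>: "B \<omega> \<omega>' = 0" using B\<phi> by (simp add: k_def)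
  have W: "\<phi> t * \<omega>' t - \<phi>' t * \<omega> t = 1" if "t \<in> {a..b}" for t
    using fu(7) that by (simp add: \<omega>_def \<omega>'_def algebra_simps)
  note c = sys_continuous(1)[OF fu(1)] sys_continuous(2)[OF fu(1)] sys_continuous(1)[OF \<omega>sys] sys_continuous(2)[OF \<omega>sys]
  obtain R1 where R1: "R1 > 0" "\<And>t. t \<in> {a..b} \<Longrightarrow> cmod (\<phi> t) \<le> R1" using continuous_on_interval_bounded[OF c(1)] by metis
  obtain R2 where R2: "R2 > 0" "\<And>t. t \<in> {a..b} \<Longrightarrow> cmod (\<phi>' t) \<le> R2" using continuous_on_interval_bounded[OF c(2)] by metis
  obtain R3 where R3: "R3 > 0" "\<And>t. t \<in> {a..b} \<Longrightarrow> cmod (\<omega> t) \<le> R3" using continuous_on_interval_bounded[OF c(3)] by metis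
  obtain R4 where R4: "R4 > 0" "\<And>t. t \<in> {a..b} \<Longrightarrow> cmod (\<omega>' t) \<le> R4" using continuous_on_interval_bounded[OF c(4)] by metis
  define R where "R = R1 + R2 + R3 + R4"
  have R0: "R \<ge> 0" using R1 R2 R3 R4 by (simp add: R_def)
  have R: "cmod (\<phi> t) \<le> R" "cmod (\<phi>' t) \<le> R" "cmod (\<omega> t) \<le> R" "cmod (\<omega>' t) \<le> R" if "t \<in> {a..b}" for t
    using R1(1) R2(1) R3(1) R4(1) R1(2)[OF that] R2(2)[OF that] R3(2)[OF that] R4(2)[OF that] unfolding R_def by linarith+
  define C where "C = 3 * R * R * nrm_one"
  show thesis
  proof (rule that[of C], use R0 nrm_one_nonneg in \<open>simp add: C_def\<close>, rule ballI)
    fix f assume f: "f \<in> H"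
    define g where "g = (\<lambda>t. complex_of_real (\<Delta> t) * f t)"
    have g: "integrable M g" unfolding g_def by (rule wL2_integrable[OF f])
    define P where "P = (\<lambda>t. integral {a..t} (\<lambda>s. g s * \<phi> s))"
    define Q where "Q = (\<lambda>t. integral {a..t} (\<lambda>s. g s * \<omega> s))"
    have Pp: "primitive a b (\<lambda>s. g s * \<phi> s) P" unfolding P_def
      by (rule primitive_of_integral[OF integrable_mult_continuous[OF g c(1)]])
    have Qp: "primitive a b (\<lambda>s. g s * \<omega> s) Q" unfolding Q_def
      by (rule primitive_of_integral[OF integrable_mult_continuous[OF g c(3)]])
    define T where "T = (\<lambda>t. Q b + (-1) * Q t)"
    have Tp: "primitive a b (\<lambda>s. 0 + (-1) * (g s * \<omega> s)) T" unfolding T_def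
      by (rule primitive_add[OF _ primitive_cmult[OF Qp]]) (simp add: primitive_def)
    have bound: "cmod (G s - G t) \<le> R * (nrm_one * hs.nrm f)"
      if G: "primitive a b (\<lambda>s. g s * h s) G" and h: "\<And>t. t \<in> {a..b} \<Longrightarrow> cmod (h t) \<le> R"
        and st: "a \<le> t" "t \<le> s" "s \<le> b" for G h s t
    proof -
      have int: "integrable M (\<lambda>t. R * (\<Delta> t * cmod (f t)))" using weighted_L1_bound(1)[OF f] by simp
      have on: "(\<lambda>t. R * (\<Delta> t * cmod (f t))) integrable_on {a..b}" by (rule integrable_on_lebesgue_on[OF int]) simp
      have "cmod (G s - G t) \<le> integral {t..s} (\<lambda>t. R * (\<Delta> t * cmod (f t)))"
      proof (rule primitive_increment_bound[OF G st on])
        fix x assume x: "x \<in> {a..b}"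
        have "cmod (g x * h x) = (\<Delta> x * cmod (f x)) * cmod (h x)" using \<Delta>_nonneg[OF x] by (simp add: g_def norm_mult)
        also have "\<dots> \<le> (\<Delta> x * cmod (f x)) * R" using h[OF x] \<Delta>_nonneg[OF x] by (intro mult_left_mono) auto
        finally show "cmod (g x * h x) \<le> R * (\<Delta> x * cmod (f x))" by (simp add: mult.commute)
      qed
      also have "\<dots> \<le> integral {a..b} (\<lambda>t. R * (\<Delta> t * cmod (f t)))"
        using st R0 \<Delta>_nonneg by (intro integral_subset_le integrable_on_subinterval[OF on] on) auto
      also have "\<dots> = (LINT t|M. R * (\<Delta> t * cmod (f t)))" by (rule lebesgue_integral_eq_integral[OF int, symmetric]) simp
      also have "\<dots> = R * (LINT t|M. \<Delta> t * cmod (f t))" by simp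
      also have "\<dots> \<le> R * (nrm_one * hs.nrm f)" using weighted_L1_bound(2)[OF f] R0 by (rule mult_left_mono)
      finally show ?thesis .
    qed
    have Pb: "cmod (P t) \<le> R * (nrm_one * hs.nrm f)" if "t \<in> {a..b}" for t
      using bound[OF Pp R(1), of a t] that by (simp add: P_def)
    have Tb: "cmod (T t) \<le> R * (nrm_one * hs.nrm f)" if "t \<in> {a..b}" for t
      using bound[OF Qp R(3), of t b] that by (simp add: T_def)
    define y where "y = (\<lambda>t. - (\<omega> t * P t + \<phi> t * T t))"
    define u where "u = (\<lambda>t. - (\<omega>' t * P t + \<phi>' t * T t))"
    have \<phi>p: "primitive a b (\<lambda>t. of_real (1 / p t) * \<phi>' t) \<phi>" "primitive a b (\<lambda>t. of_real (q t) * \<phi> t - \<mu> * of_real (\<Delta> t) * \<phi> t) \<phi>'"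
      using fu(1) by (auto simp: sys_def)
    have \<omega>p: "primitive a b (\<lambda>t. of_real (1 / p t) * \<omega>' t) \<omega>" "primitive a b (\<lambda>t. of_real (q t) * \<omega> t - \<mu> * of_real (\<Delta> t) * \<omega> t) \<omega>'"
      using \<omega>sys by (auto simp: sys_def)
    have "sys (\<lambda>t. \<mu> * of_real (\<Delta> t) * y t + of_real (\<Delta> t) * f t) y u"
      unfolding sys_def
    proof (intro conjI)
      show "primitive a b (\<lambda>t. of_real (1 / p t) * u t) y"
      proof (rule primitive_cong[OF primitive_cmult[OF primitive_add[OF primitive_mult[OF ab_le \<omega>p(1) Pp] primitive_mult[OF ab_le \<phi>p(1) Tp]], of "-1"]])
        fix t
        show "- 1 * (of_real (1 / p t) * \<omega>' t * P t + \<omega> t * (g t * \<phi> t) +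
          (of_real (1 / p t) * \<phi>' t * T t + \<phi> t * (0 + (-1) * (g t * \<omega> t)))) = of_real (1 / p t) * u t"
          unfolding u_def by (simp add: algebra_simps)
        show "- 1 * (\<omega> t * P t + \<phi> t * T t) = y t" by (simp add: y_def)
      qed
      show "primitive a b (\<lambda>t. of_real (q t) * y t - (\<mu> * of_real (\<Delta> t) * y t + of_real (\<Delta> t) * f t)) u"
      proof (rule primitive_cong[OF primitive_cmult[OF primitive_add[OF primitive_mult[OF ab_le \<omega>p(2) Pp] primitive_mult[OF ab_le \<phi>p(2) Tp]], of "-1"]])
        fix t assume t: "t \<in> {a..b}"
        have "- 1 * ((of_real (q t) * \<omega> t - \<mu> * of_real (\<Delta> t) * \<omega> t) * P t + \<omega>' t * (g t * \<phi> t) +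
          ((of_real (q t) * \<phi> t - \<mu> * of_real (\<Delta> t) * \<phi> t) * T t + \<phi>' t * (0 + (-1) * (g t * \<omega> t))))
          = of_real (q t) * y t - \<mu> * of_real (\<Delta> t) * y t - (\<phi> t * \<omega>' t - \<phi>' t * \<omega> t) * g t"
          unfolding y_def by (simp add: algebra_simps)
        then show "- 1 * ((of_real (q t) * \<omega> t - \<mu> * of_real (\<Delta> t) * \<omega> t) * P t + \<omega>' t * (g t * \<phi> t) +
          ((of_real (q t) * \<phi> t - \<mu> * of_real (\<Delta> t) * \<phi> t) * T t + \<phi>' t * (0 + (-1) * (g t * \<omega> t))))
          = of_real (q t) * y t - (\<mu> * of_real (\<Delta> t) * y t + of_real (\<Delta> t) * f t)"
          unfolding W[OF t] by (simp add: g_def)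
        show "- 1 * (\<omega>' t * P t + \<phi>' t * T t) = u t" by (simp add: u_def)
      qed
    qed
    moreover have "left_bc y u"
    proof -
      have "P a = 0" by (simp add: P_def)
      then have "of_real (cos \<alpha>) * y a + of_real (sin \<alpha>) * u a = - T a * (of_real (cos \<alpha>) * \<phi> a + of_real (sin \<alpha>) * \<phi>' a)"
        by (simp add: y_def u_def algebra_simps)
      then show ?thesis using lbc by (simp add: left_bc_def)
    qed
    moreover have "right_bc y u"
    proof -
      have "T b = 0" by (simp add: T_def)
      then have "of_real (cos \<beta>) * y b + of_real (sin \<beta>) * u b = - P b * B \<omega> \<omega>'"
        by (simp add: y_def u_def B_def algebra_simps)
      then show ?thesis using B\<omega> by (simp add: right_bc_def)
    qed
    moreover define y0 where "y0 = (\<lambda>t. if t \<in> {a..b} then y t else 0)"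
    moreover define u0 where "u0 = (\<lambda>t. if t \<in> {a..b} then u t else 0)"
    moreover have "sys (\<lambda>t. \<mu> * of_real (\<Delta> t) * y0 t + of_real (\<Delta> t) * f t) y0 u0"
      by (rule sys_cong[OF calculation(1)]) (auto simp: y0_def u0_def)
    ultimately have inh: "inhom \<mu> f y0 u0"
      using a_in b_in by (auto simp: inhom_def bvp_def left_bc_def right_bc_def)
    have est: "cmod (A t * P t + E t * T t) \<le> C * hs.nrm f"
      if t: "t \<in> {a..b}" and A: "cmod (A t) \<le> R" and E: "cmod (E t) \<le> R" for A E t
    proof -
      define r where "r = R * (nrm_one * hs.nrm f)"
      have r0: "r \<ge> 0" using R0 nrm_one_nonneg hs.nrm_nonneg[OF f] by (simp add: r_def)
      have "cmod (A t * P t + E t * T t) \<le> cmod (A t) * cmod (P t) + cmod (E t) * cmod (T t)"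
        by (metis norm_mult norm_triangle_ineq)
      also have "\<dots> \<le> R * r + R * r"
        using A E Pb[OF t] Tb[OF t] R0 by (intro add_mono mult_mono) (auto simp: r_def)
      also have "\<dots> \<le> 3 * (R * r)" using R0 r0 mult_nonneg_nonneg[OF R0 r0] by simp
      also have "\<dots> = C * hs.nrm f" by (simp add: C_def r_def)
      finally show ?thesis .
    qed
    have "cmod (y0 t) \<le> C * hs.nrm f \<and> cmod (u0 t) \<le> C * hs.nrm f" if "t \<in> {a..b}" for t
      using est[of t \<omega> \<phi>, OF that R(3)[OF that] R(1)[OF that]] est[of t \<omega>' \<phi>', OF that R(4)[OF that] R(2)[OF that]] that
      unfolding y0_def u0_def y_def u_def by (simp del: minus_add_distrib)
    with inh show "\<exists>y u. inhom \<mu> f y u \<and> (\<forall>t\<in>{a..b}. cmod (y t) \<le> C * hs.nrm f \<and> cmod (u t) \<le> C * hs.nrm f)" by blast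
  qed
qed

definition res :: "complex \<Rightarrow> (real \<Rightarrow> complex) \<Rightarrow> (real \<Rightarrow> complex)" where
  "res \<mu> f = (THE y. \<exists>u. inhom \<mu> f y u)"

lemma res_eq: assumes "\<mu> \<notin> EV" "inhom \<mu> f y u" shows "res \<mu> f = y"
  unfolding res_def using inhom_unique[OF assms(1)] assms(2) by (blast intro: the_equality)

lemma res_bound:
  assumes \<mu>: "\<mu> \<notin> EV"
  obtains C where "C \<ge> 0" "\<forall>f\<in>H. \<exists>u. inhom \<mu> f (res \<mu> f) u \<and>
     (\<forall>t\<in>{a..b}. cmod (res \<mu> f t) \<le> C * hs.nrm f \<and> cmod (u t) \<le> C * hs.nrm f)"
proof -
  obtain C where C: "C \<ge> 0" "\<forall>f\<in>H. \<exists>y u. inhom \<mu> f y u \<and>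
     (\<forall>t\<in>{a..b}. cmod (y t) \<le> C * hs.nrm f \<and> cmod (u t) \<le> C * hs.nrm f)" using green_exists[OF \<mu>] .
  show thesis
  proof (rule that[OF C(1)], rule ballI)
    fix f assume "f \<in> H"
    then obtain y u where yu: "inhom \<mu> f y u" "\<forall>t\<in>{a..b}. cmod (y t) \<le> C * hs.nrm f \<and> cmod (u t) \<le> C * hs.nrm f"
      using C(2) by blast
    then show "\<exists>u. inhom \<mu> f (res \<mu> f) u \<and> (\<forall>t\<in>{a..b}. cmod (res \<mu> f t) \<le> C * hs.nrm f \<and> cmod (u t) \<le> C * hs.nrm f)"
      unfolding res_eq[OF \<mu> yu(1)] by blast
  qed
qed

lemma res_inhom: assumes "\<mu> \<notin> EV" "f \<in> H" obtains u where "inhom \<mu> f (res \<mu> f) u"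
  using res_bound[OF assms(1)] assms(2) by metis

lemma res_in_H: assumes "\<mu> \<notin> EV" "f \<in> H" shows "res \<mu> f \<in> H"
  using res_inhom[OF assms] wL2_continuous inhom_continuous by metis

lemma res_lin:
  assumes \<mu>: "\<mu> \<notin> EV" and f: "f \<in> H" and g: "g \<in> H"
  shows "res \<mu> (\<lambda>t. f t + c * g t) = (\<lambda>t. res \<mu> f t + c * res \<mu> g t)"
proof -
  obtain u where u: "inhom \<mu> f (res \<mu> f) u" using res_inhom[OF \<mu> f] .
  obtain w where w: "inhom \<mu> g (res \<mu> g) w" using res_inhom[OF \<mu> g] .
  show ?thesis by (rule res_eq[OF \<mu> inhom_lin[OF u w]])
qed

lemma res_zero: assumes \<mu>: "\<mu> \<notin> EV" shows "res \<mu> (\<lambda>t. 0) = (\<lambda>t. 0)"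
proof -
  have "(\<lambda>t. 0) \<in> H" by (rule wL2_continuous) simp
  from res_lin[OF \<mu> this this, of "-1"] show ?thesis by simp
qed

lemma res_add:
  assumes "\<mu> \<notin> EV" "f \<in> H" "g \<in> H" shows "res \<mu> (f + g) = res \<mu> f + res \<mu> g"
  using res_lin[OF assms, of 1] by (simp add: plus_fun_def)

lemma res_scale:
  assumes "\<mu> \<notin> EV" "f \<in> H" shows "res \<mu> (cfun_scale c f) = cfun_scale c (res \<mu> f)"
proof -
  have "(\<lambda>t. 0) \<in> H" by (rule wL2_continuous) simp
  from res_lin[OF assms(1) this assms(2), of c] show ?thesis by (simp add: cfun_scale_def res_zero[OF assms(1)])
qed

lemma scale_plus_apply: "(cfun_scale c f + g) t = c * f t + g t"
  by (simp add: cfun_scale_def)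

lemma res_sum:
  assumes \<mu>: "\<mu> \<notin> EV" and v: "\<And>i. i \<in> F \<Longrightarrow> v i \<in> H"
  shows "res \<mu> (\<Sum>i\<in>F. cfun_scale (c i) (v i)) t = (\<Sum>i\<in>F. c i * res \<mu> (v i) t)"
  using v
proof (induction F rule: infinite_finite_induct)
  case (insert x F)
  have "(\<Sum>i\<in>F. cfun_scale (c i) (v i)) \<in> H" "cfun_scale (c x) (v x) \<in> H" using insert.prems by auto
  from res_add[OF \<mu> this(2,1)]
  have "res \<mu> (\<Sum>i\<in>insert x F. cfun_scale (c i) (v i)) = cfun_scale (c x) (res \<mu> (v x)) + res \<mu> (\<Sum>i\<in>F. cfun_scale (c i) (v i))"
    using insert.prems by (simp only: sum.insert[OF insert.hyps(1,2)] res_scale[OF \<mu>] insertI1)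
  from fun_cong[OF this, of t, unfolded scale_plus_apply]
  have "res \<mu> (\<Sum>i\<in>insert x F. cfun_scale (c i) (v i)) t = c x * res \<mu> (v x) t + res \<mu> (\<Sum>i\<in>F. cfun_scale (c i) (v i)) t" .
  also have "res \<mu> (\<Sum>i\<in>F. cfun_scale (c i) (v i)) t = (\<Sum>i\<in>F. c i * res \<mu> (v i) t)"
    by (rule insert.IH) (rule insert.prems, rule insertI2)
  also have "c x * res \<mu> (v x) t + (\<Sum>i\<in>F. c i * res \<mu> (v i) t) = (\<Sum>i\<in>insert x F. c i * res \<mu> (v i) t)"
    using insert.hyps by simp
  finally show ?case .
qed (use res_zero[OF \<mu>] in \<open>auto simp: zero_fun_def\<close>)

lemma sols_in_H: "y \<in> L \<nu> \<Longrightarrow> y \<in> H"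
  by (auto simp: sols_iff bvp_def intro: wL2_continuous sys_continuous)

lemma sols_scale: assumes "y \<in> L \<nu>" shows "cfun_scale c y \<in> L \<nu>"
proof -
  obtain u where u: "eigen \<nu> y u" using assms by (auto simp: sols_iff)
  have "bvp (\<lambda>t. \<nu> * of_real (\<Delta> t) * y t + (c - 1) * (\<nu> * of_real (\<Delta> t) * y t)) (\<lambda>t. y t + (c - 1) * y t) (\<lambda>t. u t + (c - 1) * u t)"
    by (rule bvp_lin[OF u u])
  then have "bvp (\<lambda>t. \<nu> * of_real (\<Delta> t) * cfun_scale c y t) (cfun_scale c y) (\<lambda>t. c * u t)"
    by (simp add: cfun_scale_def algebra_simps)
  then show ?thesis by (auto simp: sols_iff)
qed

lemma res_eigen:
  assumes \<mu>: "\<mu> \<notin> EV" and v: "v \<in> L \<nu>" and ne: "\<nu> \<noteq> \<mu>"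
  shows "res \<mu> v = cfun_scale (1 / (\<nu> - \<mu>)) v"
proof -
  define c where "c = 1 / (\<nu> - \<mu>)"
  have "cfun_scale c v \<in> L \<nu>" by (rule sols_scale[OF v])
  then obtain u where u: "bvp (\<lambda>t. \<nu> * of_real (\<Delta> t) * cfun_scale c v t) (cfun_scale c v) u" by (auto simp: sols_iff)
  have "inhom \<mu> v (cfun_scale c v) u"
    unfolding inhom_def
  proof (rule bvp_cong[OF u])
    fix t
    have "\<nu> * c = \<mu> * c + 1" using ne by (simp add: c_def field_simps)
    then have "(\<nu> * c) * (of_real (\<Delta> t) * v t) = (\<mu> * c + 1) * (of_real (\<Delta> t) * v t)" by simp
    then show "\<nu> * of_real (\<Delta> t) * cfun_scale c v t = \<mu> * of_real (\<Delta> t) * cfun_scale c v t + of_real (\<Delta> t) * v t"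
      by (simp add: cfun_scale_def algebra_simps)
  qed
  from res_eq[OF \<mu> this] show ?thesis by (simp add: c_def)
qed

lemma regular_neq_eigenvalue: "\<mu> \<notin> EV \<Longrightarrow> \<nu> \<in> EV \<Longrightarrow> \<nu> \<noteq> \<mu>" by auto

text \<open>
  For \<open>w = \<Sum> cnj (d i) v i\<close> with \<open>d i = v i t / (ev i - \<mu>)\<close> both the value of the resolvent at \<open>t\<close> and
  \<open>\<parallel>w\<parallel>\<^sup>2\<close> equal \<open>S = \<Sum> |d i|\<^sup>2\<close>, so \<open>S \<le> C * sqrt S\<close>.  This is Bessel's inequality for Green's function,
  obtained from the bound of the operator alone.
\<close>
lemma eigenfunction_kernel_bound:
  assumes \<mu>: "\<mu> \<notin> EV" and C: "C \<ge> 0" "\<And>f t. f \<in> H \<Longrightarrow> t \<in> {a..b} \<Longrightarrow> cmod (res \<mu> f t) \<le> C * hs.nrm f"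
    and F: "finite F" and v: "hs.orthonormal F v" "\<And>i. i \<in> F \<Longrightarrow> ev i \<in> EV \<and> v i \<in> L (ev i)" and t: "t \<in> {a..b}"
  shows "(\<Sum>i\<in>F. (cmod (v i t / (ev i - \<mu>)))\<^sup>2) \<le> C\<^sup>2"
proof -
  define d where "d = (\<lambda>i. v i t / (ev i - \<mu>))"
  define S where "S = (\<Sum>i\<in>F. (cmod (d i))\<^sup>2)"
  have S0: "S \<ge> 0" unfolding S_def by (rule sum_nonneg) simp
  define w where "w = (\<Sum>i\<in>F. cfun_scale (cnj (d i)) (v i))"
  have vH: "v i \<in> H" if "i \<in> F" for i using v(2)[OF that] sols_in_H by blast
  have wH: "w \<in> H" unfolding w_def using vH by auto
  have "(hs.nrm w)\<^sup>2 = S" unfolding w_def S_def by (subst hs.orthonormal_nrm_sum[OF v(1) F]) auto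
  then have nw: "hs.nrm w = sqrt S" using hs.nrm_nonneg[OF wH] by (metis real_sqrt_abs abs_of_nonneg)
  have "res \<mu> w t = (\<Sum>i\<in>F. cnj (d i) * res \<mu> (v i) t)" unfolding w_def by (rule res_sum[OF \<mu> vH])
  also have "\<dots> = (\<Sum>i\<in>F. of_real ((cmod (d i))\<^sup>2))"
  proof (rule sum.cong[OF refl])
    fix i assume i: "i \<in> F"
    have "res \<mu> (v i) t = d i"
      using res_eigen[OF \<mu>, of "v i" "ev i"] v(2)[OF i] regular_neq_eigenvalue[OF \<mu>] by (auto simp: cfun_scale_def d_def)
    then show "cnj (d i) * res \<mu> (v i) t = of_real ((cmod (d i))\<^sup>2)" by (simp add: of_real_cmod_square mult.commute)
  qed
  also have "\<dots> = of_real S" by (simp add: S_def)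
  finally have "cmod (of_real S) \<le> C * sqrt S" using C(2)[OF wH t] nw by simp
  then have le: "S \<le> C * sqrt S" using S0 by simp
  have "sqrt S \<le> C"
  proof (cases "S = 0")
    case False
    then have "sqrt S > 0" using S0 by simp
    moreover have "sqrt S * sqrt S \<le> C * sqrt S" using le S0 by simp
    ultimately show ?thesis by (rule mult_right_le_imp_le[rotated])
  qed (use C in simp)
  then have "(sqrt S)\<^sup>2 \<le> C\<^sup>2" using S0 by (intro power_mono) auto
  then show ?thesis using S0 by (simp add: S_def d_def)
qed

section \<open>Discreteness of the spectrum\<close>

lemma eigen_orthogonal:
  assumes "\<nu> \<in> EV" "\<eta> \<in> EV" "\<nu> \<noteq> \<eta>" "y \<in> L \<nu>" "z \<in> L \<eta>" shows "ip y z = 0"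
proof -
  obtain u w where "eigen \<nu> y u" "eigen \<eta> z w"
    using assms by (auto simp: sols_iff)
  from bvp_symmetric[OF this] have "\<nu> * ip y z = cnj \<eta> * ip y z"
    unfolding wip_def by (simp add: mult.assoc mult.left_commute)
  then show ?thesis using assms(3) EV_real[OF assms(2)] by simp
qed

lemma eigenfunction_exists:
  assumes "\<nu> \<in> EV" obtains v where "v \<in> L \<nu>" "ip v v = 1" "hs.nrm v = 1"
proof -
  obtain y u where y: "eigen \<nu> y u" "y \<noteq> (\<lambda>t. 0)" using assms by (auto simp: EV_iff)
  then have yL: "y \<in> L \<nu>" by (auto simp: sols_iff)
  then have yH: "y \<in> H" by (rule sols_in_H)
  have pos: "hs.nrm y > 0" using eigen_norm_pos[OF y] by (simp add: hs.nrm_def)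
  define v where "v = cfun_scale (of_real (1 / hs.nrm y)) y"
  have "hs.nrm v = 1" unfolding v_def using pos by (subst hs.nrm_scale[OF yH]) (simp add: norm_divide)
  moreover have vL: "v \<in> L \<nu>" unfolding v_def by (rule sols_scale[OF yL])
  ultimately show thesis using that hs.ip_self[OF sols_in_H[OF vL]] by simp
qed

text \<open>
  The kernel bound at \<open>\<mu> = \<i>\<close>, integrated against \<open>\<Delta>\<close>, bounds \<open>\<Sum> 1 / |\<nu> - \<i>|\<^sup>2\<close> over any finite set of eigenvalues \<open>\<nu>\<close>
  (a part of the squared Hilbert-Schmidt norm of the resolvent); in a disc the summands are bounded below.
\<close>
lemma finite_EV_ball: "finite {\<nu>\<in>EV. cmod \<nu> \<le> R}"
proof -
  have iEV: "\<i> \<notin> EV" using EV_real[of \<i>] by (auto simp: complex_eq_iff)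
  obtain C where C: "C \<ge> 0" "\<And>f t. f \<in> H \<Longrightarrow> t \<in> {a..b} \<Longrightarrow> cmod (res \<i> f t) \<le> C * hs.nrm f"
    using res_bound[OF iEV] by metis
  have "\<exists>v. v \<in> L \<nu> \<and> ip v v = 1 \<and> hs.nrm v = 1" if "\<nu> \<in> EV" for \<nu> using eigenfunction_exists[OF that] by metis
  then obtain v where v: "\<And>\<nu>. \<nu> \<in> EV \<Longrightarrow> v \<nu> \<in> L \<nu> \<and> ip (v \<nu>) (v \<nu>) = 1 \<and> hs.nrm (v \<nu>) = 1" by metis
  have orth: "hs.orthonormal EV v" 
    unfolding hs.orthonormal_def using v eigen_orthogonal sols_in_H by (metis (no_types, lifting))
  define R' where "R' = \<bar>R\<bar> + 1"
  define B where "B = nat \<lceil>(R' * C * nrm_one)\<^sup>2\<rceil>"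
  have "card F \<le> B" if F: "F \<subseteq> {\<nu>\<in>EV. cmod \<nu> \<le> R}" "finite F" for F
  proof -
    have FEV: "F \<subseteq> EV" using F by auto
    have oF: "hs.orthonormal F v" using orth FEV by (auto simp: hs.orthonormal_def subset_iff)
    have pt: "(\<Sum>\<nu>\<in>F. (cmod (v \<nu> t))\<^sup>2) \<le> (R' * C)\<^sup>2" if t: "t \<in> {a..b}" for t
    proof -
      have "(\<Sum>\<nu>\<in>F. (cmod (v \<nu> t))\<^sup>2) \<le> (\<Sum>\<nu>\<in>F. R'\<^sup>2 * (cmod (v \<nu> t / (\<nu> - \<i>)))\<^sup>2)"
      proof (rule sum_mono)
        fix \<nu> assume \<nu>: "\<nu> \<in> F"
        have ne: "\<nu> - \<i> \<noteq> 0" using \<nu> FEV iEV by auto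
        have "cmod (\<nu> - \<i>) \<le> R'" using norm_triangle_ineq4[of \<nu> \<i>] \<nu> F by (auto simp: R'_def)
        then have "cmod (v \<nu> t / (\<nu> - \<i>)) * cmod (\<nu> - \<i>) \<le> cmod (v \<nu> t / (\<nu> - \<i>)) * R'" by (rule mult_left_mono) simp
        then have "cmod (v \<nu> t) \<le> R' * cmod (v \<nu> t / (\<nu> - \<i>))" using ne by (simp add: norm_divide mult.commute)
        then have "(cmod (v \<nu> t))\<^sup>2 \<le> (R' * cmod (v \<nu> t / (\<nu> - \<i>)))\<^sup>2" by (rule power_mono) simp
        then show "(cmod (v \<nu> t))\<^sup>2 \<le> R'\<^sup>2 * (cmod (v \<nu> t / (\<nu> - \<i>)))\<^sup>2" by (simp add: power_mult_distrib)
      qed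
      also have "\<dots> = R'\<^sup>2 * (\<Sum>\<nu>\<in>F. (cmod (v \<nu> t / (\<nu> - \<i>)))\<^sup>2)" by (simp add: sum_distrib_left)
      also have "\<dots> \<le> R'\<^sup>2 * C\<^sup>2"
      proof (rule mult_left_mono)
        show "(\<Sum>\<nu>\<in>F. (cmod (v \<nu> t / (\<nu> - \<i>)))\<^sup>2) \<le> C\<^sup>2"
          by (rule eigenfunction_kernel_bound[OF iEV C F(2) oF _ t]) (use v FEV in auto)
      qed simp
      finally show ?thesis by (simp add: power_mult_distrib)
    qed
    have vH: "v \<nu> \<in> H" if "\<nu> \<in> F" for \<nu> using v FEV sols_in_H that by blast
    have "real (card F) = (\<Sum>\<nu>\<in>F. (hs.nrm (v \<nu>))\<^sup>2)" using v FEV by (simp add: subset_iff)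
    also have "\<dots> = (\<Sum>\<nu>\<in>F. (LINT t|M. \<Delta> t * (cmod (v \<nu> t))\<^sup>2))" by (intro sum.cong refl nrm_square_integral vH)
    also have "\<dots> = (LINT t|M. (\<Sum>\<nu>\<in>F. \<Delta> t * (cmod (v \<nu> t))\<^sup>2))"
      by (rule Bochner_Integration.integral_sum[symmetric]) (rule wL2_square_integrable[OF vH])
    also have "\<dots> \<le> (LINT t|M. (R' * C)\<^sup>2 * \<Delta> t)"
    proof (rule integral_mono)
      show "integrable M (\<lambda>t. \<Sum>\<nu>\<in>F. \<Delta> t * (cmod (v \<nu> t))\<^sup>2)"
        by (rule Bochner_Integration.integrable_sum) (rule wL2_square_integrable[OF vH])
      fix t assume "t \<in> space M"
      then have t: "t \<in> {a..b}" by simp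
      have "\<Delta> t * (\<Sum>\<nu>\<in>F. (cmod (v \<nu> t))\<^sup>2) \<le> \<Delta> t * (R' * C)\<^sup>2"
        by (rule mult_left_mono[OF pt[OF t] \<Delta>_nonneg[OF t]])
      then show "(\<Sum>\<nu>\<in>F. \<Delta> t * (cmod (v \<nu> t))\<^sup>2) \<le> (R' * C)\<^sup>2 * \<Delta> t"
        by (simp only: sum_distrib_left mult.commute)
    qed (use \<Delta>_int in simp)
    also have "\<dots> = (R' * C * nrm_one)\<^sup>2"
      by (simp add: power_mult_distrib nrm_one_square)
    finally show ?thesis unfolding B_def by linarith
  qed
  then show ?thesis by (rule finite_if_finite_subsets_card_bdd[THEN conjunct1])
qed

lemma EV_no_limpt: "\<not> z islimpt EV"
proof
  assume "z islimpt EV"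
  then have "infinite (EV \<inter> ball z 1)" by (simp add: islimpt_eq_infinite_ball)
  moreover have "EV \<inter> ball z 1 \<subseteq> {\<nu>\<in>EV. cmod \<nu> \<le> cmod z + 1}"
  proof clarify
    fix \<nu> assume "\<nu> \<in> ball z 1"
    then have "cmod (\<nu> - z) < 1" by (simp add: dist_norm norm_minus_commute)
    then show "cmod \<nu> \<le> cmod z + 1" using norm_triangle_sub[of \<nu> z] by linarith
  qed
  ultimately show False using finite_EV_ball finite_subset by blast
qed

lemma EV_countable: "countable EV"
  using EV_no_limpt by (rule no_limpt_imp_countable)

lemma real_regular_point: obtains m :: real where "complex_of_real m \<notin> EV"
proof -
  have "\<not> range complex_of_real \<subseteq> EV"
  proof
    assume "range complex_of_real \<subseteq> EV"
    then have "countable (range complex_of_real)" using EV_countable countable_subset by blast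
    then have "countable (UNIV :: real set)" using countable_image_inj_on[of complex_of_real UNIV] by (auto simp: inj_on_def)
    then show False using uncountable_UNIV_real by blast
  qed
  then show thesis using that by blast
qed

section \<open>Completeness of the eigenfunctions\<close>

lemma res_symmetric:
  assumes \<mu>: "\<mu> \<notin> EV" "cnj \<mu> = \<mu>" and f: "f \<in> H" and g: "g \<in> H"
  shows "ip (res \<mu> f) g = ip f (res \<mu> g)"
proof -
  obtain u where u: "inhom \<mu> f (res \<mu> f) u" using res_inhom[OF \<mu>(1) f] .
  obtain w where w: "inhom \<mu> g (res \<mu> g) w" using res_inhom[OF \<mu>(1) g] .
  define y z where "y = res \<mu> f" and "z = res \<mu> g"
  have H: "y \<in> H" "z \<in> H" unfolding y_def z_def by (rule res_in_H[OF \<mu>(1) f] res_in_H[OF \<mu>(1) g])+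
  have eq: "(LINT t|M. (\<mu> * of_real (\<Delta> t) * y t + of_real (\<Delta> t) * f t) * cnj (z t)) =
        (LINT t|M. y t * cnj (\<mu> * of_real (\<Delta> t) * z t + of_real (\<Delta> t) * g t))"
    using bvp_symmetric[OF u[unfolded inhom_def] w[unfolded inhom_def]] by (simp add: y_def z_def)
  have "(LINT t|M. (\<mu> * of_real (\<Delta> t) * y t + of_real (\<Delta> t) * f t) * cnj (z t))
      = (LINT t|M. \<mu> * (of_real (\<Delta> t) * y t * cnj (z t)) + of_real (\<Delta> t) * f t * cnj (z t))"
    by (simp add: algebra_simps)
  also have "\<dots> = \<mu> * ip y z + ip f z"
    using wL2_mult_integrable[OF H] wL2_mult_integrable[OF f H(2)]
    by (subst Bochner_Integration.integral_add) (auto simp: wip_def)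
  finally have l: "(LINT t|M. (\<mu> * of_real (\<Delta> t) * y t + of_real (\<Delta> t) * f t) * cnj (z t)) = \<mu> * ip y z + ip f z" .
  have "(LINT t|M. y t * cnj (\<mu> * of_real (\<Delta> t) * z t + of_real (\<Delta> t) * g t))
      = (LINT t|M. \<mu> * (of_real (\<Delta> t) * y t * cnj (z t)) + of_real (\<Delta> t) * y t * cnj (g t))"
    using \<mu>(2) by (simp add: algebra_simps)
  also have "\<dots> = \<mu> * ip y z + ip y g"
    using wL2_mult_integrable[OF H] wL2_mult_integrable[OF H(1) g]
    by (subst Bochner_Integration.integral_add) (auto simp: wip_def)
  finally show ?thesis using eq l by (simp add: y_def z_def)
qed

text \<open>
  The functions \<open>y = R (x n)\<close> are bounded, and equicontinuous because \<open>y' = u / p\<close> with uniformly bounded \<open>u\<close>.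
\<close>
lemma res_compact:
  assumes \<mu>: "\<mu> \<notin> EV" and x: "\<And>n::nat. x n \<in> H \<and> hs.nrm (x n) \<le> 1"
  shows "\<exists>z\<in>H. \<exists>r. strict_mono r \<and> (\<lambda>n. hs.nrm (res \<mu> (x (r n)) - z)) \<longlonglongrightarrow> 0"
proof -
  obtain C where C: "C \<ge> 0" "\<forall>f\<in>H. \<exists>u. inhom \<mu> f (res \<mu> f) u \<and>
     (\<forall>t\<in>{a..b}. cmod (res \<mu> f t) \<le> C * hs.nrm f \<and> cmod (u t) \<le> C * hs.nrm f)" using res_bound[OF \<mu>] .
  have "\<exists>u. inhom \<mu> (x n) (res \<mu> (x n)) u \<and> (\<forall>t\<in>{a..b}. cmod (res \<mu> (x n) t) \<le> C \<and> cmod (u t) \<le> C)" for n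
  proof -
    have "C * hs.nrm (x n) \<le> C" using mult_left_mono[of "hs.nrm (x n)" 1 C] x C(1) by simp
    then show ?thesis using C(2) x[of n] by (meson order_trans)
  qed
  then obtain u where u: "\<And>n. inhom \<mu> (x n) (res \<mu> (x n)) (u n)"
    and b: "\<And>n t. t \<in> {a..b} \<Longrightarrow> cmod (res \<mu> (x n) t) \<le> C" "\<And>n t. t \<in> {a..b} \<Longrightarrow> cmod (u n t) \<le> C" by metis
  define g where "g = (\<lambda>t. C * \<bar>1 / p t\<bar>)"
  have "integrable M g" unfolding g_def using p_int by (intro integrable_mult_right integrable_abs)
  then have g: "g integrable_on {a..b}" by (rule integrable_on_lebesgue_on) simp
  define N where "N = (\<lambda>t. integral {a..t} g)"
  have Nc: "continuous_on {a..b} N" unfolding N_def by (rule indefinite_integral_continuous_1[OF g])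
  have inc: "cmod (res \<mu> (x n) t - res \<mu> (x n) s) \<le> \<bar>N t - N s\<bar>" if st: "a \<le> s" "s \<le> t" "t \<le> b" for n s t
  proof -
    have "primitive a b (\<lambda>t. of_real (1 / p t) * u n t) (res \<mu> (x n))" using inhom_sys[OF u] by (simp add: sys_def)
    then have "cmod (res \<mu> (x n) t - res \<mu> (x n) s) \<le> integral {s..t} g"
    proof (rule primitive_increment_bound[OF _ st g])
      fix t assume "t \<in> {a..b}"
      then have "\<bar>1 / p t\<bar> * cmod (u n t) \<le> \<bar>1 / p t\<bar> * C" using b(2) by (intro mult_left_mono) auto
      then show "cmod (of_real (1 / p t) * u n t) \<le> g t" by (simp add: g_def norm_mult norm_divide mult.commute)
    qed
    also have "integral {s..t} g = N t - N s"
    proof -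
      have "integral {a..s} g + integral {s..t} g = integral {a..t} g"
        using st by (intro Henstock_Kurzweil_Integration.integral_combine integrable_on_subinterval[OF g]) auto
      then show ?thesis by (simp add: N_def)
    qed
    finally show ?thesis by simp
  qed
  have inc': "cmod (res \<mu> (x n) t - res \<mu> (x n) s) \<le> \<bar>N t - N s\<bar>" if "s \<in> {a..b}" "t \<in> {a..b}" for n s t
    using inc[of s t n] inc[of t s n] that by (cases "s \<le> t") (auto simp: norm_minus_commute abs_minus_commute)
  obtain h k where h: "continuous_on {a..b} h" and k: "strict_mono (k :: nat \<Rightarrow> nat)"
    and conv: "\<And>e. 0 < e \<Longrightarrow> \<exists>N. \<forall>n t. n \<ge> N \<and> t \<in> {a..b} \<longrightarrow> norm (res \<mu> (x (k n)) t - h t) < e"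
  proof (rule Arzela_Ascoli[of "{a..b}" "\<lambda>n t. res \<mu> (x n) t" C])
    show "\<And>n t. t \<in> {a..b} \<Longrightarrow> norm (res \<mu> (x n) t) \<le> C" by (rule b(1))
    fix t e :: real assume t: "t \<in> {a..b}" and e: "0 < e"
    then obtain d where d: "d > 0" "\<forall>s\<in>{a..b}. dist s t < d \<longrightarrow> dist (N s) (N t) < e"
      using Nc unfolding continuous_on_iff by meson
    have "norm (res \<mu> (x n) t - res \<mu> (x n) s) < e" if s: "s \<in> {a..b}" "norm (t - s) < d" for n s
    proof -
      have "dist (N s) (N t) < e" using d(2) s by (simp add: dist_norm norm_minus_commute)
      then show ?thesis using inc'[OF s(1) t, of n] by (simp add: dist_real_def abs_minus_commute)
    qed
    then show "\<exists>d>0. \<forall>n s. s \<in> {a..b} \<and> norm (t - s) < d \<longrightarrow> norm (res \<mu> (x n) t - res \<mu> (x n) s) < e"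
      using d(1) by blast
  qed (auto simp: compact_Icc)
  have hH: "h \<in> H" by (rule wL2_continuous[OF h])
  have "(\<lambda>n. hs.nrm (res \<mu> (x (k n)) - h)) \<longlonglongrightarrow> 0"
  proof (rule LIMSEQ_I)
    fix e :: real assume e: "e > 0"
    define e' where "e' = e / (nrm_one + 1)"
    have e': "e' > 0" using e nrm_one_nonneg by (simp add: e'_def)
    obtain n0 where n0: "\<And>n t. n \<ge> n0 \<Longrightarrow> t \<in> {a..b} \<Longrightarrow> norm (res \<mu> (x (k n)) t - h t) < e'" using conv[OF e'] by blast
    have "norm (hs.nrm (res \<mu> (x (k n)) - h) - 0) < e" if n: "n \<ge> n0" for n
    proof -
      have H: "res \<mu> (x (k n)) - h \<in> H" using res_in_H[OF \<mu>] x hH by blast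
      have "hs.nrm (res \<mu> (x (k n)) - h) \<le> e' * nrm_one"
        using nrm_sup_bound[OF H, of e'] n0[OF n] e' by (force simp: fun_diff_def)
      also have "\<dots> < e' * (nrm_one + 1)" using e' by simp
      also have "\<dots> = e" using nrm_one_nonneg by (simp add: e'_def)
      finally show ?thesis using hs.nrm_nonneg[OF H] by simp
    qed
    then show "\<exists>n0. \<forall>n\<ge>n0. norm (hs.nrm (res \<mu> (x (k n)) - h) - 0) < e" by blast
  qed
  then show ?thesis using hH k by blast
qed

lemma res_compact_symmetric:
  assumes \<mu>: "\<mu> \<notin> EV" "cnj \<mu> = \<mu>"
  shows "compact_symmetric cfun_scale H ip (res \<mu>)"
proof
  show "\<exists>B. \<forall>x\<in>H. hs.nrm (res \<mu> x) \<le> B * hs.nrm x"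
  proof -
    obtain C where C: "C \<ge> 0" "\<forall>f\<in>H. \<exists>u. inhom \<mu> f (res \<mu> f) u \<and>
     (\<forall>t\<in>{a..b}. cmod (res \<mu> f t) \<le> C * hs.nrm f \<and> cmod (u t) \<le> C * hs.nrm f)" using res_bound[OF \<mu>(1)] .
    have "hs.nrm (res \<mu> x) \<le> (C * nrm_one) * hs.nrm x" if x: "x \<in> H" for x
    proof -
      have "hs.nrm (res \<mu> x) \<le> (C * hs.nrm x) * nrm_one"
        using C x hs.nrm_nonneg[OF x] by (intro nrm_sup_bound res_in_H[OF \<mu>(1)]) auto
      then show ?thesis by (simp add: mult.assoc mult.left_commute mult.commute)
    qed
    then show ?thesis by blast
  qed
qed (auto intro: res_in_H[OF \<mu>(1)] res_add[OF \<mu>(1)] res_scale[OF \<mu>(1)] res_symmetric[OF \<mu>] res_compact[OF \<mu>(1)])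

text \<open>
  If \<open>y = R f\<close> vanishes almost everywhere on \<open>{\<Delta> > 0}\<close>, then so does \<open>\<mu> \<Delta> y + \<Delta> f\<close> by \<open>sys_zero_set\<close>.
\<close>
lemma res_injective:
  assumes \<mu>: "\<mu> \<notin> EV" and f: "f \<in> H" and 0: "hs.nrm (res \<mu> f) = 0"
  shows "hs.nrm f = 0"
proof -
  obtain u where u: "inhom \<mu> f (res \<mu> f) u" using res_inhom[OF \<mu> f] .
  have "Re (ip (res \<mu> f) (res \<mu> f)) = 0" using 0 hs.nrm_square[OF res_in_H[OF \<mu> f]] by simp
  then have "AE t in M. \<Delta> t > 0 \<longrightarrow> res \<mu> f t = 0" by (rule ip_zero_AE[OF res_in_H[OF \<mu> f]])
  with sys_zero_set[OF inhom_sys[OF u]] have "AE t in M. \<Delta> t * (cmod (f t))\<^sup>2 = 0"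
    using AE_space[of M]
  proof eventually_elim
    case (elim t)
    then have "\<Delta> t \<ge> 0" using \<Delta>_nonneg by simp
    then show ?case using elim by (cases "\<Delta> t = 0") auto
  qed
  then have "(LINT t|M. \<Delta> t * (cmod (f t))\<^sup>2) = 0" by (rule integral_eq_zero_AE)
  then show ?thesis using nrm_square_integral[OF f] by simp
qed

text \<open>
  The spectral theorem for the resolvent at a real point, translated back: an eigenvalue \<open>\<kappa>\<close> of the
  resolvent at \<open>\<mu>\<close> belongs to the eigenvalue \<open>\<mu> + 1 / \<kappa>\<close> of the boundary value problem.
\<close>
lemma eigenfunction_in_orthocomplement:
  assumes V: "\<And>v. v \<in> V \<Longrightarrow> \<exists>\<nu>\<in>EV. v \<in> L \<nu>" and g: "g \<in> H" "hs.nrm g \<noteq> 0" "\<And>v. v \<in> V \<Longrightarrow> ip g v = 0"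
  obtains \<nu> z where "\<nu> \<in> EV" "z \<in> L \<nu>" "hs.nrm z \<noteq> 0" "\<And>v. v \<in> V \<Longrightarrow> ip z v = 0"
proof -
  obtain m :: real where m: "complex_of_real m \<notin> EV" using real_regular_point .
  define \<mu> where "\<mu> = complex_of_real m"
  have \<mu>: "\<mu> \<notin> EV" "cnj \<mu> = \<mu>" using m by (auto simp: \<mu>_def)
  interpret K: compact_symmetric cfun_scale H ip "res \<mu>" by (rule res_compact_symmetric[OF \<mu>])
  have VH: "V \<subseteq> H" using V sols_in_H by blast
  have Vev: "\<exists>\<kappa>::real. res \<mu> v = cfun_scale (of_real \<kappa>) v" if v: "v \<in> V" for v
  proof -
    obtain \<nu> where \<nu>: "\<nu> \<in> EV" "v \<in> L \<nu>" using V[OF v] by blast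
    have "\<nu> = of_real (Re \<nu>)" using EV_real[OF \<nu>(1)] by (simp add: complex_eq_iff)
    then have "1 / (\<nu> - \<mu>) = of_real (1 / (Re \<nu> - m))" by (metis \<mu>_def of_real_1 of_real_diff of_real_divide)
    then show ?thesis using res_eigen[OF \<mu>(1) \<nu>(2) regular_neq_eigenvalue[OF \<mu>(1) \<nu>(1)]] by metis
  qed
  have "hs.nrm (res \<mu> g) \<noteq> 0" using res_injective[OF \<mu>(1) g(1)] g(2) by blast
  then obtain z \<kappa> where z: "z \<in> H" "\<forall>v\<in>V. ip z v = 0" "hs.nrm z \<noteq> 0" "\<kappa> \<noteq> (0::real)"
    "hs.nrm (res \<mu> z - cfun_scale (of_real \<kappa>) z) = 0"
    using K.eigenvector_in_orthocomplement[OF VH Vev g(1,3)] by metis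
  \<comment> \<open>\<open>z\<close> is an eigenvector only up to a function of norm zero.  The resolvent maps such functions to
     zero at every point, so \<open>z' = R z / \<kappa>\<close> is an eigenfunction in the literal sense.\<close>
  define z' where "z' = cfun_scale (of_real (1 / \<kappa>)) (res \<mu> z)"
  have KzH: "res \<mu> z \<in> H" by (rule res_in_H[OF \<mu>(1) z(1)])
  have z'H: "z' \<in> H" unfolding z'_def using KzH by blast
  define d where "d = z - z'"
  have dH: "d \<in> H" unfolding d_def using z(1) z'H by blast
  have "d = cfun_scale (of_real (- 1 / \<kappa>)) (res \<mu> z - cfun_scale (of_real \<kappa>) z)"
    using z(4) by (simp add: d_def z'_def cfun_scale_def fun_eq_iff algebra_simps)
  then have dn: "hs.nrm d = 0"
    using z(5) hs.nrm_scale[of "res \<mu> z - cfun_scale (of_real \<kappa>) z" "of_real (- 1 / \<kappa>)"] z(1) KzH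
    by (simp only:) auto
  have Kd: "res \<mu> d t = 0" for t
  proof (cases "t \<in> {a..b}")
    case True
    obtain C where "\<forall>f\<in>H. \<exists>u. inhom \<mu> f (res \<mu> f) u \<and>
     (\<forall>t\<in>{a..b}. cmod (res \<mu> f t) \<le> C * hs.nrm f \<and> cmod (u t) \<le> C * hs.nrm f)" using res_bound[OF \<mu>(1)] .
    then have "cmod (res \<mu> d t) \<le> C * hs.nrm d" using dH True by blast
    then show ?thesis using dn by simp
  next
    case False
    obtain u where "inhom \<mu> d (res \<mu> d) u" using res_inhom[OF \<mu>(1) dH] .
    then show ?thesis using False by (simp add: inhom_def bvp_def)
  qed
  have "z = z' + d" by (simp add: d_def)
  then have "res \<mu> z = res \<mu> z' + res \<mu> d" using res_add[OF \<mu>(1) z'H dH] by simp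
  then have Kz: "res \<mu> z' = res \<mu> z" using Kd by (simp add: fun_eq_iff)
  obtain u where u: "inhom \<mu> z' (res \<mu> z') u" using res_inhom[OF \<mu>(1) z'H] .
  define \<nu> where "\<nu> = \<mu> + of_real (1 / \<kappa>)"
  have zL: "res \<mu> z \<in> L \<nu>"
  proof -
    have "bvp (\<lambda>t. \<nu> * of_real (\<Delta> t) * res \<mu> z t) (res \<mu> z) u"
      using u[unfolded inhom_def Kz] by (rule bvp_cong) (simp add: z'_def cfun_scale_def \<nu>_def algebra_simps)
    then show ?thesis by (auto simp: sols_iff)
  qed
  have z'L: "z' \<in> L \<nu>" unfolding z'_def by (rule sols_scale[OF zL])
  have z'n: "hs.nrm z' \<noteq> 0"
  proof
    assume "hs.nrm z' = 0"
    then have "hs.nrm z \<le> 0" using hs.nrm_triangle[OF z'H dH] \<open>z = z' + d\<close> dn by simp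
    then show False using z(3) hs.nrm_nonneg[OF z(1)] by simp
  qed
  have "z' \<noteq> (\<lambda>t. 0)"
  proof
    assume "z' = (\<lambda>t. 0)"
    then have "hs.nrm z' = 0" by (simp add: hs.nrm_def wip_def)
    then show False using z'n by simp
  qed
  then have \<nu>EV: "\<nu> \<in> EV" using z'L unfolding EV_iff sols_iff by blast
  have "ip z' v = 0" if v: "v \<in> V" for v
  proof -
    have vH: "v \<in> H" using v VH by blast
    have "ip z v = ip z' v + ip d v" using \<open>z = z' + d\<close> hs.ip_add[OF z'H dH vH] by simp
    moreover have "cmod (ip d v) \<le> 0" using hs.cauchy_schwarz[OF dH vH] dn by simp
    ultimately show ?thesis using z(2) v by simp
  qed
  then show thesis using that[OF \<nu>EV z'L z'n] by blast
qed

lemma sols_proportional: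
  assumes "y \<in> L \<nu>" "z \<in> L \<nu>" "hs.nrm z \<noteq> 0"
  obtains c where "y = cfun_scale c z"
proof -
  obtain u w where y: "eigen \<nu> y u" and z: "eigen \<nu> z w"
    using assms by (auto simp: sols_iff)
  have "z \<noteq> (\<lambda>t. 0)" using assms(3) by (auto simp: hs.nrm_def wip_def)
  then obtain c where c: "\<And>t. t \<in> {a..b} \<Longrightarrow> y t = c * z t \<and> u t = c * w t"
    using left_bc_unique[of \<nu> y u z w] y z unfolding bvp_def by metis
  have "y t = c * z t" for t using c y z by (cases "t \<in> {a..b}") (auto simp: bvp_def)
  then show thesis using that[of c] by (simp add: cfun_scale_def fun_eq_iff)
qed

text \<open>
  An eigenfunction orthogonal to all \<open>v \<nu>\<close> would be proportional to one of them, as eigenspaces are one-dimensional.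
\<close>
lemma orthogonal_to_all_eigenfunctions:
  assumes v: "\<And>\<nu>. \<nu> \<in> EV \<Longrightarrow> v \<nu> \<in> L \<nu> \<and> hs.nrm (v \<nu>) \<noteq> 0"
    and g: "g \<in> H" "\<And>\<nu>. \<nu> \<in> EV \<Longrightarrow> ip g (v \<nu>) = 0"
  shows "hs.nrm g = 0"
proof (rule ccontr)
  assume "hs.nrm g \<noteq> 0"
  then obtain \<nu> z where z: "\<nu> \<in> EV" "z \<in> L \<nu>" "hs.nrm z \<noteq> 0" "\<forall>w\<in>v ` EV. ip z w = 0"
    using eigenfunction_in_orthocomplement[of "v ` EV" g] v g by (smt (verit, ccfv_threshold) imageE)
  obtain c where c: "z = cfun_scale c (v \<nu>)" using sols_proportional[OF z(2)] v[OF z(1)] by metis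
  have H: "z \<in> H" "v \<nu> \<in> H" using z v sols_in_H by blast+
  have "ip z z = cnj c * ip z (v \<nu>)" using c hs.ip_scale_right[OF H] by metis
  then have "ip z z = 0" using z(1,4) by simp
  then show False using z(3) by (simp add: hs.nrm_def)
qed

lemma \<Delta>_integral_pos: "integral {a..b} \<Delta> > 0"
proof -
  have "(LINT t|M. \<Delta> t) \<ge> 0" using \<Delta>_nonneg by (auto intro!: Bochner_Integration.integral_nonneg)
  moreover have "(LINT t|M. \<Delta> t) \<noteq> 0"
  proof
    assume "(LINT t|M. \<Delta> t) = 0"
    moreover have "AE t in M. 0 \<le> \<Delta> t" by (rule AE_I2) (use \<Delta>_nonneg in simp)
    ultimately have "AE t in M. \<Delta> t = 0"
      using integral_nonneg_eq_0_iff_AE[OF \<Delta>_int] by simp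
    then have "AE t in M. \<Delta> t > 0 \<longrightarrow> False" by eventually_elim simp
    then show False by (rule AE_pos_witness)
  qed
  ultimately show ?thesis using lebesgue_integral_eq_integral[OF \<Delta>_int] by simp
qed

lemma EV_infinite: "infinite EV"
proof
  assume fin: "finite EV"
  have "\<exists>v. v \<in> L \<nu> \<and> hs.nrm v \<noteq> 0" if "\<nu> \<in> EV" for \<nu> using eigenfunction_exists[OF that] by (metis zero_neq_one)
  then obtain v where v: "\<And>\<nu>. \<nu> \<in> EV \<Longrightarrow> v \<nu> \<in> L \<nu> \<and> hs.nrm (v \<nu>) \<noteq> 0" by metis
  obtain e where e: "hs.orthonormal {..<Suc (card EV)} e" using exists_orthonormal[OF \<Delta>_integral_pos] by blast
  obtain g where g: "g \<in> H" "hs.nrm g \<noteq> 0" "\<And>\<nu>. \<nu> \<in> EV \<Longrightarrow> ip g (v \<nu>) = 0"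
    by (rule hs.exists_orthogonal[OF e finite_lessThan fin, of v]) (use v sols_in_H in auto)
  then show False using orthogonal_to_all_eigenfunctions[OF v] by blast
qed

text \<open>
  With \<open>y = R g\<close> the coefficients are \<open>(y, v k) = (g, v k) / (ev k - \<mu>)\<close>, so the partial sums of the expansion of
  \<open>y\<close> are the images under \<open>R\<close> of those of \<open>g\<close>, and \<open>|R (g - gn) (t)| \<le> C \<parallel>g - gn\<parallel>\<close> gives uniform convergence.
\<close>
theorem eigenfunction_expansion:
  fixes ev :: "nat \<Rightarrow> complex" and v :: "nat \<Rightarrow> real \<Rightarrow> complex"
  assumes ev: "inj ev" "range ev = EV" and v: "\<And>k. v k \<in> L (ev k)" "\<And>k. hs.nrm (v k) = 1"
    and y: "y \<in> sl_F a b p q \<Delta> \<alpha> \<beta>"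
  shows "\<And>t. t \<in> {a..b} \<Longrightarrow> summable (\<lambda>k. cmod (ip y (v k) * v k t))"
    and "uniform_limit {a..b} (\<lambda>n t. \<Sum>k<n. ip y (v k) * v k t) y sequentially"
proof -
  obtain m :: real where m: "complex_of_real m \<notin> EV" using real_regular_point .
  define \<mu> where "\<mu> = complex_of_real m"
  have \<mu>: "\<mu> \<notin> EV" "cnj \<mu> = \<mu>" using m by (auto simp: \<mu>_def)
  obtain C where C: "C \<ge> 0" "\<And>f t. f \<in> H \<Longrightarrow> t \<in> {a..b} \<Longrightarrow> cmod (res \<mu> f t) \<le> C * hs.nrm f"
    using res_bound[OF \<mu>(1)] by metis
  have evEV: "ev k \<in> EV" for k using ev(2) by blast
  have vH: "v k \<in> H" for k using v(1) sols_in_H by blast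
  have orth: "hs.orthonormal UNIV v"
    unfolding hs.orthonormal_def
    using vH v(2) eigen_orthogonal[OF evEV evEV _ v(1) v(1)] inj_eq[OF ev(1)] hs.ip_self[OF vH] by simp
  obtain f u where f: "f \<in> H" and u: "bvp (\<lambda>t. of_real (\<Delta> t) * f t) y u" using y by (auto simp: F_iff)
  have yH: "y \<in> H" using u by (auto simp: bvp_def intro: wL2_continuous sys_continuous)
  define g where "g = f - cfun_scale \<mu> y"
  have gH: "g \<in> H" unfolding g_def using f yH by blast
  have "inhom \<mu> g y u" unfolding inhom_def
    by (rule bvp_cong[OF u]) (simp add: g_def cfun_scale_def algebra_simps)
  then have yK: "res \<mu> g = y" by (rule res_eq[OF \<mu>(1)])
  have Kv: "res \<mu> (v k) = cfun_scale (1 / (ev k - \<mu>)) (v k)" for k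
    by (rule res_eigen[OF \<mu>(1) v(1) regular_neq_eigenvalue[OF \<mu>(1) evEV]])
  have coef: "ip y (v k) = ip g (v k) / (ev k - \<mu>)" for k
  proof -
    have "ip y (v k) = ip g (res \<mu> (v k))" using res_symmetric[OF \<mu> gH vH] yK by simp
    also have "\<dots> = cnj (1 / (ev k - \<mu>)) * ip g (v k)" unfolding Kv by (rule hs.ip_scale_right[OF gH vH])
    also have "cnj (1 / (ev k - \<mu>)) = 1 / (ev k - \<mu>)" using EV_real[OF evEV] \<mu>(2) by simp
    finally show ?thesis by simp
  qed
  show "summable (\<lambda>k. cmod (ip y (v k) * v k t))" if t: "t \<in> {a..b}" for t
  proof -
    define A where "A = (\<lambda>k. (cmod (ip g (v k)))\<^sup>2)"
    define B where "B = (\<lambda>k. (cmod (v k t / (ev k - \<mu>)))\<^sup>2)"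
    have "summable A"
      by (rule summableI_nonneg_bounded[where x = "(hs.nrm g)\<^sup>2"])
         (auto simp: A_def intro: hs.bessel[OF orth _ _ gH])
    moreover have "summable B"
    proof (rule summableI_nonneg_bounded[where x = "C\<^sup>2"])
      fix n
      have o: "hs.orthonormal {..<n} v" using orth by (simp add: hs.orthonormal_def)
      show "(\<Sum>k<n. B k) \<le> C\<^sup>2" unfolding B_def
        by (rule eigenfunction_kernel_bound[OF \<mu>(1) C _ o _ t]) (use evEV v in auto)
    qed (simp add: B_def)
    ultimately have "summable (\<lambda>k. (A k + B k) / 2)" by (intro summable_divide summable_add)
    then show ?thesis
    proof (rule summable_comparison_test')
      fix k
      have "2 * cmod (ip g (v k)) * cmod (v k t / (ev k - \<mu>)) \<le> A k + B k"
        unfolding A_def B_def by (rule sum_squares_bound)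
      moreover have "cmod (ip y (v k) * v k t) = cmod (ip g (v k)) * cmod (v k t / (ev k - \<mu>))"
        unfolding coef by (simp add: norm_mult norm_divide)
      ultimately show "norm (cmod (ip y (v k) * v k t)) \<le> (A k + B k) / 2" by simp
    qed
  qed
  have total: "hs.nrm h = 0" if h: "h \<in> H" "\<And>k. ip h (v k) = 0" for h
  proof (rule orthogonal_to_all_eigenfunctions[where v = "\<lambda>\<nu>. v (the_inv ev \<nu>)"])
    fix \<nu> assume "\<nu> \<in> EV"
    then obtain k where "\<nu> = ev k" using ev(2) by blast
    then show "v (the_inv ev \<nu>) \<in> L \<nu> \<and> hs.nrm (v (the_inv ev \<nu>)) \<noteq> 0" "ip h (v (the_inv ev \<nu>)) = 0"
      using v h(2) ev(1) by (auto simp: the_inv_f_f)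
  qed (rule h(1))
  define gn where "gn = (\<lambda>n. \<Sum>k<n. cfun_scale (ip g (v k)) (v k))"
  have gnH: "gn n \<in> H" for n unfolding gn_def using vH by auto
  have lim: "(\<lambda>n. hs.nrm (g - gn n)) \<longlonglongrightarrow> 0"
    unfolding gn_def by (rule hs.orthonormal_expansion[OF orth gH riesz_fischer total])
  have Kgn: "res \<mu> (gn n) t = (\<Sum>k<n. ip y (v k) * v k t)" for n t
    unfolding gn_def res_sum[OF \<mu>(1) vH] by (simp add: Kv cfun_scale_def coef)
  show "uniform_limit {a..b} (\<lambda>n t. \<Sum>k<n. ip y (v k) * v k t) y sequentially"
  proof (rule uniform_limitI)
    fix e :: real assume e: "e > 0"
    have "(\<lambda>n. C * hs.nrm (g - gn n)) \<longlonglongrightarrow> C * 0" by (intro tendsto_intros lim)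
    then have "\<forall>\<^sub>F n in sequentially. C * hs.nrm (g - gn n) < e" using e by (intro order_tendstoD(2)) auto
    then show "\<forall>\<^sub>F n in sequentially. \<forall>t\<in>{a..b}. dist (\<Sum>k<n. ip y (v k) * v k t) (y t) < e"
    proof eventually_elim
      case (elim n)
      show ?case
      proof
        fix t assume t: "t \<in> {a..b}"
        have dH: "g - gn n \<in> H" using gH gnH by blast
        have "g = (g - gn n) + gn n" by simp
        then have "y = res \<mu> (g - gn n) + res \<mu> (gn n)" using res_add[OF \<mu>(1) dH gnH] yK by metis
        then have "y t - (\<Sum>k<n. ip y (v k) * v k t) = res \<mu> (g - gn n) t" by (simp add: Kgn)
        then have "dist (\<Sum>k<n. ip y (v k) * v k t) (y t) = cmod (res \<mu> (g - gn n) t)"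
          by (metis dist_commute dist_norm)
        also have "\<dots> \<le> C * hs.nrm (g - gn n)" by (rule C(2)[OF dH t])
        finally show "dist (\<Sum>k<n. ip y (v k) * v k t) (y t) < e" using elim by simp
      qed
    qed
  qed
qed


section \<open>A lower bound for nonnegative leading coefficients\<close>

lemma bvp_zero: "bvp (\<lambda>t. 0) (\<lambda>t. 0) (\<lambda>t. 0)"
  by (simp add: bvp_def sys_def primitive_def left_bc_def right_bc_def)

lemma bvp_sum:
  assumes "finite F" "\<And>i. i \<in> F \<Longrightarrow> bvp (g i) (y i) (u i)"
  shows "bvp (\<lambda>t. \<Sum>i\<in>F. c i * g i t) (\<lambda>t. \<Sum>i\<in>F. c i * y i t) (\<lambda>t. \<Sum>i\<in>F. c i * u i t)"
  using assms
proof (induction F rule: finite_induct)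
  case empty
  then show ?case using bvp_zero by simp
next
  case (insert x F)
  then have "bvp (\<lambda>t. (\<Sum>i\<in>F. c i * g i t) + c x * g x t) (\<lambda>t. (\<Sum>i\<in>F. c i * y i t) + c x * y x t)
      (\<lambda>t. (\<Sum>i\<in>F. c i * u i t) + c x * u x t)"
    by (intro bvp_lin) auto
  then show ?case using insert.hyps by (simp add: add.commute)
qed

text \<open>
  If \<open>sin \<theta> = 0\<close>, the boundary condition is \<open>y = 0\<close> and both sides vanish.
\<close>
lemma bc_form_bound:
  fixes \<theta> :: real and y u :: complex
  assumes "of_real (cos \<theta>) * y + of_real (sin \<theta>) * u = 0"
  shows "cmod (u * cnj y) \<le> \<bar>cos \<theta> / sin \<theta>\<bar> * (cmod y)\<^sup>2"
proof (cases "sin \<theta> = 0")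
  case True
  then have "cos \<theta> \<noteq> 0" using sin_cos_squared_add[of \<theta>] by (metis add_0 power_zero_numeral zero_neq_one)
  then show ?thesis using assms True by simp
next
  case False
  then have "u = - of_real (cos \<theta> / sin \<theta>) * y" using assms by (simp add: field_simps add_eq_0_iff)
  then show ?thesis by (simp add: norm_mult norm_divide power2_eq_square)
qed

text \<open>
  Suppose that there are more negative eigenvalues than points \<open>\<tau> 0, \<dots>, \<tau> n\<close> of a grid.  Some nontrivial combination
  \<open>w\<close> of their eigenfunctions vanishes on the grid.  Writing \<open>x\<close> for the maximum of \<open>|w|\<close> and
  \<open>N2 = \<integral> p |w'|\<^sup>2\<close>, negativity of the form gives \<open>N2 < Cc x\<^sup>2\<close>, while the grid gives \<open>x\<^sup>2 \<le> \<delta> N2\<close> where \<open>\<delta>\<close>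
  bounds \<open>\<integral> 1/p\<close> between neighbouring points.  The grid is chosen such that \<open>Cc \<delta> \<le> 1\<close>.
\<close>
lemma finite_negative_EV:
  assumes p0: "\<forall>t\<in>{a..b}. 0 \<le> p t"
  shows "finite {\<nu>\<in>EV. Re \<nu> < 0}"
proof -
  define r where "r = (\<lambda>t. 1 / p t)"
  have r0: "r t \<ge> 0" if "t \<in> {a..b}" for t using p0 that by (simp add: r_def)
  have r_int: "integrable M r" using p_int by (simp add: r_def)
  have r_on: "r integrable_on {a..b}" by (rule integrable_on_lebesgue_on[OF r_int]) simp
  have r_onuv: "r integrable_on {s..t}" if "a \<le> s" "t \<le> b" for s t
    using integrable_on_subinterval[OF r_on] that by auto
  define \<rho> where "\<rho> = (\<lambda>t. integral {a..t} r)"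
  have \<rho>_cont: "continuous_on {a..b} \<rho>" unfolding \<rho>_def by (rule indefinite_integral_continuous_1[OF r_on])
  have \<rho>_diff: "integral {s..t} r = \<rho> t - \<rho> s" if "a \<le> s" "s \<le> t" "t \<le> b" for s t
  proof -
    have "integral {a..s} r + integral {s..t} r = integral {a..t} r"
      using that by (intro Henstock_Kurzweil_Integration.integral_combine r_onuv) auto
    then show ?thesis by (simp add: \<rho>_def)
  qed
  have \<rho>_le: "\<rho> s \<le> \<rho> t" if "a \<le> s" "s \<le> t" "t \<le> b" for s t
  proof -
    have "integral {s..t} r \<ge> 0" using that r0 by (intro Henstock_Kurzweil_Integration.integral_nonneg r_onuv) auto
    then show ?thesis using \<rho>_diff[OF that] by simp
  qed
  have \<rho>a: "\<rho> a = 0" by (simp add: \<rho>_def)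
  have \<rho>b: "\<rho> b \<ge> 0" using \<rho>_le[of a b] \<rho>a ab_le by simp
  define Cc where "Cc = (LINT t|M. \<bar>q t\<bar>) + \<bar>cos \<alpha> / sin \<alpha>\<bar> + \<bar>cos \<beta> / sin \<beta>\<bar>"
  have Cc0: "Cc \<ge> 0" unfolding Cc_def by (intro add_nonneg_nonneg Bochner_Integration.integral_nonneg) auto
  obtain n0 :: nat where n0: "Cc * (\<rho> b + 1) \<le> n0" using real_arch_simple by blast
  define n where "n = Suc n0"
  define \<delta> where "\<delta> = (\<rho> b + 1) / real n"
  have \<delta>: "\<delta> > 0" using \<rho>b by (simp add: \<delta>_def n_def)
  have Cc\<delta>: "Cc * \<delta> \<le> 1" using n0 by (simp add: \<delta>_def n_def field_simps)
  obtain \<tau> where \<tau>: "\<And>j. j \<le> n \<Longrightarrow> a \<le> \<tau> j \<and> \<tau> j \<le> b \<and> \<rho> (\<tau> j) = real j / real n * \<rho> b"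
    using equally_spaced_levels[OF ab_le \<rho>_cont \<rho>a \<rho>b, of n] by (auto simp: n_def)
  have near: "\<exists>j\<le>n. \<bar>\<rho> t - \<rho> (\<tau> j)\<bar> \<le> \<delta>" if t: "t \<in> {a..b}" for t
  proof (cases "\<rho> b = 0")
    case True
    then have "\<rho> t = 0" using \<rho>_le[of a t] \<rho>_le[of t b] \<rho>a t by auto
    then show ?thesis using \<tau>[of 0] \<delta> by (intro exI[of _ 0]) auto
  next
    case False
    then have pos: "\<rho> b > 0" using \<rho>b by simp
    have \<rho>t: "0 \<le> \<rho> t" "\<rho> t \<le> \<rho> b" using \<rho>_le[of a t] \<rho>_le[of t b] \<rho>a t by auto
    define x where "x = real n * \<rho> t / \<rho> b"
    define j where "j = nat \<lfloor>x\<rfloor>"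
    have x0: "0 \<le> x" using \<rho>t pos by (simp add: x_def)
    have xn: "x \<le> real n" using \<rho>t pos by (simp add: x_def field_simps mult_left_mono)
    have jx: "real j \<le> x" "x < real j + 1" using x0 by (auto simp: j_def)
    have jn: "j \<le> n" using jx(1) xn by linarith
    have "\<rho> t = x / real n * \<rho> b" using pos by (simp add: x_def n_def)
    then have "\<rho> t - \<rho> (\<tau> j) = (x - real j) / real n * \<rho> b"
      using \<tau>[OF jn] by (simp add: diff_divide_distrib left_diff_distrib)
    moreover have "(x - real j) / real n * \<rho> b \<le> 1 / real n * (\<rho> b + 1)"
      using jx pos by (intro mult_mono divide_right_mono) auto
    moreover have "(x - real j) / real n * \<rho> b \<ge> 0" using jx pos by simp
    ultimately show ?thesis using jn by (intro exI[of _ j]) (simp add: \<delta>_def)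
  qed
  have "\<exists>v. v \<in> L \<nu> \<and> ip v v = 1 \<and> hs.nrm v = 1" if "\<nu> \<in> EV" for \<nu> using eigenfunction_exists[OF that] by metis
  then obtain v where v: "\<And>\<nu>. \<nu> \<in> EV \<Longrightarrow> v \<nu> \<in> L \<nu> \<and> ip (v \<nu>) (v \<nu>) = 1 \<and> hs.nrm (v \<nu>) = 1" by metis
  have orth: "hs.orthonormal EV v"
    unfolding hs.orthonormal_def using v eigen_orthogonal sols_in_H by (metis (no_types, lifting))
  have "\<exists>u. eigen \<nu> (v \<nu>) u" if "\<nu> \<in> EV" for \<nu> using v[OF that] by (auto simp: sols_iff)
  then obtain u where u: "\<And>\<nu>. \<nu> \<in> EV \<Longrightarrow> eigen \<nu> (v \<nu>) (u \<nu>)" by metis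
  have "card F \<le> Suc n" if F: "F \<subseteq> {\<nu>\<in>EV. Re \<nu> < 0}" "finite F" for F
  proof (rule ccontr)
    assume "\<not> card F \<le> Suc n"
    then have card: "card {..n} < card F" by simp
    have FEV: "F \<subseteq> EV" using F by auto
    obtain c where c: "\<exists>\<nu>\<in>F. c \<nu> \<noteq> 0" "\<And>j. j \<in> {..n} \<Longrightarrow> (\<Sum>\<nu>\<in>F. v \<nu> (\<tau> j) * c \<nu>) = 0"
      using underdetermined_system[OF finite_atMost F(2) card, of "\<lambda>j \<nu>. v \<nu> (\<tau> j)"] by blast
    define w where "w = (\<lambda>t. \<Sum>\<nu>\<in>F. c \<nu> * v \<nu> t)"
    define U where "U = (\<lambda>t. \<Sum>\<nu>\<in>F. c \<nu> * u \<nu> t)"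
    define G where "G = (\<lambda>t. \<Sum>\<nu>\<in>F. c \<nu> * (\<nu> * of_real (\<Delta> t) * v \<nu> t))"
    have bw: "bvp G w U" unfolding G_def w_def U_def using u FEV by (intro bvp_sum F(2)) auto
    then have sw: "sys G w U" by (simp add: bvp_def)
    have wp: "primitive a b (\<lambda>t. of_real (r t) * U t) w" and Up: "primitive a b (\<lambda>t. of_real (q t) * w t - G t) U"
      using sw by (auto simp: sys_def r_def)
    have wc: "continuous_on {a..b} w" and Uc: "continuous_on {a..b} U" using sys_continuous[OF sw] by auto
    have wH: "w \<in> H" by (rule wL2_continuous[OF wc])
    have vH: "v \<nu> \<in> H" if "\<nu> \<in> F" for \<nu> using v FEV sols_in_H that by blast
    have w_eq: "w = (\<Sum>\<nu>\<in>F. cfun_scale (c \<nu>) (v \<nu>))"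
    proof
      fix t
      have "(\<Sum>\<nu>\<in>S. cfun_scale (c \<nu>) (v \<nu>)) t = (\<Sum>\<nu>\<in>S. c \<nu> * v \<nu> t)" if "finite S" for S
        using that by (induction S rule: finite_induct) (auto simp: cfun_scale_def zero_fun_def)
      then show "w t = (\<Sum>\<nu>\<in>F. cfun_scale (c \<nu>) (v \<nu>)) t" using F(2) by (simp add: w_def)
    qed
    have wzero: "w (\<tau> j) = 0" if "j \<le> n" for j using c(2)[of j] that by (simp add: w_def mult.commute)
    define N2 where "N2 = (LINT t|M. r t * (cmod (U t))\<^sup>2)"
    \<comment> \<open>Integrating \<open>(U cnj w)'\<close> expresses \<open>N2 = \<integral> r |U|\<^sup>2\<close> by the eigenvalues, the potential and the boundary
       values; the eigenvalues contribute a negative amount, so \<open>N2\<close> is less than \<open>Cc\<close> times the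
       square of the maximum of \<open>|w|\<close>.\<close>
    have rU: "integrable M (\<lambda>t. complex_of_real (r t) * U t * cnj (U t))"
      unfolding r_def by (rule integrable_mult_continuous[OF q_mult_integrable(2)[OF Uc] continuous_on_cnj[OF Uc]])
    have rU': "integrable M (\<lambda>t. r t * (cmod (U t))\<^sup>2)"
    proof -
      have "integrable M (\<lambda>t. Re (complex_of_real (r t) * U t * cnj (U t)))" using rU by (rule integrable_Re)
      moreover have "Re (complex_of_real (r t) * U t * cnj (U t)) = r t * (cmod (U t))\<^sup>2" for t
        by (simp add: mult.assoc flip: complex_norm_square)
      ultimately show ?thesis by simp
    qed
    have N20: "N2 \<ge> 0" unfolding N2_def using r0 by (auto intro!: Bochner_Integration.integral_nonneg)
    have qw: "integrable M (\<lambda>t. complex_of_real (q t) * w t * cnj (w t))"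
      by (rule integrable_mult_continuous[OF q_mult_integrable(1)[OF wc] continuous_on_cnj[OF wc]])
    have Gw: "integrable M (\<lambda>t. G t * cnj (w t))"
      by (rule integrable_mult_continuous[OF sys_integrable[OF sw] continuous_on_cnj[OF wc]])
    have e1: "(LINT t|M. (of_real (q t) * w t - G t) * cnj (w t) + U t * cnj (of_real (r t) * U t)) = U b * cnj (w b) - U a * cnj (w a)"
      by (rule primitive_integral[OF ab_le primitive_mult[OF ab_le Up primitive_cnj[OF wp]]])
    have e2: "(LINT t|M. (of_real (q t) * w t - G t) * cnj (w t) + U t * cnj (of_real (r t) * U t))
       = (LINT t|M. of_real (q t) * w t * cnj (w t)) - (LINT t|M. G t * cnj (w t)) + (LINT t|M. of_real (r t) * U t * cnj (U t))"
    proof -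
      have "(LINT t|M. (of_real (q t) * w t - G t) * cnj (w t) + U t * cnj (of_real (r t) * U t))
        = (LINT t|M. of_real (q t) * w t * cnj (w t) - G t * cnj (w t) + of_real (r t) * U t * cnj (U t))"
        by (simp add: algebra_simps)
      then show ?thesis using qw Gw rU by simp
    qed
    have e3: "(LINT t|M. of_real (r t) * U t * cnj (U t)) = of_real N2"
    proof -
      have "(LINT t|M. of_real (r t) * U t * cnj (U t)) = (LINT t|M. complex_of_real (r t * (cmod (U t))\<^sup>2))"
        by (simp add: of_real_cmod_square mult.assoc)
      then show ?thesis unfolding N2_def by (simp only: integral_complex_of_real)
    qed
    have e4: "(LINT t|M. G t * cnj (w t)) = (\<Sum>\<nu>\<in>F. \<nu> * of_real ((cmod (c \<nu>))\<^sup>2))"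
    proof -
      have "(LINT t|M. G t * cnj (w t)) = (LINT t|M. (\<Sum>\<nu>\<in>F. (c \<nu> * \<nu>) * (of_real (\<Delta> t) * v \<nu> t * cnj (w t))))"
        by (simp add: G_def sum_distrib_right mult.assoc mult.left_commute)
      also have "\<dots> = (\<Sum>\<nu>\<in>F. (c \<nu> * \<nu>) * ip (v \<nu>) w)"
        unfolding wip_def using wL2_mult_integrable[OF vH wH]
        by (subst Bochner_Integration.integral_sum) auto
      also have "\<dots> = (\<Sum>\<nu>\<in>F. \<nu> * of_real ((cmod (c \<nu>))\<^sup>2))"
      proof (rule sum.cong[OF refl])
        fix \<nu> assume \<nu>: "\<nu> \<in> F"
        have "ip w (v \<nu>) = c \<nu>" using hs.orthonormal_ip_sum[OF orth F(2) FEV, of \<nu> c] \<nu> FEV unfolding w_eq by auto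
        then have "ip (v \<nu>) w = cnj (c \<nu>)" using hs.ip_cnj[OF wH vH[OF \<nu>]] by simp
        then show "(c \<nu> * \<nu>) * ip (v \<nu>) w = \<nu> * of_real ((cmod (c \<nu>))\<^sup>2)"
          by (simp add: of_real_cmod_square mult.assoc mult.left_commute)
      qed
      finally show ?thesis .
    qed
    have rearrange: "z = y - x + d" if "x - y + z = d" for x y z d :: complex
      using that by (auto simp: algebra_simps)
    have energy: "of_real N2 = (\<Sum>\<nu>\<in>F. \<nu> * of_real ((cmod (c \<nu>))\<^sup>2)) - (LINT t|M. of_real (q t) * w t * cnj (w t))
         + (U b * cnj (w b) - U a * cnj (w a))"
      by (rule rearrange[OF e1[unfolded e2 e3 e4]])
    have neg: "(\<Sum>\<nu>\<in>F. Re \<nu> * (cmod (c \<nu>))\<^sup>2) < 0"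
    proof -
      obtain \<nu> where \<nu>: "\<nu> \<in> F" "c \<nu> \<noteq> 0" using c(1) by blast
      have "0 < (\<Sum>\<nu>\<in>F. - Re \<nu> * (cmod (c \<nu>))\<^sup>2)"
      proof (rule sum_pos2[OF F(2) \<nu>(1)])
        show "0 < - Re \<nu> * (cmod (c \<nu>))\<^sup>2" using \<nu> F(1) by (intro mult_pos_pos) auto
        show "0 \<le> - Re i * (cmod (c i))\<^sup>2" if "i \<in> F" for i using that F(1) by (intro mult_nonneg_nonneg) auto
      qed
      then show ?thesis by (simp add: sum_negf)
    qed
    obtain s where s: "s \<in> {a..b}" "\<And>t. t \<in> {a..b} \<Longrightarrow> cmod (w t) \<le> cmod (w s)"
      using continuous_attains_sup[OF compact_Icc _ continuous_on_norm[OF wc]] ab_le by fastforce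
    define x where "x = cmod (w s)"
    have x0: "x \<ge> 0" by (simp add: x_def)
    have wx: "(cmod (w t))\<^sup>2 \<le> x\<^sup>2" if "t \<in> {a..b}" for t using s(2)[OF that] by (intro power_mono) (auto simp: x_def)
    have qb: "cmod (LINT t|M. of_real (q t) * w t * cnj (w t)) \<le> (LINT t|M. \<bar>q t\<bar>) * x\<^sup>2"
    proof -
      have "cmod (LINT t|M. of_real (q t) * w t * cnj (w t)) \<le> (LINT t|M. cmod (of_real (q t) * w t * cnj (w t)))"
        by (rule integral_norm_bound)
      also have "\<dots> \<le> (LINT t|M. \<bar>q t\<bar> * x\<^sup>2)"
      proof (rule integral_mono)
        show "integrable M (\<lambda>t. cmod (of_real (q t) * w t * cnj (w t)))" using qw by (rule integrable_norm)
        show "integrable M (\<lambda>t. \<bar>q t\<bar> * x\<^sup>2)" using q_int by (intro integrable_mult_left integrable_abs)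
        fix t assume "t \<in> space M"
        then have "\<bar>q t\<bar> * (cmod (w t))\<^sup>2 \<le> \<bar>q t\<bar> * x\<^sup>2" using wx[of t] by (intro mult_left_mono) auto
        then show "cmod (of_real (q t) * w t * cnj (w t)) \<le> \<bar>q t\<bar> * x\<^sup>2" by (simp add: norm_mult power2_eq_square mult.assoc)
      qed
      finally show ?thesis by simp
    qed
    have Ub: "cmod (U b * cnj (w b)) \<le> \<bar>cos \<beta> / sin \<beta>\<bar> * x\<^sup>2"
      using bc_form_bound[of \<beta> "w b" "U b"] bw mult_left_mono[OF wx[OF b_in], of "\<bar>cos \<beta> / sin \<beta>\<bar>"]
      unfolding bvp_def right_bc_def by linarith
    have Ua: "cmod (U a * cnj (w a)) \<le> \<bar>cos \<alpha> / sin \<alpha>\<bar> * x\<^sup>2"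
      using bc_form_bound[of \<alpha> "w a" "U a"] bw mult_left_mono[OF wx[OF a_in], of "\<bar>cos \<alpha> / sin \<alpha>\<bar>"]
      unfolding bvp_def left_bc_def by linarith
    have "N2 = (\<Sum>\<nu>\<in>F. Re \<nu> * (cmod (c \<nu>))\<^sup>2) - Re (LINT t|M. of_real (q t) * w t * cnj (w t))
         + (Re (U b * cnj (w b)) - Re (U a * cnj (w a)))"
      using arg_cong[OF energy, of Re] by simp
    also have "\<dots> < Cc * x\<^sup>2"
    proof -
      have "\<bar>Re (LINT t|M. of_real (q t) * w t * cnj (w t))\<bar> \<le> (LINT t|M. \<bar>q t\<bar>) * x\<^sup>2"
        "\<bar>Re (U b * cnj (w b))\<bar> \<le> \<bar>cos \<beta> / sin \<beta>\<bar> * x\<^sup>2" "\<bar>Re (U a * cnj (w a))\<bar> \<le> \<bar>cos \<alpha> / sin \<alpha>\<bar> * x\<^sup>2"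
        using qb Ub Ua abs_Re_le_cmod order_trans by blast+
      then show ?thesis using neg unfolding Cc_def distrib_right by linarith
    qed
    finally have N2lt: "N2 < Cc * x\<^sup>2" .
    \<comment> \<open>The increment of \<open>w\<close> is \<open>\<integral> r U\<close>, and \<open>2 |U| \<le> k + |U|\<^sup>2 / k\<close>.  As \<open>w\<close> vanishes on the grid, the choice
       \<open>k = x / \<delta>\<close> gives \<open>x\<^sup>2 \<le> \<delta> N2\<close> for the maximum \<open>x\<close> of \<open>|w|\<close>.\<close>
    have inc: "cmod (w t' - w t) \<le> (k * \<delta> + N2 / k) / 2"
      if k: "k > 0" and t: "a \<le> t" "t \<le> t'" "t' \<le> b" and d: "\<rho> t' - \<rho> t \<le> \<delta>" for k t t'
    proof -
      define h where "h = (\<lambda>t. (k / 2) * r t + (1 / (2 * k)) * (r t * (cmod (U t))\<^sup>2))"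
      have rU_on: "(\<lambda>t. r t * (cmod (U t))\<^sup>2) integrable_on {a..b}" by (rule integrable_on_lebesgue_on[OF rU']) simp
      have h_on: "h integrable_on {a..b}" unfolding h_def using r_on rU_on by (intro integrable_add integrable_on_mult_right)
      have "cmod (w t' - w t) \<le> integral {t..t'} h"
      proof (rule primitive_increment_bound[OF wp t h_on])
        fix x assume x: "x \<in> {a..b}"
        have "2 * k * cmod (U x) \<le> k\<^sup>2 + (cmod (U x))\<^sup>2" by (rule sum_squares_bound)
        then have "cmod (U x) \<le> k / 2 + 1 / (2 * k) * (cmod (U x))\<^sup>2" using k by (simp add: field_simps power2_eq_square)
        then have "r x * cmod (U x) \<le> r x * (k / 2 + 1 / (2 * k) * (cmod (U x))\<^sup>2)" using r0[OF x] by (rule mult_left_mono)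
        also have "\<dots> = h x" by (simp add: h_def algebra_simps)
        finally show "cmod (of_real (r x) * U x) \<le> h x" using r0[OF x] by (simp add: norm_mult)
      qed
      also have "\<dots> = (k / 2) * integral {t..t'} r + (1 / (2 * k)) * integral {t..t'} (\<lambda>t. r t * (cmod (U t))\<^sup>2)"
      proof -
        have "(\<lambda>t. r t * (cmod (U t))\<^sup>2) integrable_on {t..t'}"
          using integrable_on_subinterval[OF rU_on, of t t'] t by auto
        then have "(\<lambda>s. (1 / (2 * k)) * (r s * (cmod (U s))\<^sup>2)) integrable_on {t..t'}" by (rule integrable_on_mult_right)
        moreover have "(\<lambda>s. (k / 2) * r s) integrable_on {t..t'}" using t by (intro integrable_on_mult_right r_onuv)
        ultimately show ?thesis
          unfolding h_def by (simp only: Henstock_Kurzweil_Integration.integral_add integral_mult_right)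
      qed
      also have "\<dots> \<le> (k / 2) * \<delta> + (1 / (2 * k)) * N2"
      proof (intro add_mono mult_left_mono)
        show "integral {t..t'} r \<le> \<delta>" using \<rho>_diff[OF t] d by simp
        have "integral {t..t'} (\<lambda>t. r t * (cmod (U t))\<^sup>2) \<le> integral {a..b} (\<lambda>t. r t * (cmod (U t))\<^sup>2)"
          using t r0 by (intro integral_subset_le integrable_on_subinterval[OF rU_on] rU_on) auto
        then show "integral {t..t'} (\<lambda>t. r t * (cmod (U t))\<^sup>2) \<le> N2"
          using lebesgue_integral_eq_integral[OF rU'] by (simp add: N2_def)
      qed (use k in auto)
      also have "\<dots> = (k * \<delta> + N2 / k) / 2" using k by (simp add: field_simps)
      finally show ?thesis .
    qed
    obtain j where j: "j \<le> n" "\<bar>\<rho> s - \<rho> (\<tau> j)\<bar> \<le> \<delta>" using near[OF s(1)] by blast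
    have xb: "x \<le> (k * \<delta> + N2 / k) / 2" if k: "k > 0" for k
      using inc[OF k, of "\<tau> j" s] inc[OF k, of s "\<tau> j"] \<tau>[OF j(1)] j(2) s(1) wzero[OF j(1)]
      by (cases "\<tau> j \<le> s") (auto simp: x_def)
    have x2: "x\<^sup>2 \<le> \<delta> * N2"
    proof (cases "x = 0")
      case True
      then show ?thesis using N20 \<delta> by simp
    next
      case False
      then have xp: "x > 0" using x0 by simp
      have "x \<le> ((x / \<delta>) * \<delta> + N2 / (x / \<delta>)) / 2" using xp \<delta> by (intro xb) simp
      then show ?thesis using xp \<delta> by (simp add: field_simps power2_eq_square)
    qed
    have "Cc * x\<^sup>2 \<le> Cc * (\<delta> * N2)" using x2 Cc0 by (rule mult_left_mono)
    also have "\<dots> = (Cc * \<delta>) * N2" by simp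
    also have "\<dots> \<le> 1 * N2" using Cc\<delta> N20 by (rule mult_right_mono)
    finally show False using N2lt by simp
  qed
  then show ?thesis by (rule finite_if_finite_subsets_card_bdd[THEN conjunct1])
qed

lemma EV_bounded_below:
  assumes "\<forall>t\<in>{a..b}. 0 \<le> p t"
  shows "\<exists>\<mu>\<^sub>0\<in>EV. \<forall>\<mu>\<in>EV. Re \<mu>\<^sub>0 \<le> Re \<mu>"
proof -
  obtain \<nu> where \<nu>: "\<nu> \<in> EV" using EV_infinite by fastforce
  define S where "S = {\<mu>\<in>EV. Re \<mu> < 0} \<union> {\<mu>\<in>EV. cmod \<mu> \<le> cmod \<nu>}"
  have fin: "finite S" unfolding S_def using finite_negative_EV[OF assms] finite_EV_ball by simp
  have "\<nu> \<in> S" using \<nu> by (simp add: S_def)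
  then obtain \<mu>\<^sub>0 where m: "\<mu>\<^sub>0 \<in> S" "\<And>\<mu>. \<mu> \<in> S \<Longrightarrow> Re \<mu>\<^sub>0 \<le> Re \<mu>"
    using arg_min_if_finite[OF fin, of Re] by (metis empty_iff not_le)
  have "Re \<mu>\<^sub>0 \<le> Re \<mu>" if \<mu>: "\<mu> \<in> EV" for \<mu>
  proof (cases "\<mu> \<in> S")
    case False
    then have "Re \<mu> \<ge> 0" "cmod \<nu> < cmod \<mu>" using \<mu> by (auto simp: S_def)
    moreover have "cmod \<mu> = \<bar>Re \<mu>\<bar>"
      using EV_real[OF \<mu>] by (simp add: complex_eq_iff cmod_eq_Re)
    moreover have "Re \<nu> \<le> cmod \<nu>" by (rule complex_Re_le_cmod)
    ultimately have "Re \<nu> \<le> Re \<mu>" by simp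
    then show ?thesis using m(2)[OF \<open>\<nu> \<in> S\<close>] by simp
  qed (rule m(2))
  then show ?thesis using m(1) by (auto simp: S_def)
qed

end

section \<open>Spectrum and eigenfunction expansion\<close>

theorem corollary5p16:
  fixes a b \<alpha> \<beta> :: real
    and p q \<Delta> :: "real \<Rightarrow> real"
  assumes "a < b"
    and "AE t in lebesgue_on {a..b}. p t \<noteq> 0"
    and "integrable (lebesgue_on {a..b}) (\<lambda>t. 1 / p t)"
    and "integrable (lebesgue_on {a..b}) q"
    and "integrable (lebesgue_on {a..b}) \<Delta>"
    and "\<forall>t\<in>{a..b}. 0 \<le> \<Delta> t"
    and "emeasure lebesgue {t\<in>{a..b}. 0 < \<Delta> t} \<noteq> 0"
  shows
    "(infinite (sl_EV a b p q \<Delta> \<alpha> \<beta>) \<and> countable (sl_EV a b p q \<Delta> \<alpha> \<beta>) \<and>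
      sl_EV a b p q \<Delta> \<alpha> \<beta> \<subseteq> \<real> \<and>
      (\<forall>z. \<not> z islimpt sl_EV a b p q \<Delta> \<alpha> \<beta>) \<and>
      (\<forall>\<mu>\<in>sl_EV a b p q \<Delta> \<alpha> \<beta>. cfun_dim (sl_sols a b p q \<Delta> \<alpha> \<beta> \<mu>) = 1))
     \<and>
     ((\<forall>t\<in>{a..b}. 0 \<le> p t) \<longrightarrow>
      (\<exists>\<mu>\<^sub>0\<in>sl_EV a b p q \<Delta> \<alpha> \<beta>. \<forall>\<mu>\<in>sl_EV a b p q \<Delta> \<alpha> \<beta>. Re \<mu>\<^sub>0 \<le> Re \<mu>))
     \<and>
     (\<forall>(ev :: nat \<Rightarrow> complex) (v :: nat \<Rightarrow> real \<Rightarrow> complex).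
      inj ev \<and> range ev = sl_EV a b p q \<Delta> \<alpha> \<beta> \<and>
      (\<forall>k. v k \<in> sl_sols a b p q \<Delta> \<alpha> \<beta> (ev k) \<and> wnorm a b \<Delta> (v k) = 1) \<longrightarrow>
      (\<forall>y\<in>sl_F a b p q \<Delta> \<alpha> \<beta>.
         (\<forall>t\<in>{a..b}. summable (\<lambda>k. cmod (wip a b \<Delta> y (v k) * v k t))) \<and>
         (\<forall>t\<in>{a..b}. (\<lambda>k. wip a b \<Delta> y (v k) * v k t) sums y t) \<and>
         uniform_limit {a..b} (\<lambda>n t. \<Sum>k<n. wip a b \<Delta> y (v k) * v k t) y sequentially))"
proof -
  interpret sturm_liouville a b \<Delta> p q \<alpha> \<beta>
    by unfold_locales (use assms in auto)
  have iii: "(\<forall>t\<in>{a..b}. summable (\<lambda>k. cmod (wip a b \<Delta> y (v k) * v k t))) \<and>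
         (\<forall>t\<in>{a..b}. (\<lambda>k. wip a b \<Delta> y (v k) * v k t) sums y t) \<and>
         uniform_limit {a..b} (\<lambda>n t. \<Sum>k<n. wip a b \<Delta> y (v k) * v k t) y sequentially"
    if ev: "inj ev" "range ev = EV" and v: "\<And>k. v k \<in> L (ev k) \<and> wnorm a b \<Delta> (v k) = 1"
      and y: "y \<in> sl_F a b p q \<Delta> \<alpha> \<beta>" for ev :: "nat \<Rightarrow> complex" and v y
  proof -
    have vL: "v k \<in> L (ev k)" and vn: "hs.nrm (v k) = 1" for k using v wnorm_eq_nrm by auto
    note ex = eigenfunction_expansion[OF ev vL vn y]
    have "(\<lambda>k. wip a b \<Delta> y (v k) * v k t) sums y t" if "t \<in> {a..b}" for t
      unfolding sums_def by (rule tendsto_uniform_limitI[OF ex(2) that])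
    then show ?thesis using ex by blast
  qed
  show ?thesis
  proof (intro conjI ballI allI impI)
    show "infinite EV" by (rule EV_infinite)
    show "countable EV" by (rule EV_countable)
    show "EV \<subseteq> \<real>" by (rule EV_subset_Reals)
    show "\<not> z islimpt EV" for z by (rule EV_no_limpt)
    show "cfun_dim (L \<mu>) = 1" if "\<mu> \<in> EV" for \<mu> by (rule sols_dim[OF that])
    show "\<exists>\<mu>\<^sub>0\<in>EV. \<forall>\<mu>\<in>EV. Re \<mu>\<^sub>0 \<le> Re \<mu>" if "\<forall>t\<in>{a..b}. 0 \<le> p t" by (rule EV_bounded_below[OF that])
  qed (use iii in blast)+
qed

end
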